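(* Let $n$ range over a sequence of natural numbers $n\ge 2$ going to infinity. For each $n$ in this sequence let $f=f^{(n)}$ be a monic polynomial of degree $n$ with all zeroes in $\overline{D(0,1)}$, and let $a=a^{(n)}\in[0,1]$ be such that $f(a)=0$ and $f'$ has no zeroes in $\overline{D(a,1)}$. Suppose that $a^{(n)}$ converges to a limit $a^{(\infty)}\in[0,1]$ as $n\to\infty$. Let $\lambda=\lambda^{(n)}$ be a zero of $f$ chosen uniformly at random from the $n$ zeroes of $f$ (counting multiplicity), and let $\zeta=\zeta^{(n)}$ be a zero of $f'$ chosen uniformly at random from the $n-1$ zeroes of $f'$ (counting multiplicity), independently of $\lambda$. Suppose that $\lambda,\zeta$ converge in distribution as $n\to\infty$ to random variables $\lambda^{(\infty)},\zeta^{(\infty)}$ respectively, taking values in $\overline{D(0,1)}$. (i) If $a^{(\infty)}=0$, then $\lambda^{(\infty)}$ and $\zeta^{(\infty)}$ almost surely lie in the semicircle $C:=\{e^{i\theta}:\pi/2\le\theta\le 3\pi/2\}$ and have the same distribution. In particular, $\mathrm{dist}(\lambda,C)$ converges in probability to zero. In fact, for every compact set $K\subset\overline{D(0,1)}\setminus C$ not depending on $n$, there is a constant $A$ not depending on $n$ such that, for all $n$ in the sequence, $$\mathbb{P}(\lambda\in K)\le A\left(a+\frac{\log n}{n^{1/3}}\right).$$ (ii) If $a^{(\infty)}=1$, then $\lambda^{(\infty)}$ is uniformly distributed on the unit circle $\partial D(0,1)$, and $\zeta^{(\infty)}$ is almost surely zero. In particular, $|\lambda|$ converges in probability to $1$ and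 $\zeta$ converges in probability to $0$. In fact there is a constant $A$ not depending on $n$ such that, for all sufficiently large $n$ in the sequence, $$\mathbb{E}\log\frac{1}{|\lambda|}\le\frac{A}{n}\quad\text{and}\quad \mathbb{E}\log|\zeta-a|\le\frac{A}{n}.$$
   Context: $D(z_0,r)=\{z\in\mathbb{C}:|z-z_0|<r\}$, $\overline{D(z_0,r)}=\{z\in\mathbb{C}:|z-z_0|\le r\}$, $\partial D(z_0,r)=\{z\in\mathbb{C}:|z-z_0|=r\}$. The random variables for different $n$ may live on different probability spaces. A sequence of complex random variables $X^{(n)}$ converges in probability to a constant $c$ if $\mathbb{P}(|X^{(n)}-c|\le\varepsilon)\to1$ as $n\to\infty$ for every fixed $\varepsilon>0$. It converges in distribution to $X^{(\infty)}$ if $\mathbb{E}\varphi(X^{(n)})\to\mathbb{E}\varphi(X^{(\infty)})$ for every fixed bounded continuous $\varphi:\mathbb{C}\to\mathbb{C}$. Note that $|\lambda|\le 1$ and $|\zeta-a|>1$ surely, so the two expectations in (ii) are of non-negative quantities. *)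

theory Defs
  imports "HOL-Probability.Probability"
begin

text \<open>The spaces \<open>M k\<close> are allowed to differ with \<open>k\<close>; the target constant is deterministic.\<close>

definition converges_in_probability ::
  "(nat \<Rightarrow> 'a measure) \<Rightarrow> (nat \<Rightarrow> 'a \<Rightarrow> 'b::real_normed_vector) \<Rightarrow> 'b \<Rightarrow> bool" where
  "converges_in_probability M X c \<longleftrightarrow>
     (\<forall>\<epsilon>>0. (\<lambda>k. measure (M k) {\<omega> \<in> space (M k). norm (X k \<omega> - c) \<le> \<epsilon>}) \<longlonglongrightarrow> 1)"

definition converges_in_distribution ::
  "(nat \<Rightarrow> 'a measure) \<Rightarrow> (nat \<Rightarrow> 'a \<Rightarrow> complex) \<Rightarrow> 'b measure \<Rightarrow> ('b \<Rightarrow> complex) \<Rightarrow> bool" where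
  "converges_in_distribution M X P Y \<longleftrightarrow>
     (\<forall>\<phi> :: complex \<Rightarrow> complex. continuous_on UNIV \<phi> \<longrightarrow> bounded (range \<phi>) \<longrightarrow>
        (\<lambda>k. \<integral>\<omega>. \<phi> (X k \<omega>) \<partial>M k) \<longlonglongrightarrow> (\<integral>\<omega>. \<phi> (Y \<omega>) \<partial>P))"

text \<open>\<open>X\<close> is a zero of \<open>p\<close> drawn uniformly, counting multiplicity: \<open>proots p\<close> is the multiset of
  zeroes. The value is a zero for every outcome, not just almost every one.\<close>

definition uniform_random_zero :: "'a measure \<Rightarrow> ('a \<Rightarrow> complex) \<Rightarrow> complex poly \<Rightarrow> bool" where
  "uniform_random_zero M X p \<longleftrightarrow>
     X \<in> borel_measurable M \<and>
     (\<forall>\<omega>\<in>space M. X \<omega> \<in># proots p) \<and>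
     (\<forall>z. measure M {\<omega> \<in> space M. X \<omega> = z} = count (proots p) z / size (proots p))"

definition left_semicircle :: "complex set" where
  "left_semicircle = {exp (\<i> * of_real \<theta>) | \<theta>. pi / 2 \<le> \<theta> \<and> \<theta> \<le> 3 * pi / 2}"

text \<open>The uniform probability measure on the unit circle: the law of \<open>exp (\<i>\<theta>)\<close> for
  \<open>\<theta>\<close> uniform on \<open>[0, 2\<pi>]\<close>.\<close>

definition uniform_unit_circle :: "complex measure" where
  "uniform_unit_circle =
     distr (uniform_measure lborel {0..2 * pi}) borel (\<lambda>\<theta>. exp (\<i> * of_real \<theta>))"

text \<open>\<open>log (1 / x)\<close> for \<open>0 \<le> x \<le> 1\<close>, with the value \<open>\<infinity>\<close> at \<open>x = 0\<close> (in contrast to the convention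
  \<open>ln (1 / 0) = 0\<close> on the reals); this matters because \<open>0\<close> may be a zero of the polynomial.\<close>

definition log_recip :: "real \<Rightarrow> ennreal" where
  "log_recip x = (if x = 0 then \<infinity> else ennreal (ln (1 / x)))"

end

theory Submission
  imports
    Defs
    "HOL-Complex_Analysis.Complex_Analysis"
    "HOL-Computational_Algebra.Fundamental_Theorem_Algebra"
    "HOL-Real_Asymp.Real_Asymp"
begin

text \<open>
  Call \<open>(f, a)\<close> an exception if it satisfies the hypotheses of the theorem for a single \<open>n\<close>; write
  \<open>\<lambda>\<close> and \<open>\<zeta>\<close> for a random zero and a random critical point. By Gauss--Lucas \<open>|\<zeta>| \<le> 1\<close>.

  Both parts use that \<open>\<lambda>\<close> and \<open>\<zeta>\<close> have nearly the same moments. Outside the unit disc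
  \<open>z f'(z) / (n f(z)) = E z / (z - \<lambda>)\<close> has real part at least \<open>1/2\<close>. Its logarithmic derivative, as a
  function of \<open>1/z\<close>, is the generating function of the differences of the power sums of zeroes and
  critical points, so Cauchy's inequality bounds these differences by a multiple of \<open>k\<^sup>2\<close>
  (\<open>power_sum_diff_le\<close>), and \<open>|E \<lambda>\<^sup>k - E \<zeta>\<^sup>k| = O(k / sqrt n)\<close> (\<open>root_mean_power_diff_le\<close>).

  For \<open>a \<rightarrow> 0\<close>, every critical point lies in the lune \<open>|z| \<le> 1 < |z - a|\<close>, hence within \<open>2 a\<close> of
  the semicircle \<open>C\<close>. There is a power series \<open>F\<close>, with coefficients of size \<open>k\<^sup>-\<^sup>3\<close>, whose real part
  vanishes on \<open>C\<close> and is positive on the rest of the closed disc (\<open>Re_barrier_unit_circle\<close>,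
  \<open>Re_barrier_pos\<close>). Comparing moments, \<open>E Re F(\<lambda>) \<le> E Re F(\<zeta>) + O(1 / sqrt n) = O(a + 1 / sqrt n)\<close>,
  and Markov's inequality bounds \<open>P(\<lambda> \<in> K)\<close>. So both limit laws live on \<open>C\<close>; having the same moments
  they agree, because trigonometric polynomials are dense in the continuous functions on the circle.

  For \<open>a \<rightarrow> 1\<close>, put \<open>v = 1 / (a - \<zeta>)\<close>, so \<open>|v| \<le> 1\<close>, and let \<open>m = n - 1\<close> be the degree of \<open>f'\<close>.
  Since \<open>f(a + w)\<close> is the integral of \<open>f'\<close> over the segment from \<open>a\<close> to \<open>a + w\<close>, Laplace's method
  gives \<open>|f(a + w)| \<ge> |f'(a)| / (2 m)\<close> as soon as \<open>f'\<close> decays exponentially along that segment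
  (\<open>laplace_lower_bound\<close>). This is used twice.

  On \<open>|z| = 1\<close> one has \<open>|f(z)| \<le> (2/n) |f'(z)|\<close>, so exponential decay from \<open>a\<close> to a point \<open>z\<close> of the
  circle is impossible. Expanding \<open>E log |1 + w v|\<close> to second order at a point \<open>z = a + w\<close> close
  to \<open>1\<close>, this forces \<open>Re E v \<le> Re E v\<^sup>2\<close> in the limit (\<open>critical_moments_limit\<close>). But
  \<open>Re v \<ge> 1/2\<close> and \<open>|v| \<le> 1\<close> imply \<open>Re v\<^sup>2 \<le> Re v\<close>, with equality only for \<open>v = 1\<close>. Hence \<open>\<zeta> \<rightarrow> 0\<close>.

  Now \<open>E v \<rightarrow> 1\<close>, so \<open>f'\<close> decays from \<open>a\<close> to \<open>0\<close>, and \<open>|f(0)| \<ge> |f'(a)| / (2 m)\<close>. In terms of the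
  roots, the product of all \<open>|a - \<zeta>|\<close> is at most twice the product of all \<open>|\<lambda>|\<close>. The former is at
  least \<open>1\<close> and the latter at most \<open>1\<close>, so the logarithms of both are bounded: these are the two
  expectation bounds (\<open>root_means_log_le\<close>). In particular \<open>|\<lambda>| \<rightarrow> 1\<close>, and all moments of \<open>\<lambda>\<close> tend
  to those of \<open>\<zeta>\<close>, that is to \<open>0\<close>: the limit is uniform on the circle.
\<close>

section \<open>Zeroes and logarithmic derivatives\<close>

lemma poly_eq_prod_proots:
  fixes p :: "complex poly"
  shows "poly p z = lead_coeff p * (\<Prod>x\<in>#proots p. z - x)"
proof -
  have "poly p z = poly (smult (lead_coeff p) (\<Prod>x\<in>#proots p. [:-x, 1:])) z"
    by (simp only: complex_poly_decompose_multiset)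
  then show ?thesis by (simp add: poly_prod_mset)
qed

lemma poly_pderiv_eq_sum_proots:
  fixes p :: "complex poly"
  assumes "poly p z \<noteq> 0"
  shows "poly (pderiv p) z = poly p z * (\<Sum>x\<in>#proots p. 1 / (z - x))"
proof -
  have *: "z \<notin># A \<Longrightarrow> poly (pderiv (\<Prod>x\<in>#A. [:-x, 1:])) z
      = poly (\<Prod>x\<in>#A. [:-x, 1:]) z * (\<Sum>x\<in>#A. 1 / (z - x))" for A :: "complex multiset"
  proof (induction A)
    case (add x A)
    have "poly (pderiv [:-x, 1:]) z = 1" by (simp add: pderiv_pCons)
    with add show ?case
      by (simp add: pderiv_mult del: mult_pCons_left) (simp add: field_simps)
  qed simp
  have "z \<notin># proots p"
    using assms by (cases "p = 0") auto
  with * have "poly (pderiv (smult (lead_coeff p) (\<Prod>x\<in>#proots p. [:-x, 1:]))) z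
      = poly (smult (lead_coeff p) (\<Prod>x\<in>#proots p. [:-x, 1:])) z * (\<Sum>x\<in>#proots p. 1 / (z - x))"
    by (simp add: pderiv_smult)
  then show ?thesis
    by (simp only: complex_poly_decompose_multiset)
qed

lemma Re_sum_mset: "Re (\<Sum>x\<in>#A. g x) = (\<Sum>x\<in>#A. Re (g x))"
  by (induction A) auto

lemma norm_sum_mset_le:
  fixes g :: "'a \<Rightarrow> 'b::real_normed_vector"
  shows "(\<And>x. x \<in># A \<Longrightarrow> norm (g x) \<le> b) \<Longrightarrow> norm (\<Sum>x\<in>#A. g x) \<le> real (size A) * b"
proof (induction A)
  case (add x A)
  then have "norm (g x + (\<Sum>x\<in>#A. g x)) \<le> b + real (size A) * b"
    by (intro norm_triangle_mono) auto
  then show ?case by (simp add: algebra_simps)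
qed auto

lemma norm_prod_mset: "norm (\<Prod>x\<in>#A. g x :: complex) = (\<Prod>x\<in>#A. norm (g x))"
  by (induction A) (auto simp: norm_mult)

lemma sum_mset_ge:
  fixes g :: "'a \<Rightarrow> real"
  shows "(\<And>x. x \<in># A \<Longrightarrow> b \<le> g x) \<Longrightarrow> real (size A) * b \<le> (\<Sum>x\<in>#A. g x)"
proof (induction A)
  case (add x A)
  then have "b + real (size A) * b \<le> g x + (\<Sum>x\<in>#A. g x)"
    by (intro add_mono) auto
  then show ?case by (simp add: algebra_simps)
qed auto

text \<open>The map \<open>u \<mapsto> 1 / (1 - u)\<close> sends the unit disc to the half plane right of \<open>1/2\<close>.\<close>

lemma Re_inverse_one_minus_ge_half:
  fixes u :: complex
  assumes "norm u \<le> 1" "u \<noteq> 1"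
  shows "1 / 2 \<le> Re (1 / (1 - u))"
proof -
  have "(norm u)\<^sup>2 \<le> 1" using assms by (simp add: abs_square_le_1)
  then have "(1 - Re u)\<^sup>2 + (Im u)\<^sup>2 \<le> 2 * (1 - Re u)"
    unfolding cmod_power2 by (simp add: power2_eq_square algebra_simps)
  moreover have "(1 - Re u)\<^sup>2 + (Im u)\<^sup>2 > 0"
    using assms(2) by (metis Re_complex_of_real Im_complex_of_real complex_eqI of_real_1 eq_iff_diff_eq_0 less_eq_real_def
      sum_power2_gt_zero_iff)
  ultimately show ?thesis
    by (simp add: Re_divide field_simps)
qed

lemma norm_proots_le:
  fixes f :: "complex poly"
  assumes "\<And>x. poly f x = 0 \<Longrightarrow> x \<in> cball 0 1" "f \<noteq> 0" "x \<in># proots f"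
  shows "norm x \<le> 1"
  using assms by auto

text \<open>Each zero \<open>x\<close> contributes \<open>z / (z - x) = 1 / (1 - x / z)\<close> to \<open>z f'(z) / f(z)\<close>, and these terms
  all have real part at least \<open>1/2\<close>, so that they cannot cancel.\<close>

lemma norm_pderiv_ge_outside_disc:
  fixes f :: "complex poly"
  assumes roots: "\<And>x. poly f x = 0 \<Longrightarrow> x \<in> cball 0 1" and z: "1 \<le> norm z"
  shows "degree f / 2 * norm (poly f z) \<le> norm (z * poly (pderiv f) z)"
proof (cases "poly f z = 0")
  case False
  then have f0: "f \<noteq> 0" by auto
  have nz: "z \<noteq> 0" using z by auto
  have 1: "1 / 2 \<le> Re (z / (z - x))" if "x \<in># proots f" for x
  proof -
    have "norm x \<le> 1" using norm_proots_le[of f, OF roots f0 that] .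
    then have "norm (x / z) \<le> 1" using z by (simp add: norm_divide divide_le_eq_1)
    moreover have "x \<noteq> z" using that False f0 by auto
    ultimately have "1 / 2 \<le> Re (1 / (1 - x / z))"
      using nz by (intro Re_inverse_one_minus_ge_half) auto
    also have "1 / (1 - x / z) = z / (z - x)" using nz \<open>x \<noteq> z\<close> by (simp add: field_simps)
    finally show ?thesis .
  qed
  have "degree f / 2 \<le> (\<Sum>x\<in>#proots f. Re (z / (z - x)))"
    using sum_mset_ge[of "proots f" "1/2", OF 1] by (simp add: size_proots_complex)
  also have "\<dots> = Re (z * (\<Sum>x\<in>#proots f. 1 / (z - x)))"
    by (simp add: Re_sum_mset[symmetric] sum_mset_distrib_left)
  also have "\<dots> \<le> norm (z * (\<Sum>x\<in>#proots f. 1 / (z - x)))"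
    by (rule complex_Re_le_cmod)
  finally have "degree f / 2 * norm (poly f z) \<le> norm (z * (\<Sum>x\<in>#proots f. 1 / (z - x))) * norm (poly f z)"
    by (rule mult_right_mono) auto
  also have "\<dots> = norm (z * poly (pderiv f) z)"
    by (simp add: poly_pderiv_eq_sum_proots[OF False] norm_mult)
  finally show ?thesis .
qed auto

lemma pderiv_roots_in_disc:
  fixes f :: "complex poly"
  assumes roots: "\<And>x. poly f x = 0 \<Longrightarrow> x \<in> cball 0 1" and "degree f \<noteq> 0"
    and "poly (pderiv f) z = 0"
  shows "z \<in> cball 0 1"
proof (rule ccontr)
  assume "z \<notin> cball 0 1"
  then have "1 < norm z" by simp
  moreover from this have "poly f z \<noteq> 0" using roots[of z] by auto
  ultimately show False
    using norm_pderiv_ge_outside_disc[of f z, OF roots] assms by (auto simp: mult_le_0_iff)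
qed

section \<open>Power sums of the zeroes and of the critical points\<close>

lemma power_sum_generating_function:
  fixes q :: complex
  assumes "norm q < 1" "\<And>x. x \<in># A \<Longrightarrow> norm x \<le> 1"
  shows "(\<lambda>k. (\<Sum>x\<in>#A. x ^ Suc k) * q ^ k) sums (\<Sum>x\<in>#A. x / (1 - x * q))"
  using assms(2)
proof (induction A)
  case (add x A)
  then have "norm (x * q) \<le> 1 * norm q"
    unfolding norm_mult by (intro mult_right_mono) auto
  with assms(1) have "norm (x * q) < 1" by simp
  then have "(\<lambda>k. x * (x * q) ^ k) sums (x * (1 / (1 - x * q)))"
    by (intro sums_mult geometric_sums)
  then have "(\<lambda>k. x ^ Suc k * q ^ k) sums (x / (1 - x * q))"
    by (simp add: power_mult_distrib mult_ac)
  from sums_add[OF this add.IH] add.prems show ?case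
    by (simp add: algebra_simps)
qed simp

text \<open>With \<open>z = 1 / q\<close> and \<open>S = f' / f\<close>, the identity \<open>f'' / f' = S + S' / S\<close> turns the difference of the
  two generating functions into \<open>- z (1 + z S' / S)\<close>. Here \<open>|z S| \<ge> n/2\<close> by the half-plane bound,
  and \<open>- z\<^sup>2 S'\<close> is a sum of \<open>n\<close> terms \<open>1 / (1 - x q)\<^sup>2\<close>.\<close>

lemma power_sum_diff_generating_function_le:
  fixes f :: "complex poly"
  assumes roots: "\<And>x. poly f x = 0 \<Longrightarrow> x \<in> cball 0 1" and deg: "degree f \<noteq> 0"
    and q: "q \<noteq> 0" "norm q < 1"
  defines "D \<equiv> \<lambda>q. (\<Sum>x\<in>#proots f. x / (1 - x * q)) - (\<Sum>x\<in>#proots (pderiv f). x / (1 - x * q))"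
  shows "norm (D q) \<le> (1 + 2 / (1 - norm q)\<^sup>2) / norm q"
proof -
  define z where "z = 1 / q"
  have z: "1 < norm z" "z \<noteq> 0" using q by (auto simp: z_def norm_divide)
  have f0: "f \<noteq> 0" and f'0: "pderiv f \<noteq> 0" using deg by (auto simp: pderiv_eq_0_iff)
  define n where "n = degree f"
  have out: "poly f w \<noteq> 0 \<and> poly (pderiv f) w \<noteq> 0" if "1 < norm w" for w
    using roots[of w] pderiv_roots_in_disc[of f w, OF roots deg] that by auto
  define S where "S = (\<lambda>w. \<Sum>x\<in>#proots f. 1 / (w - x))"
  define T where "T = (\<Sum>x\<in>#proots f. 1 / (z - x)\<^sup>2)"
  have nx: "z \<noteq> x" if "x \<in># proots f" for x using out[OF z(1)] that f0 by auto
  have nx': "z \<noteq> x" if "x \<in># proots (pderiv f)" for x using out[OF z(1)] that f'0 by auto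
  have dS: "(S has_field_derivative - T) (at z)"
  proof -
    have "(\<forall>x. x \<in># A \<longrightarrow> z \<noteq> x) \<Longrightarrow>
        ((\<lambda>w. \<Sum>x\<in>#A. 1 / (w - x)) has_field_derivative - (\<Sum>x\<in>#A. 1 / (z - x)\<^sup>2)) (at z)" for A
      by (induction A) (auto intro!: derivative_eq_intros simp: power2_eq_square field_simps)
    with nx show ?thesis unfolding S_def T_def by auto
  qed
  have f': "poly (pderiv f) w = poly f w * S w" if "1 < norm w" for w
    unfolding S_def using poly_pderiv_eq_sum_proots out[OF that] by blast
  have "((\<lambda>w. poly f w * S w) has_field_derivative (poly (pderiv f) z * S z + poly f z * (- T))) (at z)"
    by (rule derivative_eq_intros poly_DERIV dS refl)+ simp
  moreover have "((\<lambda>w. poly f w * S w) has_field_derivative poly (pderiv (pderiv f)) z) (at z)"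
  proof (rule has_field_derivative_transform_within_open[OF poly_DERIV[of "pderiv f"]])
    show "open (- cball (0::complex) 1)" "z \<in> - cball 0 1" using z by auto
    show "\<And>w. w \<in> - cball 0 1 \<Longrightarrow> poly (pderiv f) w = poly f w * S w" using f' by auto
  qed
  ultimately have f'': "poly (pderiv (pderiv f)) z = poly (pderiv f) z * S z - poly f z * T"
    using DERIV_unique by fastforce
  define S' where "S' = (\<Sum>x\<in>#proots (pderiv f). 1 / (z - x))"
  have "poly (pderiv (pderiv f)) z = poly (pderiv f) z * S'"
    unfolding S'_def using poly_pderiv_eq_sum_proots out[OF z(1)] by blast
  with f'' f'[OF z(1)] out[OF z(1)] have SS: "S z * S' = S z * S z - T"
    by (metis (no_types, lifting) mult.assoc mult_cancel_left right_diff_distrib)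
  have Sz: "n / 2 \<le> norm (z * S z)"
    using norm_pderiv_ge_outside_disc[of f z, OF roots] z out[OF z(1)]
    by (simp add: f' norm_mult n_def)
  have n0: "n > 0" using deg by (simp add: n_def)
  then have Sz0: "S z \<noteq> 0" using Sz by auto
  have nT: "norm (z\<^sup>2 * T) \<le> n * (1 / (1 - norm q)\<^sup>2)"
  proof -
    have "norm (z\<^sup>2 / (z - x)\<^sup>2) \<le> 1 / (1 - norm q)\<^sup>2" if "x \<in># proots f" for x
    proof -
      have "norm x \<le> 1" using norm_proots_le[of f, OF roots f0 that] .
      then have "norm (x * q) \<le> norm q" by (simp add: norm_mult mult_left_le_one_le)
      then have *: "1 - norm q \<le> norm (1 - x * q)"
        by (smt (verit) norm_one norm_triangle_ineq2)
      have "z\<^sup>2 / (z - x)\<^sup>2 = 1 / (1 - x * q)\<^sup>2"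
        using q nx[OF that] by (simp add: z_def field_simps)
      then show ?thesis using * q
        by (auto simp: norm_divide norm_power intro!: divide_left_mono power_mono mult_pos_pos)
    qed
    then have "norm (\<Sum>x\<in>#proots f. z\<^sup>2 / (z - x)\<^sup>2) \<le> size (proots f) * (1 / (1 - norm q)\<^sup>2)"
      by (intro norm_sum_mset_le)
    then show ?thesis by (simp add: T_def sum_mset_distrib_left n_def size_proots_complex)
  qed
  have tr: "(\<Sum>x\<in>#A. x / (1 - x * q)) = z\<^sup>2 * (\<Sum>x\<in>#A. 1 / (z - x)) - size A * z"
    if "\<forall>x. x \<in># A \<longrightarrow> z \<noteq> x" for A
  proof -
    have *: "x / (1 - x * q) = z\<^sup>2 * (1 / (z - x)) - z" if "z \<noteq> x" for x
      using that q by (simp add: z_def field_simps power2_eq_square)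
    show ?thesis using that
    proof (induction A)
      case (add x A)
      then have "(\<Sum>x\<in>#A. x / (1 - x * q)) = z\<^sup>2 * (\<Sum>x\<in>#A. 1 / (z - x)) - size A * z" "z \<noteq> x"
        by auto
      then show ?case by (simp add: * ring_distribs)
    qed simp
  qed
  have "D q = z\<^sup>2 * S z - n * z - (z\<^sup>2 * S' - (n - 1) * z)"
    unfolding D_def S_def S'_def using nx nx' n0
    by (simp add: tr size_proots_complex degree_pderiv n_def of_nat_diff)
  also have "\<dots> = z\<^sup>2 * (S z - S') - z"
  proof -
    have "complex_of_nat n = of_nat (n - 1) + 1" using n0 by (simp add: of_nat_diff)
    then show ?thesis by (simp only:) (simp add: algebra_simps)
  qed
  also have "S z - S' = T / S z"
    using SS Sz0 by (simp add: field_simps)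
  also have "z\<^sup>2 * (T / S z) - z = z * (z\<^sup>2 * T / (z * S z) - 1)"
  proof -
    have "z\<^sup>2 * T / (z * S z) = z * (T / S z)" using z by (simp add: power2_eq_square)
    then show ?thesis by (simp only: right_diff_distrib) (simp add: power2_eq_square)
  qed
  finally have "D q = z * (z\<^sup>2 * T / (z * S z) - 1)" .
  then have "norm (D q) = norm z * norm (z\<^sup>2 * T / (z * S z) - 1)"
    by (simp only: norm_mult)
  also have "\<dots> \<le> norm z * (norm (z\<^sup>2 * T / (z * S z)) + norm (1 :: complex))"
    by (intro mult_left_mono norm_triangle_ineq4 norm_ge_zero)
  also have "\<dots> = norm z * (norm (z\<^sup>2 * T) / norm (z * S z) + 1)"
    by (simp only: norm_divide norm_one)
  also have "\<dots> \<le> norm z * (n * (1 / (1 - norm q)\<^sup>2) / (n / 2) + 1)"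
    using nT Sz n0 by (intro mult_left_mono add_right_mono frac_le) auto
  also have "\<dots> = (1 + 2 / (1 - norm q)\<^sup>2) / norm q"
    using n0 by (simp add: z_def norm_divide field_simps)
  finally show ?thesis .
qed

text \<open>Cauchy's inequality on the circle of radius \<open>1 - 1 / (k + 2)\<close>, where the bound on the generating
  function is quadratic in \<open>k\<close>.\<close>

lemma power_sum_diff_le:
  fixes f :: "complex poly"
  assumes roots: "\<And>x. poly f x = 0 \<Longrightarrow> x \<in> cball 0 1" and deg: "degree f \<noteq> 0"
  shows "norm ((\<Sum>x\<in>#proots f. x ^ Suc k) - (\<Sum>x\<in>#proots (pderiv f). x ^ Suc k))
      \<le> 36 * (real (Suc k))\<^sup>2"
proof -
  have f0: "f \<noteq> 0" and f'0: "pderiv f \<noteq> 0" using deg by (auto simp: pderiv_eq_0_iff)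
  define c where "c = (\<lambda>k. (\<Sum>x\<in>#proots f. x ^ Suc k) - (\<Sum>x\<in>#proots (pderiv f). x ^ Suc k))"
  define D where "D \<equiv> \<lambda>q. (\<Sum>x\<in>#proots f. x / (1 - x * q)) - (\<Sum>x\<in>#proots (pderiv f). x / (1 - x * q))"
  have 1: "norm x \<le> 1" if "x \<in># proots f" for x using norm_proots_le[of f, OF roots f0 that] .
  have 2: "norm x \<le> 1" if "x \<in># proots (pderiv f)" for x
    using pderiv_roots_in_disc[of f x, OF roots deg] that f'0 by auto
  have sums: "(\<lambda>k. c k * q ^ k) sums D q" if "norm q < 1" for q
    unfolding D_def c_def left_diff_distrib
    by (intro sums_diff power_sum_generating_function that 1 2)
  have holo: "D holomorphic_on ball 0 1"
    using power_series_holomorphic[of 0 1 c D] sums by simp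
  have "D has_fps_expansion Abs_fps c"
    by (rule has_fps_expansionI) (use sums in \<open>auto simp: eventually_nhds_metric intro!: exI[of _ 1]\<close>)
  from fps_nth_fps_expansion[OF this] have ck: "c k = (deriv ^^ k) D 0 / fact k" by simp
  define r where "r = 1 - 1 / (real k + 2)"
  have r: "0 < r" "r < 1" by (auto simp: r_def field_simps)
  define B where "B = (1 + 2 / (1 - r)\<^sup>2) / r"
  have "norm ((deriv ^^ k) D 0) \<le> fact k * B / r ^ k"
  proof (rule Cauchy_inequality)
    show "D holomorphic_on ball 0 r" "continuous_on (cball 0 r) D"
      using r by (auto intro!: holomorphic_on_imp_continuous_on holomorphic_on_subset[OF holo])
    show "norm (D x) \<le> B" if "norm (0 - x) = r" for x
      using power_sum_diff_generating_function_le[of f x, OF roots deg] that r by (auto simp: D_def B_def)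
  qed (use r in auto)
  then have "norm (c k) \<le> B / r ^ k"
    by (simp add: ck norm_divide divide_le_eq mult.commute)
  also have "\<dots> = (1 + 2 * (real k + 2)\<^sup>2) * (1 / r ^ Suc k)"
    by (simp add: B_def r_def) (simp add: power_divide)
  also have "1 / r ^ Suc k \<le> 3"
  proof -
    have "1 / r = 1 + 1 / real (Suc k)" by (simp add: r_def field_simps)
    then have "1 / r ^ Suc k = (1 + 1 / real (Suc k)) ^ Suc k"
      by (metis power_one_over)
    also have "\<dots> \<le> exp (1 / real (Suc k)) ^ Suc k"
      by (intro power_mono) auto
    also have "\<dots> = exp 1" by (subst exp_of_nat_mult[symmetric]) simp
    also have "\<dots> \<le> 3" by (rule exp_le)
    finally show ?thesis .
  qed
  then have "(1 + 2 * (real k + 2)\<^sup>2) * (1 / r ^ Suc k) \<le> (1 + 2 * (real k + 2)\<^sup>2) * 3"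
    by (intro mult_left_mono) auto
  also have "\<dots> \<le> 36 * (real (Suc k))\<^sup>2"
    by (simp add: power2_eq_square algebra_simps)
  finally show ?thesis by (simp add: c_def)
qed

section \<open>Averages over the zeroes as expectations\<close>

definition root_mean :: "complex poly \<Rightarrow> (complex \<Rightarrow> 'b) \<Rightarrow> 'b::real_vector" where
  "root_mean p \<phi> = (\<Sum>x\<in>#proots p. \<phi> x) /\<^sub>R real (size (proots p))"

lemma sum_mset_eq_sum_count:
  fixes \<phi> :: "'a \<Rightarrow> 'b::real_vector"
  shows "(\<Sum>x\<in>#A. \<phi> x) = (\<Sum>x\<in>set_mset A. real (count A x) *\<^sub>R \<phi> x)"
proof (induction A)
  case (add y A)
  have "(\<Sum>x\<in>set_mset (add_mset y A). real (count (add_mset y A) x) *\<^sub>R \<phi> x)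
      = (\<Sum>x\<in>insert y (set_mset A). real (count A x) *\<^sub>R \<phi> x + (if x = y then \<phi> x else 0))"
    by (intro sum.cong) (auto simp: scaleR_left_distrib)
  also have "\<dots> = (\<Sum>x\<in>insert y (set_mset A). real (count A x) *\<^sub>R \<phi> x) + \<phi> y"
    by (simp add: sum.distrib)
  also have "(\<Sum>x\<in>insert y (set_mset A). real (count A x) *\<^sub>R \<phi> x)
      = (\<Sum>x\<in>set_mset A. real (count A x) *\<^sub>R \<phi> x)"
    by (intro sum.mono_neutral_right) (auto simp: not_in_iff)
  finally show ?case using add by (simp add: add.commute)
qed simp

lemma integral_uniform_random_zero:
  fixes \<phi> :: "complex \<Rightarrow> 'b::{banach, second_countable_topology}"
  assumes M: "prob_space M" and X: "uniform_random_zero M X p"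
  shows "has_bochner_integral M (\<lambda>\<omega>. \<phi> (X \<omega>)) (root_mean p \<phi>)"
proof -
  interpret prob_space M by (rule M)
  have [measurable]: "X \<in> borel_measurable M" using X by (simp add: uniform_random_zero_def)
  define S where "S = set_mset (proots p)"
  have XS: "X \<omega> \<in> S" if "\<omega> \<in> space M" for \<omega>
    using X that by (simp add: uniform_random_zero_def S_def)
  have "has_bochner_integral M (\<lambda>\<omega>. \<Sum>z\<in>S. indicator {\<omega> \<in> space M. X \<omega> = z} \<omega> *\<^sub>R \<phi> z)
      (\<Sum>z\<in>S. measure M {\<omega> \<in> space M. X \<omega> = z} *\<^sub>R \<phi> z)"
    by (intro has_bochner_integral_sum has_bochner_integral_scaleR_left has_bochner_integral_real_indicator)
       (auto simp: emeasure_eq_measure)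
  also have "(\<Sum>z\<in>S. measure M {\<omega> \<in> space M. X \<omega> = z} *\<^sub>R \<phi> z) = root_mean p \<phi>"
    using X by (simp add: root_mean_def sum_mset_eq_sum_count S_def scaleR_sum_right
      uniform_random_zero_def divide_inverse mult.commute del: count_proots)
  also have "has_bochner_integral M (\<lambda>\<omega>. \<Sum>z\<in>S. indicator {\<omega> \<in> space M. X \<omega> = z} \<omega> *\<^sub>R \<phi> z) (root_mean p \<phi>)
      \<longleftrightarrow> ?thesis" (is "?l \<longleftrightarrow> ?r")
  proof (rule has_bochner_integral_cong)
    fix \<omega> assume \<omega>: "\<omega> \<in> space M"
    have "(\<Sum>z\<in>S. indicator {\<omega> \<in> space M. X \<omega> = z} \<omega> *\<^sub>R \<phi> z) = (\<Sum>z\<in>S. if X \<omega> = z then \<phi> z else 0)"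
      using \<omega> by (intro sum.cong) (auto simp: indicator_def)
    also have "\<dots> = \<phi> (X \<omega>)"
      using XS[OF \<omega>] by (simp add: S_def)
    finally show "(\<Sum>z\<in>S. indicator {\<omega> \<in> space M. X \<omega> = z} \<omega> *\<^sub>R \<phi> z) = \<phi> (X \<omega>)" .
  qed auto
  finally show ?thesis .
qed

lemma prob_uniform_random_zero:
  assumes M: "prob_space M" and X: "uniform_random_zero M X p" and "B \<in> sets borel"
  shows "measure M {\<omega> \<in> space M. X \<omega> \<in> B} = root_mean p (indicator B)"
proof -
  interpret prob_space M by (rule M)
  have [measurable]: "X \<in> borel_measurable M" using X by (simp add: uniform_random_zero_def)
  have [measurable]: "{\<omega> \<in> space M. X \<omega> \<in> B} \<in> sets M" using assms(3) by measurable
  have "root_mean p (indicator B) = (\<integral>\<omega>. (indicator B (X \<omega>) :: real) \<partial>M)"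
    by (rule has_bochner_integral_integral_eq[OF integral_uniform_random_zero[OF M X, of "indicat_real B"], symmetric])
  also have "\<dots> = (\<integral>\<omega>. indicator {\<omega> \<in> space M. X \<omega> \<in> B} \<omega> \<partial>M)"
    by (intro Bochner_Integration.integral_cong) (auto simp: indicator_def)
  also have "\<dots> = measure M {\<omega> \<in> space M. X \<omega> \<in> B}"
    by simp
  finally show ?thesis by simp
qed

lemma nn_integral_uniform_random_zero:
  fixes \<phi> :: "complex \<Rightarrow> real"
  assumes M: "prob_space M" and X: "uniform_random_zero M X p"
    and nn: "\<And>x. x \<in># proots p \<Longrightarrow> 0 \<le> \<phi> x"
  shows "(\<integral>\<^sup>+\<omega>. ennreal (\<phi> (X \<omega>)) \<partial>M) = ennreal (root_mean p \<phi>)"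
proof -
  note * = integral_uniform_random_zero[OF M X, of \<phi>]
  have "AE \<omega> in M. 0 \<le> \<phi> (X \<omega>)"
    using X nn by (auto simp: uniform_random_zero_def)
  with * show ?thesis
    by (simp add: nn_integral_eq_integral has_bochner_integral_iff)
qed

lemma root_mean_mono:
  fixes \<phi> \<psi> :: "complex \<Rightarrow> real"
  assumes "\<And>x. x \<in># proots p \<Longrightarrow> \<phi> x \<le> \<psi> x"
  shows "root_mean p \<phi> \<le> root_mean p \<psi>"
proof -
  have "(\<forall>x. x \<in># A \<longrightarrow> \<phi> x \<le> \<psi> x) \<Longrightarrow> (\<Sum>x\<in>#A. \<phi> x) \<le> (\<Sum>x\<in>#A. \<psi> x)" for A
    by (induction A) (auto intro: add_mono)
  then show ?thesis using assms
    by (auto simp: root_mean_def intro!: mult_left_mono)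
qed

lemma root_mean_const [simp]:
  fixes c :: "'b::real_vector"
  assumes "degree p \<noteq> 0" shows "root_mean p (\<lambda>_. c) = c"
proof -
  have "(\<Sum>x\<in>#A. c) = real (size A) *\<^sub>R c" for A :: "complex multiset"
    by (induction A) (auto simp: algebra_simps)
  then show ?thesis using assms by (simp add: root_mean_def size_proots_complex)
qed

lemma root_mean_cmult: "root_mean p (\<lambda>x. c * \<phi> x) = c * root_mean p \<phi>" for c :: "'b::real_algebra_1"
proof -
  show ?thesis unfolding root_mean_def by (simp add: sum_mset_distrib_left)
qed

lemma root_mean_diff: "root_mean p (\<lambda>x. \<phi> x - \<psi> x) = root_mean p \<phi> - root_mean p \<psi>"
  by (simp add: root_mean_def scaleR_right_diff_distrib sum_mset_eq_sum_count sum_subtractf)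

lemma root_mean_add: "root_mean p (\<lambda>x. \<phi> x + \<psi> x) = root_mean p \<phi> + root_mean p \<psi>"
  by (simp add: root_mean_def scaleR_right_distrib sum_mset_eq_sum_count sum.distrib)

lemma root_mean_cong:
  "(\<And>x. x \<in># proots p \<Longrightarrow> \<phi> x = \<psi> x) \<Longrightarrow> root_mean p \<phi> = root_mean p \<psi>"
  unfolding root_mean_def by (metis image_mset_cong)

lemma Re_root_mean: "Re (root_mean p \<phi>) = root_mean p (\<lambda>x. Re (\<phi> x))"
  by (simp add: root_mean_def Re_sum_mset)

lemma norm_root_mean_le:
  fixes \<phi> :: "complex \<Rightarrow> 'b::real_normed_vector"
  assumes "\<And>x. x \<in># proots p \<Longrightarrow> norm (\<phi> x) \<le> b" "0 \<le> b"
  shows "norm (root_mean p \<phi>) \<le> b"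
proof (cases "size (proots p) = 0")
  case False
  have "norm (\<Sum>x\<in>#proots p. \<phi> x) \<le> size (proots p) * b"
    using assms by (intro norm_sum_mset_le)
  with False show ?thesis by (simp add: root_mean_def inverse_eq_divide pos_divide_le_eq nonempty_has_size mult.commute)
qed (use assms in \<open>auto simp: root_mean_def\<close>)

section \<open>Laws on the unit circle are determined by their moments\<close>

text \<open>The indicator of a closed set \<open>A\<close> is the decreasing limit of the continuous functions
  \<open>max 0 (1 - k dist(x, A))\<close>, and closed sets generate the Borel sets.\<close>

lemma measure_eqI_continuous_bounded:
  fixes P Q :: "'a::metric_space measure"
  assumes P: "prob_space P" and Q: "prob_space Q" and sets: "sets P = sets borel" "sets Q = sets borel"
    and eq: "\<And>g :: 'a \<Rightarrow> real. continuous_on UNIV g \<Longrightarrow> (\<And>x. \<bar>g x\<bar> \<le> 1) \<Longrightarrow> (\<integral>x. g x \<partial>P) = (\<integral>x. g x \<partial>Q)"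
  shows "P = Q"
proof -
  interpret P: prob_space P by (rule P)
  interpret Q: prob_space Q by (rule Q)
  have lim: "(\<lambda>k. \<integral>x. max 0 (1 - real k * infdist x A) \<partial>R) \<longlonglongrightarrow> measure R A"
    if "prob_space R" and R: "sets R = sets borel" and A: "closed A" "A \<noteq> {}" for R and A :: "'a set"
  proof -
    interpret R: prob_space R by fact
    have [measurable]: "A \<in> sets R" using A by (simp add: R)
    have [measurable_cong]: "sets R = sets borel" by (rule R)
    have "(\<lambda>k. \<integral>x. max 0 (1 - real k * infdist x A) \<partial>R) \<longlonglongrightarrow> (\<integral>x. indicator A x \<partial>R)"
    proof (rule integral_dominated_convergence[where w="\<lambda>_. 1"])
      show "AE x in R. (\<lambda>k. max 0 (1 - real k * infdist x A)) \<longlonglongrightarrow> indicator A x"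
      proof (rule AE_I2)
        fix x
        show "(\<lambda>k. max 0 (1 - real k * infdist x A)) \<longlonglongrightarrow> indicator A x"
        proof (cases "x \<in> A")
          case False
          then have d: "infdist x A > 0" using A by (metis in_closed_iff_infdist_zero infdist_nonneg less_eq_real_def)
          have "filterlim (\<lambda>k. real k * infdist x A) at_top sequentially"
            by (rule filterlim_at_top_mult_tendsto_pos[OF tendsto_const d filterlim_real_sequentially, THEN filterlim_cong[THEN iffD1, rotated -1]])
               (auto simp: mult.commute)
          then have "\<forall>\<^sub>F k in sequentially. 1 \<le> real k * infdist x A" by (simp add: filterlim_at_top)
          then have "\<forall>\<^sub>F k in sequentially. max 0 (1 - real k * infdist x A) = indicator A x"
            by eventually_elim (use False in auto)
          then show ?thesis by (rule tendsto_eventually)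
        qed simp
      qed
      show "AE x in R. norm (max 0 (1 - real k * infdist x A)) \<le> 1" for k
        by (rule AE_I2) (auto simp: infdist_nonneg)
    qed (auto intro!: borel_measurable_continuous_onI continuous_intros simp: measurable_cong_sets[OF R refl])
    then show ?thesis by simp
  qed
  have "measure P A = measure Q A" if A: "closed A" for A
  proof (cases "A = {}")
    case False
    have "(\<integral>x. max 0 (1 - real k * infdist x A) \<partial>P) = (\<integral>x. max 0 (1 - real k * infdist x A) \<partial>Q)" for k
      by (rule eq) (auto intro!: continuous_intros simp: infdist_nonneg)
    with lim[OF P sets(1) A False] lim[OF Q sets(2) A False] show ?thesis
      using LIMSEQ_unique by auto
  qed simp
  then have "emeasure P A = emeasure Q A" if "closed A" for A
    using that by (simp add: P.emeasure_eq_measure Q.emeasure_eq_measure)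
  moreover have "sets borel = sigma_sets UNIV (Collect (closed :: 'a set \<Rightarrow> bool))"
    by (simp add: borel_eq_closed)
  ultimately show ?thesis
    using sets
    by (intro measure_eqI_generator_eq[where E="Collect closed" and \<Omega>=UNIV and A="\<lambda>_. UNIV"])
       (auto simp: Int_stable_def)
qed

text \<open>On the unit circle \<open>cnj z = 1 / z\<close>, so the moments determine the integrals of all polynomials in
  \<open>z\<close> and \<open>cnj z\<close>; by the Stone--Weierstrass theorem they determine the law.\<close>

lemma unit_circle_law_eqI:
  fixes P Q :: "complex measure"
  assumes P: "prob_space P" and Q: "prob_space Q" and sets: "sets P = sets borel" "sets Q = sets borel"
    and circ: "AE z in P. norm z = 1" "AE z in Q. norm z = 1"
    and mom: "\<And>k. (\<integral>z. z ^ Suc k \<partial>P) = (\<integral>z. z ^ Suc k \<partial>Q)"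
  shows "P = Q"
proof (rule measure_eqI_continuous_bounded[OF P Q sets])
  interpret P: prob_space P by (rule P)
  interpret Q: prob_space Q by (rule Q)
  have [measurable_cong]: "sets P = sets borel" "sets Q = sets borel" by (rule sets)+
  have mom': "(\<integral>z. z ^ k \<partial>P) = (\<integral>z. z ^ k \<partial>Q)" for k
    using mom by (cases k) (auto simp: P.prob_space Q.prob_space)
  define L where "L = {h :: complex \<Rightarrow> complex. continuous_on UNIV h \<and> (\<integral>z. h z \<partial>P) = (\<integral>z. h z \<partial>Q)}"
  have int: "integrable R h" if "prob_space R" "sets R = sets borel" "AE z in R. norm z = 1" "continuous_on UNIV h"
    for R and h :: "complex \<Rightarrow> 'c::{banach,second_countable_topology}"
  proof -
    interpret R: prob_space R by fact
    have "compact (h ` sphere 0 1)"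
      by (intro compact_continuous_image continuous_on_subset[OF that(4)]) auto
    then obtain B where "\<And>z. z \<in> sphere 0 1 \<Longrightarrow> norm (h z) \<le> B"
      by (metis bounded_iff compact_imp_bounded imageI)
    then show ?thesis
      using that borel_measurable_continuous_onI[OF that(4)]
      by (intro R.integrable_const_bound[where B=B]) (auto simp: measurable_cong_sets[OF that(2) refl])
  qed
  note intP = int[OF P sets(1) circ(1)] and intQ = int[OF Q sets(2) circ(2)]
  define mono where "mono = (\<lambda>j k (z::complex). z ^ j * cnj z ^ k)"
  have mono_L: "mono j k \<in> L" for j k
  proof -
    have "(\<integral>z. mono j k z \<partial>R) = (if k \<le> j then \<integral>z. z ^ (j - k) \<partial>R else cnj (\<integral>z. z ^ (k - j) \<partial>R))"
      if "prob_space R" and s: "sets R = sets borel" and "AE z in R. norm z = 1" for R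
    proof -
      have *: "z ^ j * cnj z ^ k = (if k \<le> j then z ^ (j - k) else cnj (z ^ (k - j)))" if "norm z = 1" for z
      proof -
        have zz: "z ^ i * cnj z ^ i = 1" for i
          using that by (simp add: power_mult_distrib[symmetric] complex_norm_square[symmetric])
        show ?thesis
          using zz[of k] zz[of j] power_add[of z "j - k" k] power_add[of "cnj z" "k - j" j]
          by (auto simp: mult.assoc mult.left_commute[of "z ^ j"])
      qed
      have [measurable]: "h \<in> borel_measurable R" if "continuous_on UNIV h" for h :: "complex \<Rightarrow> complex"
        using borel_measurable_continuous_onI[OF that] by (simp add: measurable_cong_sets[OF s refl])
      have "continuous_on UNIV (\<lambda>z::complex. if k \<le> j then z ^ (j - k) else cnj (z ^ (k - j)))"
        by (cases "k \<le> j") (auto intro!: continuous_intros)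
      note [measurable] = \<open>\<And>h. _ \<Longrightarrow> h \<in> borel_measurable R\<close>[OF this]
      have "(\<integral>z. mono j k z \<partial>R) = (\<integral>z. (if k \<le> j then z ^ (j - k) else cnj (z ^ (k - j))) \<partial>R)"
        using that(3) by (intro integral_cong_AE)
          (auto simp: mono_def * intro!: continuous_intros simp del: complex_cnj_power)
      then show ?thesis by (simp flip: integral_cnj complex_cnj_power)
    qed
    then have "(\<integral>z. mono j k z \<partial>P) = (\<integral>z. mono j k z \<partial>Q)"
      using P Q sets circ by (simp add: mom')
    then show ?thesis by (auto simp: L_def mono_def intro!: continuous_intros)
  qed
  \<comment> \<open>Polynomials in \<open>z\<close> and \<open>cnj z\<close>, encoded as bivariate polynomials so that \<open>V\<close> is visibly a ring.\<close>
  define V where "V = {h. \<exists>A :: complex poly poly. h = (\<lambda>z. poly (poly A [:z:]) (cnj z))}"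
  have "V \<subseteq> L"
  proof
    fix h assume "h \<in> V"
    then obtain A :: "complex poly poly" where A: "h = (\<lambda>z. poly (poly A [:z:]) (cnj z))"
      by (auto simp: V_def)
    have h: "h = (\<lambda>z. \<Sum>i\<le>degree A. \<Sum>j\<le>degree (coeff A i). coeff (coeff A i) j * mono i j z)"
      by (simp add: A poly_altdef[of A] poly_altdef[of "coeff A _"] poly_sum mono_def sum_distrib_right sum_distrib_left mult_ac fun_eq_iff)
    have mc: "continuous_on UNIV (mono j k)" and me: "(\<integral>z. mono j k z \<partial>P) = (\<integral>z. mono j k z \<partial>Q)" for j k
      using mono_L[of j k] by (auto simp: L_def)
    have "continuous_on UNIV h" unfolding h
      by (intro continuous_intros mc)
    moreover have "(\<integral>z. h z \<partial>P) = (\<integral>z. h z \<partial>Q)"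
      unfolding h using intP[OF mc] intQ[OF mc] by (simp add: me)
    ultimately show "h \<in> L" by (simp add: L_def)
  qed
  have poly_V: "(\<lambda>z. of_real (r z)) \<in> V" if "real_polynomial_function r" for r :: "complex \<Rightarrow> real"
    using that
  proof induction
    case (linear f)
    interpret bounded_linear f by fact
    have f: "f z = Re z * f 1 + Im z * f \<i>" for z
    proof -
      have "z = Re z *\<^sub>R 1 + Im z *\<^sub>R \<i>" by (simp add: complex_eq_iff)
      then show ?thesis by (metis add scaleR real_scaleR_def)
    qed
    define A :: "complex poly poly" where
      "A = [: [: 0, (f 1 + \<i> * f \<i>) / 2 :], [: (f 1 - \<i> * f \<i>) / 2 :] :]"
    have "of_real (f z) = poly (poly A [:z:]) (cnj z)" for z
      by (subst f) (auto simp: A_def complex_eq_iff field_simps)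
    then show ?case by (auto simp: V_def)
  next
    case (const c)
    then show ?case by (auto simp: V_def intro!: exI[of _ "[:[:of_real c:]:]"])
  next
    case (add f g)
    then obtain A B where "(\<lambda>z. complex_of_real (f z)) = (\<lambda>z. poly (poly A [:z:]) (cnj z))"
       "(\<lambda>z. complex_of_real (g z)) = (\<lambda>z. poly (poly B [:z:]) (cnj z))" by (auto simp: V_def)
    then show ?case by (auto simp: V_def fun_eq_iff intro!: exI[of _ "A + B"])
  next
    case (mult f g)
    then obtain A B where "(\<lambda>z. complex_of_real (f z)) = (\<lambda>z. poly (poly A [:z:]) (cnj z))"
       "(\<lambda>z. complex_of_real (g z)) = (\<lambda>z. poly (poly B [:z:]) (cnj z))" by (auto simp: V_def)
    then show ?case by (auto simp: V_def fun_eq_iff intro!: exI[of _ "A * B"])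
  qed
  show "(\<integral>x. g x \<partial>P) = (\<integral>x. g x \<partial>Q)" if g: "continuous_on UNIV g" for g :: "complex \<Rightarrow> real"
  proof -
    have "\<bar>(\<integral>x. g x \<partial>P) - (\<integral>x. g x \<partial>Q)\<bar> \<le> e" if e: "e > 0" for e
    proof -
      obtain r where r: "real_polynomial_function r" and gr: "\<And>x. x \<in> sphere 0 1 \<Longrightarrow> \<bar>g x - r x\<bar> < e / 2"
        using Stone_Weierstrass_real_polynomial_function[of "sphere 0 1" g "e / 2"] e
        by (metis continuous_on_subset[OF g subset_UNIV] compact_sphere half_gt_zero)
      have rc: "continuous_on UNIV r"
        using r by (simp add: continuous_on_polymonial_function real_polynomial_function_eq)
      have "(\<integral>x. complex_of_real (r x) \<partial>P) = (\<integral>x. complex_of_real (r x) \<partial>Q)"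
        using poly_V[OF r] \<open>V \<subseteq> L\<close> by (auto simp: L_def)
      then have rPQ: "(\<integral>x. r x \<partial>P) = (\<integral>x. r x \<partial>Q)" by simp
      have near: "\<bar>(\<integral>x. g x \<partial>R) - (\<integral>x. r x \<partial>R)\<bar> \<le> e / 2"
        if R: "prob_space R" "AE z in R. norm z = 1" "integrable R g" "integrable R r" for R
      proof -
        interpret R: prob_space R by fact
        have "\<bar>\<integral>x. g x - r x \<partial>R\<bar> \<le> (\<integral>x. \<bar>g x - r x\<bar> \<partial>R)" by (rule integral_abs_bound)
        also have "\<dots> \<le> (\<integral>x. e / 2 \<partial>R)"
        proof (rule integral_mono_AE)
          show "AE x in R. \<bar>g x - r x\<bar> \<le> e / 2"
            using R(2) by eventually_elim (use gr in \<open>force intro: less_imp_le\<close>)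
        qed (use R in auto)
        also have "\<dots> = e / 2" by (simp add: R.prob_space)
        finally show ?thesis using R by simp
      qed
      show ?thesis
        using near[OF P circ(1) intP[OF g] intP[OF rc]] near[OF Q circ(2) intQ[OF g] intQ[OF rc]] rPQ
        by linarith
    qed
    then have "\<bar>(\<integral>x. g x \<partial>P) - (\<integral>x. g x \<partial>Q)\<bar> \<le> 0 + e" if "e > 0" for e
      using that by (simp only: add_0_left)
    then have "\<bar>(\<integral>x. g x \<partial>P) - (\<integral>x. g x \<partial>Q)\<bar> \<le> 0"
      by (rule field_le_epsilon)
    then show ?thesis by simp
  qed
qed

section \<open>A harmonic function vanishing on the left semicircle\<close>

lemma left_semicircle_eq: "left_semicircle = {z. norm z = 1 \<and> Re z \<le> 0}"
proof (intro equalityI subsetI)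
  fix z assume "z \<in> left_semicircle"
  then obtain \<theta> where t: "z = exp (\<i> * of_real \<theta>)" "pi / 2 \<le> \<theta>" "\<theta> \<le> 3 * pi / 2"
    by (auto simp: left_semicircle_def)
  have "cos \<theta> \<le> 0"
    using cos_ge_zero[of "\<theta> - pi"] t by (simp add: cos_diff)
  then show "z \<in> {z. norm z = 1 \<and> Re z \<le> 0}"
    by (simp add: t Re_exp)
next
  fix z assume z: "z \<in> {z :: complex. norm z = 1 \<and> Re z \<le> 0}"
  obtain t where t: "0 \<le> t" "t < 2 * pi" "z = exp (\<i> * of_real t)"
  proof -
    have "z \<noteq> 0" using z by auto
    then have "z = exp (\<i> * of_real (Arg2pi z))" using z Arg2pi_eq[of z] by simp
    then show ?thesis using that Arg2pi_ge_0 Arg2pi_lt_2pi by blast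
  qed
  have c: "cos t \<le> 0" using z t by (simp add: Re_exp)
  have "pi / 2 \<le> t"
  proof (rule ccontr)
    assume "\<not> pi / 2 \<le> t"
    then have "cos t > 0" using t by (intro cos_gt_zero_pi) auto
    with c show False by simp
  qed
  moreover have "t \<le> 3 * pi / 2"
  proof (rule ccontr)
    assume "\<not> t \<le> 3 * pi / 2"
    then have "cos (t - 2 * pi) > 0" using t by (intro cos_gt_zero_pi) auto
    with c show False by (simp add: cos_diff)
  qed
  ultimately show "z \<in> left_semicircle" using t by (auto simp: left_semicircle_def)
qed

lemma closed_left_semicircle: "closed left_semicircle"
proof -
  have "left_semicircle = sphere 0 1 \<inter> {z. Re z \<le> 0}"
    by (auto simp: left_semicircle_eq)
  then show ?thesis by (metis closed_Int closed_sphere closed_halfspace_Re_le)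
qed

text \<open>The weight \<open>k\<close> in the summability condition makes the sum Lipschitz up to the boundary; it is
  also the growth allowed by the bound on the differences of moments.\<close>

lemma power_series_unit_disc:
  fixes c :: "nat \<Rightarrow> complex"
  assumes c: "summable (\<lambda>k. real k * norm (c k))"
  shows power_series_unit_disc_sums: "norm z \<le> 1 \<Longrightarrow> (\<lambda>k. c k * z ^ k) sums (\<Sum>k. c k * z ^ k)"
    and power_series_unit_disc_holomorphic: "(\<lambda>z. \<Sum>k. c k * z ^ k) holomorphic_on ball 0 1"
    and power_series_unit_disc_lipschitz: "norm z \<le> 1 \<Longrightarrow> norm w \<le> 1 \<Longrightarrow>
      norm ((\<Sum>k. c k * z ^ k) - (\<Sum>k. c k * w ^ k)) \<le> (\<Sum>k. real k * norm (c k)) * norm (z - w)"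
proof -
  have sc: "summable (\<lambda>k. norm (c k))"
  proof (rule summable_comparison_test_ev[OF _ c])
    show "\<forall>\<^sub>F k in sequentially. norm (norm (c k)) \<le> real k * norm (c k)"
      using eventually_ge_at_top[of 1] by eventually_elim (simp add: mult_le_cancel_right1)
  qed
  have S: "(\<lambda>k. c k * z ^ k) sums (\<Sum>k. c k * z ^ k)" if "norm z \<le> 1" for z
  proof (rule summable_sums, rule summable_comparison_test_ev[OF _ sc])
    show "\<forall>\<^sub>F k in sequentially. norm (c k * z ^ k) \<le> norm (c k)"
      using that by (auto simp: norm_mult norm_power power_le_one mult_left_le)
  qed
  then show "norm z \<le> 1 \<Longrightarrow> (\<lambda>k. c k * z ^ k) sums (\<Sum>k. c k * z ^ k)" .
  show "(\<lambda>z. \<Sum>k. c k * z ^ k) holomorphic_on ball 0 1"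
    by (rule power_series_holomorphic[of 0 1 c]) (use S in auto)
  have pw: "norm (z ^ k - w ^ k) \<le> real k * norm (z - w)" if "norm z \<le> 1" "norm w \<le> 1" for z w :: complex and k
    by (rule norm_power_diff[OF that])
  show "norm ((\<Sum>k. c k * z ^ k) - (\<Sum>k. c k * w ^ k)) \<le> (\<Sum>k. real k * norm (c k)) * norm (z - w)"
    if zw: "norm z \<le> 1" "norm w \<le> 1"
  proof -
    have "(\<lambda>k. c k * z ^ k - c k * w ^ k) sums ((\<Sum>k. c k * z ^ k) - (\<Sum>k. c k * w ^ k))"
      by (intro sums_diff S zw)
    moreover have "(\<lambda>k. real k * norm (c k) * norm (z - w)) sums ((\<Sum>k. real k * norm (c k)) * norm (z - w))"
      by (intro sums_mult2 summable_sums c)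
    moreover have "norm (c k * z ^ k - c k * w ^ k) \<le> real k * norm (c k) * norm (z - w)" for k
    proof -
      have "norm (c k * z ^ k - c k * w ^ k) = norm (c k) * norm (z ^ k - w ^ k)"
        by (simp add: norm_mult[symmetric] right_diff_distrib)
      also have "\<dots> \<le> norm (c k) * (real k * norm (z - w))"
        by (intro mult_left_mono pw zw) auto
      finally show ?thesis by (simp add: mult_ac)
    qed
    ultimately show ?thesis
      using norm_sums_le by blast
  qed
qed

definition arctan_coeff :: "nat \<Rightarrow> real" where
  "arctan_coeff m = (-1) ^ m / (2 * real m + 1)"

text \<open>The coefficient of \<open>z\<^bsup>2m+1\<^esup>\<close> in \<open>(z + 1/z)\<^sup>2 Arctan z\<close>, except that for \<open>m = 0\<close> it is larger by \<open>1\<close>: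
  the pole \<open>1/z\<close> of that function is replaced by \<open>z\<close>, which has the same real part on the circle.\<close>

definition barrier_odd :: "nat \<Rightarrow> real" where
  "barrier_odd m = - 8 * (-1) ^ m / ((2 * real m - 1) * (2 * real m + 1) * (2 * real m + 3))"

definition barrier_coeff :: "nat \<Rightarrow> complex" where
  "barrier_coeff k = (if odd k then of_real (barrier_odd (k div 2)) else 0)
     + (if k \<in> {0, 2} then of_real (pi / 2) else 0)"

text \<open>On the unit circle \<open>(z + 1/z)\<^sup>2 = 4 cos\<^sup>2 \<theta>\<close> and \<open>Re (Arctan z) = (\<pi>/4) sgn (cos \<theta>)\<close>. Adding
  \<open>(\<pi>/2) (1 + z\<^sup>2)\<close>, whose real part there is \<open>\<pi> cos\<^sup>2 \<theta>\<close>, cancels the left half and doubles the right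
  half. The factor \<open>cos\<^sup>2 \<theta>\<close> removes the jumps at \<open>\<plusminus>\<i>\<close>, so the coefficients decay like \<open>k\<^sup>-\<^sup>3\<close>.\<close>

definition barrier :: "complex \<Rightarrow> complex" where
  "barrier z = (\<Sum>k. barrier_coeff k * z ^ k)"

lemma summable_barrier_coeff: "summable (\<lambda>k. real k * norm (barrier_coeff k))"
proof (rule summable_comparison_test_ev)
  show "summable (\<lambda>k. 16 * (1 / real k ^ 2))"
    by (intro summable_mult inverse_power_summable[of 2, where 'a=real, simplified inverse_eq_divide]) simp
  show "\<forall>\<^sub>F k in sequentially. norm (real k * norm (barrier_coeff k)) \<le> 16 * (1 / real k ^ 2)"
    using eventually_ge_at_top[of 3]
  proof eventually_elim
    case (elim k)
    show ?case
    proof (cases "odd k")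
      case True
      then obtain m where m: "k = 2 * m + 1" by (elim oddE)
      have m1: "real m \<ge> 1" using elim m by simp
      have "norm (barrier_coeff k) = \<bar>barrier_odd m\<bar>"
        using m m1 by (simp add: barrier_coeff_def)
      also have "\<dots> = 8 / ((2 * real m - 1) * (2 * real m + 1) * (2 * real m + 3))"
        using m1 by (simp add: barrier_odd_def abs_mult power_abs)
      finally have "norm (barrier_coeff k) = 8 / ((2 * real m - 1) * (2 * real m + 1) * (2 * real m + 3))" .
      then have "real k * norm (barrier_coeff k) =
          (2 * real m + 1) * (8 / ((2 * real m - 1) * (2 * real m + 1) * (2 * real m + 3)))"
        using m by simp
      also have "\<dots> = 8 / ((2 * real m - 1) * (2 * real m + 3))"
      proof -
        have c: "x * (8 / (A * x * B)) = 8 / (A * B)" if "x \<noteq> 0" for x A B :: real using that by simp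
        show ?thesis by (rule c) (use m1 in simp)
      qed
      also have "\<dots> \<le> 8 / (real k ^ 2 / 2)"
      proof (rule divide_left_mono)
        show le: "real k ^ 2 / 2 \<le> (2 * real m - 1) * (2 * real m + 3)"
        proof -
          have "real k = 2 * real m + 1" using m by simp
          then have "real k ^ 2 / 2 = 2 * (real m * real m) + 2 * real m + 1 / 2"
            by (simp add: power2_eq_square algebra_simps)
          moreover have "(2 * real m - 1) * (2 * real m + 3) = 4 * (real m * real m) + 4 * real m - 3"
            by (simp add: algebra_simps)
          moreover have "1 \<le> real m * real m" using mult_mono[OF m1 m1] by simp
          ultimately show ?thesis using m1 by linarith
        qed
        show "0 < (2 * real m - 1) * (2 * real m + 3) * (real k ^ 2 / 2)"
          using m m1 by (intro mult_pos_pos) auto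
      qed simp
      finally show ?thesis by simp
    next
      case False
      then show ?thesis using elim by (simp add: barrier_coeff_def)
    qed
  qed
qed

lemma barrier_sums_odd:
  assumes "(\<lambda>m. of_real (barrier_odd m) * z ^ (2 * m + 1)) sums s"
  shows "barrier z = s + of_real (pi / 2) * (1 + z\<^sup>2)"
proof -
  have "(\<lambda>k. (if odd k then of_real (barrier_odd (k div 2)) else 0) * z ^ k) sums s"
  proof (subst sums_mono_reindex[symmetric, where g="\<lambda>m. 2 * m + 1"])
    show "strict_mono (\<lambda>m. 2 * m + 1 :: nat)" by (auto simp: strict_mono_def)
    show "(if odd n then of_real (barrier_odd (n div 2)) else 0) * z ^ n = 0"
      if "n \<notin> range (\<lambda>m. 2 * m + 1)" for n
      using that by (auto elim!: oddE)
  qed (use assms in simp)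
  moreover have "(\<lambda>k. (if k \<in> {0, 2} then of_real (pi / 2) else 0) * z ^ k) sums
      (\<Sum>k\<in>{0,2}. (if k \<in> {0, 2} then of_real (pi / 2) else 0) * z ^ k)"
    by (rule sums_finite) auto
  ultimately have "(\<lambda>k. barrier_coeff k * z ^ k) sums (s + of_real (pi / 2) * (1 + z\<^sup>2))"
    unfolding barrier_coeff_def distrib_right by (intro sums_add) (auto simp: algebra_simps)
  then show ?thesis by (simp add: barrier_def sums_unique[symmetric])
qed

lemma barrier_eq_Arctan:
  assumes z: "norm z < 1" "z \<noteq> 0"
  shows "barrier z = (1 + z\<^sup>2)\<^sup>2 / z\<^sup>2 * Arctan z - 1 / z + z + of_real (pi / 2) * (1 + z\<^sup>2)"
proof -
  define y where "y = z\<^sup>2"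
  define a where "a = (\<lambda>m. complex_of_real (arctan_coeff m) * y ^ m)"
  define B where "B = Arctan z / z"
  have "(\<lambda>m. (- 1) ^ m / of_nat (2 * m + 1) * z ^ (2 * m + 1) / z) sums B"
    unfolding B_def by (intro sums_divide Arctan_series(2) z)
  also have "(\<lambda>m. (- 1) ^ m / of_nat (2 * m + 1) * z ^ (2 * m + 1) / z) = a"
    using z(2) by (auto simp: a_def y_def arctan_coeff_def power_mult fun_eq_iff)
  finally have a: "a sums B" .
  have a0: "a 0 = 1" by (simp add: a_def arctan_coeff_def)
  have aS: "(\<lambda>m. a (Suc m)) sums (B - 1)" using a a0 by (simp add: sums_Suc_iff)
  have aP: "(\<lambda>m. case m of 0 \<Rightarrow> 1 | Suc m \<Rightarrow> y * a m) sums (y * B + 1)"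
    using sums_Suc[of "\<lambda>m. case m of 0 \<Rightarrow> 1 | Suc m \<Rightarrow> y * a m" "y * B"] sums_mult[OF a, of y] by simp
  have "(\<lambda>m. (a (Suc m) + 2 * y * a m + y * (case m of 0 \<Rightarrow> 1 | Suc m \<Rightarrow> y * a m)) / y * z) sums
      ((B - 1 + 2 * y * B + y * (y * B + 1)) / y * z)"
    by (intro sums_mult2 sums_divide sums_add sums_mult aS a aP)
  also have "(\<lambda>m. (a (Suc m) + 2 * y * a m + y * (case m of 0 \<Rightarrow> 1 | Suc m \<Rightarrow> y * a m)) / y * z)
      = (\<lambda>m. of_real (barrier_odd m) * z ^ (2 * m + 1))"
  proof
    fix m
    have y0: "y \<noteq> 0" using z by (simp add: y_def)
    have r: "arctan_coeff (Suc m) + 2 * arctan_coeff m - (-1) ^ m / (2 * real m - 1) = barrier_odd m"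
    proof -
      have "2 * real m - 1 \<noteq> 0" by (metis diff_numeral_special(9) eq_iff_diff_eq_0 even_mult_iff
        even_numeral odd_one of_nat_1 of_nat_eq_iff of_nat_mult of_nat_numeral)
      then show ?thesis
        by (simp add: arctan_coeff_def barrier_odd_def divide_simps) (simp add: algebra_simps)
    qed
    have "(case m of 0 \<Rightarrow> 1 | Suc m \<Rightarrow> y * a m) = of_real (- ((-1) ^ m / (2 * real m - 1))) * y ^ m"
      by (cases m) (auto simp: a_def arctan_coeff_def mult_ac add_ac)
    then have "(a (Suc m) + 2 * y * a m + y * (case m of 0 \<Rightarrow> 1 | Suc m \<Rightarrow> y * a m))
        = of_real (arctan_coeff (Suc m) + 2 * arctan_coeff m - (-1) ^ m / (2 * real m - 1)) * y ^ m * y"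
      by (simp only: a_def of_real_add of_real_diff of_real_mult) (simp add: algebra_simps)
    also have "\<dots> / y * z = of_real (barrier_odd m) * z ^ (2 * m + 1)"
      using y0 by (simp only: r) (simp add: y_def mult_ac flip: power_mult)
    finally show "(a (Suc m) + 2 * y * a m + y * (case m of 0 \<Rightarrow> 1 | Suc m \<Rightarrow> y * a m)) / y * z
        = of_real (barrier_odd m) * z ^ (2 * m + 1)" .
  qed
  finally have "barrier z = (B - 1 + 2 * y * B + y * (y * B + 1)) / y * z + of_real (pi / 2) * (1 + z\<^sup>2)"
    by (rule barrier_sums_odd)
  also have "(B - 1 + 2 * y * B + y * (y * B + 1)) / y * z = (1 + z\<^sup>2)\<^sup>2 / z\<^sup>2 * Arctan z - 1 / z + z"
    using z(2) by (simp add: B_def y_def field_simps power2_eq_square)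
  finally show ?thesis .
qed

text \<open>The Moebius map \<open>z \<mapsto> (1 - \<i> z) / (1 + \<i> z)\<close> in the definition of \<open>Arctan\<close> takes the circle to the
  imaginary axis, where the argument is constant on each half.\<close>

lemma Re_Arctan_unit_circle:
  assumes z: "norm z = 1" "Re z \<noteq> 0"
  shows "Re (Arctan z) = sgn (Re z) * (pi / 4)"
proof -
  have n: "(Re z)\<^sup>2 + (Im z)\<^sup>2 = 1" using z by (simp add: cmod_def)
  define d where "d = 2 * (1 - Im z)"
  have "(Im z)\<^sup>2 < 1" using n z(2) by (smt (verit) zero_less_power2)
  then have "Im z < 1" by (simp add: power2_less_1_iff)
  then have d: "d > 0" by (simp add: d_def)
  have "2 * (Re z)\<^sup>2 = d * (1 + Im z)"
    using n by (simp add: d_def power2_eq_square algebra_simps)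
  then have "1 - \<i> * z = of_real (2 * Re z / d) * (- \<i>) * (1 + \<i> * z)"
    using d by (simp add: complex_eq_iff power2_eq_square field_simps) (simp add: d_def algebra_simps)
  moreover have "1 + \<i> * z \<noteq> 0" using z(2) by (auto simp: complex_eq_iff)
  ultimately have "(1 - \<i> * z) / (1 + \<i> * z) = of_real (2 * Re z / d) * (- \<i>)"
    by (simp add: divide_eq_eq)
  also have "\<dots> = of_real (2 * \<bar>Re z\<bar> / d) * (- of_real (sgn (Re z)) * \<i>)"
    by (auto simp: sgn_if)
  finally have eq: "(1 - \<i> * z) / (1 + \<i> * z) = of_real (2 * \<bar>Re z\<bar> / d) * (- of_real (sgn (Re z)) * \<i>)" .
  have "Im (Ln ((1 - \<i> * z) / (1 + \<i> * z))) = - sgn (Re z) * (pi / 2)"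
  proof -
    have *: "Ln (of_real r * w) = of_real (ln r) + Ln w" if "r > 0" "w \<noteq> 0" for r w
      using that by (simp add: Ln_times_of_real Ln_of_real)
    have "Ln (of_real (2 * \<bar>Re z\<bar> / d) * (- of_real (sgn (Re z)) * \<i>))
        = of_real (ln (2 * \<bar>Re z\<bar> / d)) + Ln (- of_real (sgn (Re z)) * \<i>)"
      by (rule *) (use z(2) d in \<open>auto simp: sgn_if\<close>)
    then show ?thesis
      unfolding eq using z(2) by (auto simp: sgn_if)
  qed
  then show ?thesis by (simp add: Arctan_def)
qed

lemma barrier_lipschitz:
  "norm z \<le> 1 \<Longrightarrow> norm w \<le> 1 \<Longrightarrow>
      norm (barrier z - barrier w) \<le> (\<Sum>k. real k * norm (barrier_coeff k)) * norm (z - w)"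
  unfolding barrier_def by (rule power_series_unit_disc_lipschitz[OF summable_barrier_coeff])

lemma continuous_on_barrier: "continuous_on (cball 0 1) barrier"
proof (rule lipschitz_on_continuous_on)
  show "(\<Sum>k. real k * norm (barrier_coeff k))-lipschitz_on (cball 0 1) barrier"
    using summable_barrier_coeff
    by (intro lipschitz_onI) (auto simp: dist_norm intro!: barrier_lipschitz suminf_nonneg)
qed

text \<open>The closed form is valid inside the disc; it is extended radially to the boundary points where
  \<open>Arctan\<close> is continuous. At \<open>\<plusminus>\<i>\<close> the odd terms of the series are purely imaginary and the two even
  terms cancel.\<close>

lemma Re_barrier_unit_circle:
  assumes z: "norm z = 1"
  shows "Re (barrier z) = (if Re z \<le> 0 then 0 else 2 * pi * (Re z)\<^sup>2)"
proof (cases "Re z = 0")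
  case True
  have n: "(Re z)\<^sup>2 + (Im z)\<^sup>2 = 1" using z by (simp add: cmod_def)
  have zi: "z = \<i> * of_real (Im z)" using True by (simp add: complex_eq_iff)
  have z2: "z\<^sup>2 = -1" using n True zi by (metis add_0 i_squared mult.right_neutral mult_minus_left of_real_1
        of_real_power power_mult_distrib power2_i zero_power2)
  have "(\<lambda>k. Re (barrier_coeff k * z ^ k)) sums Re (barrier z)"
    unfolding barrier_def using z
    by (intro sums_Re power_series_unit_disc_sums summable_barrier_coeff) auto
  moreover have "Re (barrier_coeff k * z ^ k) = 0" if "k \<notin> {0, 2}" for k
  proof (cases "odd k")
    case odd: True
    then obtain m where m: "k = 2 * m + 1" by (elim oddE)
    then have "z ^ k = of_real ((-1) ^ m) * z" by (simp add: power_mult z2)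
    then have "barrier_coeff k * z ^ k = of_real (barrier_odd m * (-1) ^ m) * z"
      using m by (simp add: barrier_coeff_def)
    then show ?thesis by (simp only: Re_complex_of_real times_complex.simps(1)) (simp add: True)
  qed (use that in \<open>auto simp: barrier_coeff_def\<close>)
  then have "(\<lambda>k. Re (barrier_coeff k * z ^ k)) sums (\<Sum>k\<in>{0,2}. Re (barrier_coeff k * z ^ k))"
    by (intro sums_finite) auto
  moreover have "(\<Sum>k\<in>{0,2}. Re (barrier_coeff k * z ^ k)) = 0"
    by (simp add: barrier_coeff_def z2)
  ultimately have "Re (barrier z) = 0" using sums_unique2 by metis
  then show ?thesis using True by simp
next
  case False
  define W where "W = (\<lambda>z. (1 + z\<^sup>2)\<^sup>2 / z\<^sup>2 * Arctan z - 1 / z + z + of_real (pi / 2) * (1 + z\<^sup>2))"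
  have z0: "z \<noteq> 0" using z by auto
  define u where "u = (\<lambda>k. of_real (1 - 1 / real (Suc k)) * z)"
  have lim: "u \<longlonglongrightarrow> z"
  proof -
    have "u \<longlonglongrightarrow> of_real (1 - 0) * z"
      unfolding u_def by (intro tendsto_mult tendsto_of_real tendsto_diff tendsto_const LIMSEQ_Suc[OF lim_1_over_n])
    then show ?thesis by simp
  qed
  have W_lim: "(\<lambda>k. W (u k)) \<longlonglongrightarrow> W z"
    unfolding W_def using False z0
    by (intro tendsto_intros lim isCont_tendsto_compose[OF continuous_at_Arctan]) auto
  have barrier_lim: "(\<lambda>k. barrier (u k)) \<longlonglongrightarrow> barrier z"
  proof (rule continuous_on_tendsto_compose[OF continuous_on_barrier lim])
    show "\<forall>\<^sub>F k in sequentially. u k \<in> cball 0 1"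
    proof (rule always_eventually, rule allI)
      fix k
      have "\<bar>1 - 1 / real (Suc k)\<bar> \<le> 1" by (simp add: abs_le_iff)
      then show "u k \<in> cball 0 1" using z by (simp only: u_def mem_cball dist_0_norm norm_mult norm_of_real) simp
    qed
  qed (use z in auto)
  have "\<forall>\<^sub>F k in sequentially. barrier (u k) = W (u k)"
    using eventually_gt_at_top[of 0]
  proof eventually_elim
    case (elim k)
    have "norm (u k) < 1" unfolding u_def norm_mult norm_of_real z using elim by (simp add: field_simps)
    moreover have "u k \<noteq> 0" using z0 elim by (simp add: u_def)
    ultimately show ?case unfolding W_def by (rule barrier_eq_Arctan)
  qed
  then have "\<forall>\<^sub>F k in sequentially. W (u k) = barrier (u k)"
    by (rule eventually_mono) (rule sym)
  with W_lim have "(\<lambda>k. barrier (u k)) \<longlonglongrightarrow> W z"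
    by (rule Lim_transform_eventually)
  with barrier_lim have "barrier z = W z" by (rule LIMSEQ_unique)
  moreover have "Re (W z) = 4 * (Re z)\<^sup>2 * Re (Arctan z) + pi * (Re z)\<^sup>2"
  proof -
    have "z * cnj z = 1" using z by (simp flip: complex_norm_square)
    then have zc: "1 / z = cnj z" using z0 by (simp add: divide_eq_eq mult.commute)
    have "(1 + z\<^sup>2)\<^sup>2 / z\<^sup>2 = (z + 1 / z)\<^sup>2" using z0 by (simp add: field_simps power2_eq_square)
    also have "\<dots> = of_real (4 * (Re z)\<^sup>2)" by (simp add: zc complex_add_cnj)
    finally have 1: "(1 + z\<^sup>2)\<^sup>2 / z\<^sup>2 = of_real (4 * (Re z)\<^sup>2)" .
    have n: "(Re z)\<^sup>2 + (Im z)\<^sup>2 = 1" using z by (simp add: cmod_def)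
    have z2: "Re (z\<^sup>2) = 2 * (Re z)\<^sup>2 - 1" using n by (simp add: power2_eq_square)
    show ?thesis
      unfolding W_def 1 zc by (simp add: z2 field_simps)
  qed
  ultimately show ?thesis using Re_Arctan_unit_circle[OF z False] False
    by (auto simp: sgn_if)
qed

text \<open>The maximum principle for \<open>exp (- barrier)\<close>. Equality at an interior point would make this
  function constant, but its modulus differs at \<open>0\<close> and at \<open>1\<close>.\<close>

lemma Re_barrier_pos:
  assumes "z \<in> cball 0 1 - left_semicircle"
  shows "0 < Re (barrier z)"
proof (cases "norm z = 1")
  case True
  with assms show ?thesis by (auto simp: Re_barrier_unit_circle left_semicircle_eq)
next
  case False
  then have z: "z \<in> ball 0 1" using assms by auto
  define g where "g = (\<lambda>z. exp (- barrier z))"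
  have hol: "g holomorphic_on ball 0 1"
    unfolding g_def barrier_def
    by (intro holomorphic_intros power_series_unit_disc_holomorphic summable_barrier_coeff)
  have cont: "continuous_on (cball 0 1) g"
    unfolding g_def by (intro continuous_intros continuous_on_barrier)
  have le: "norm (g w) \<le> 1" if "w \<in> ball 0 1" for w
  proof (rule maximum_modulus_frontier[of g "ball 0 1"])
    show "norm (g z) \<le> 1" if "z \<in> frontier (ball 0 1)" for z
      using that by (auto simp: g_def Re_barrier_unit_circle)
  qed (use hol cont that in auto)
  show ?thesis
  proof (rule ccontr)
    assume "\<not> 0 < Re (barrier z)"
    then have "norm (g w) \<le> norm (g z)" if "w \<in> ball 0 1" for w
      using le[OF that] by (simp add: g_def)
    then have "g constant_on ball 0 1"
      using maximum_modulus_principle[OF hol, of "ball 0 1" z] z by auto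
    then obtain c where c: "\<And>w. w \<in> ball 0 1 \<Longrightarrow> g w = c" by (auto simp: constant_on_def)
    have "g 1 = c"
      by (rule continuous_constant_on_closure[where S="ball 0 1", of g]) (use cont c in auto)
    moreover have "g 0 = c" by (rule c) simp
    moreover have "norm (g 0) = exp (- (pi / 2))"
      by (simp add: g_def barrier_def barrier_coeff_def)
    moreover have "norm (g 1) = exp (- (2 * pi))"
      by (simp add: g_def Re_barrier_unit_circle)
    ultimately show False by simp
  qed
qed

section \<open>Few zeroes away from the semicircle\<close>

text \<open>The counterexamples to Sendov's conjecture, normalised by a rotation so that the distinguished zero
  lies in \<open>[0, 1]\<close>.\<close>

definition sendov_exception :: "complex poly \<Rightarrow> real \<Rightarrow> bool" where
  "sendov_exception f a \<longleftrightarrow> lead_coeff f = 1 \<and> 2 \<le> degree f \<and> (\<forall>z. poly f z = 0 \<longrightarrow> norm z \<le> 1) \<and>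
     0 \<le> a \<and> a \<le> 1 \<and> poly f (of_real a) = 0 \<and> (\<forall>z. poly (pderiv f) z = 0 \<longrightarrow> 1 < norm (z - of_real a))"

lemma sendov_exception_roots:
  assumes "sendov_exception f a"
  shows "x \<in># proots f \<Longrightarrow> norm x \<le> 1"
    and "x \<in># proots (pderiv f) \<Longrightarrow> norm x \<le> 1"
    and "x \<in># proots (pderiv f) \<Longrightarrow> 1 < norm (x - of_real a)"
proof -
  have f0: "f \<noteq> 0" and f'0: "pderiv f \<noteq> 0"
    using assms by (auto simp: sendov_exception_def pderiv_eq_0_iff)
  show "x \<in># proots f \<Longrightarrow> norm x \<le> 1" "x \<in># proots (pderiv f) \<Longrightarrow> 1 < norm (x - of_real a)"
    using assms f0 f'0 by (auto simp: sendov_exception_def)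
  show "norm x \<le> 1" if "x \<in># proots (pderiv f)"
    using pderiv_roots_in_disc[of f x] that assms f'0 by (auto simp: sendov_exception_def)
qed

text \<open>The bound of order \<open>k\<^sup>2 / n\<close> from the power sums is interpolated with the trivial bound \<open>2\<close>. The
  geometric mean has only linear growth in \<open>k\<close>, at the price of \<open>sqrt n\<close> in place of \<open>n\<close>.\<close>

lemma root_mean_power_diff_le:
  assumes f: "sendov_exception f a"
  shows "norm (root_mean f (\<lambda>x. x ^ k) - root_mean (pderiv f) (\<lambda>x. x ^ k)) \<le> 9 * real k / sqrt (degree f)"
proof (cases k)
  case 0
  then show ?thesis using f by (simp add: sendov_exception_def degree_pderiv)
next
  case (Suc j)
  define n where "n = degree f"
  have n: "n \<ge> 2" using f by (simp add: n_def sendov_exception_def)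
  define m where "m = (\<lambda>p. root_mean p (\<lambda>x. x ^ k) :: complex)"
  have m1: "norm (m f) \<le> 1" "norm (m (pderiv f)) \<le> 1"
    unfolding m_def using sendov_exception_roots[OF f]
    by (auto intro!: norm_root_mean_le simp: norm_power power_le_one)
  have S1: "(\<Sum>x\<in>#proots f. x ^ k) = of_nat n * m f"
    using n by (simp add: m_def root_mean_def size_proots_complex n_def scaleR_conv_of_real)
  have S2: "(\<Sum>x\<in>#proots (pderiv f). x ^ k) = (of_nat n - 1) * m (pderiv f)"
    using n by (simp add: m_def root_mean_def size_proots_complex n_def scaleR_conv_of_real degree_pderiv of_nat_diff)
  have "norm (of_nat n * m f - (of_nat n - 1) * m (pderiv f)) \<le> 36 * (real k)\<^sup>2"
    using power_sum_diff_le[of f j] f unfolding S1[symmetric] S2[symmetric] Suc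
    by (auto simp: sendov_exception_def)
  then have "norm (of_nat n * m f - (of_nat n - 1) * m (pderiv f) - m (pderiv f)) \<le> 36 * (real k)\<^sup>2 + 1"
    using m1 norm_triangle_ineq4[of "of_nat n * m f - (of_nat n - 1) * m (pderiv f)" "m (pderiv f)"]
    by linarith
  also have "of_nat n * m f - (of_nat n - 1) * m (pderiv f) - m (pderiv f) = of_nat n * (m f - m (pderiv f))"
    by (simp add: algebra_simps)
  also have "36 * (real k)\<^sup>2 + 1 \<le> 37 * (real k)\<^sup>2"
    using Suc by simp
  finally have 1: "real n * norm (m f - m (pderiv f)) \<le> 37 * (real k)\<^sup>2" by (simp add: norm_mult)
  have 2: "norm (m f - m (pderiv f)) \<le> 2"
    using norm_triangle_ineq4[of "m f" "m (pderiv f)"] m1 by linarith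
  have "real n * (norm (m f - m (pderiv f)))\<^sup>2 \<le> 37 * (real k)\<^sup>2 * 2"
    using mult_mono[OF 1 2] by (simp add: power2_eq_square mult_ac)
  also have "\<dots> \<le> (9 * real k)\<^sup>2" by (simp add: power2_eq_square)
  finally have "sqrt (real n * (norm (m f - m (pderiv f)))\<^sup>2) \<le> 9 * real k"
    by (intro real_le_lsqrt) auto
  then have "sqrt (real n) * norm (m f - m (pderiv f)) \<le> 9 * real k"
    by (simp add: real_sqrt_mult)
  then show ?thesis using n by (simp add: m_def n_def[symmetric] field_simps)
qed

lemma root_mean_power_series_diff_le:
  fixes c :: "nat \<Rightarrow> complex"
  assumes f: "sendov_exception f a" and c: "summable (\<lambda>k. real k * norm (c k))"
  defines "F \<equiv> \<lambda>z. \<Sum>k. c k * z ^ k"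
  shows "norm (root_mean f F - root_mean (pderiv f) F) \<le> 9 * (\<Sum>k. real k * norm (c k)) / sqrt (degree f)"
proof -
  have sums: "(\<lambda>k. c k * root_mean p (\<lambda>x. x ^ k)) sums root_mean p F"
    if "\<And>x. x \<in># proots p \<Longrightarrow> norm x \<le> 1" for p
  proof -
    have "(\<lambda>k. c k * (\<Sum>x\<in>#A. x ^ k)) sums (\<Sum>x\<in>#A. F x)" if "\<forall>x. x \<in># A \<longrightarrow> norm x \<le> 1" for A
      using that
    proof (induction A)
      case (add x A)
      then have "(\<lambda>k. c k * x ^ k + c k * (\<Sum>x\<in>#A. x ^ k)) sums (F x + (\<Sum>x\<in>#A. F x))"
        unfolding F_def by (intro sums_add power_series_unit_disc_sums[OF c]) auto
      then show ?case by (simp add: distrib_left)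
    qed simp
    then have "(\<lambda>k. (c k * (\<Sum>x\<in>#proots p. x ^ k)) /\<^sub>R real (size (proots p))) sums root_mean p F"
      unfolding root_mean_def using that by (intro sums_scaleR_right) auto
    then show ?thesis by (simp add: root_mean_def)
  qed
  have "(\<lambda>k. c k * root_mean f (\<lambda>x. x ^ k) - c k * root_mean (pderiv f) (\<lambda>x. x ^ k)) sums
      (root_mean f F - root_mean (pderiv f) F)"
    by (intro sums_diff sums sendov_exception_roots[OF f])
  moreover have "(\<lambda>k. real k * norm (c k) * (9 / sqrt (degree f))) sums
      ((\<Sum>k. real k * norm (c k)) * (9 / sqrt (degree f)))"
    by (intro sums_mult2 summable_sums c)
  moreover have "norm (c k * root_mean f (\<lambda>x. x ^ k) - c k * root_mean (pderiv f) (\<lambda>x. x ^ k))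
      \<le> real k * norm (c k) * (9 / sqrt (degree f))" for k
  proof -
    have "norm (c k * root_mean f (\<lambda>x. x ^ k) - c k * root_mean (pderiv f) (\<lambda>x. x ^ k))
        = norm (c k) * norm (root_mean f (\<lambda>x. x ^ k) - root_mean (pderiv f) (\<lambda>x. x ^ k))"
      by (simp only: right_diff_distrib[symmetric] norm_mult)
    also have "\<dots> \<le> norm (c k) * (9 * real k / sqrt (degree f))"
      by (intro mult_left_mono root_mean_power_diff_le[OF f]) auto
    finally show ?thesis by (simp add: mult_ac)
  qed
  ultimately have "norm (root_mean f F - root_mean (pderiv f) F)
      \<le> (\<Sum>k. real k * norm (c k)) * (9 / sqrt (degree f))"
    by (rule norm_sums_le)
  then show ?thesis by (simp add: mult_ac)
qed

text \<open>In the lune \<open>|z| \<ge> 1 - a\<close> and \<open>Re z < a / 2\<close>. If \<open>Re z \<le> 0\<close> then \<open>z / |z|\<close> is the required point;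
  otherwise \<open>z\<close> is close to \<open>\<i>\<close> or \<open>-\<i>\<close>.\<close>

lemma lune_near_left_semicircle:
  assumes a: "0 \<le> a" "a \<le> 1" and z: "norm z \<le> 1" "1 < norm (z - of_real a)"
  obtains w where "w \<in> left_semicircle" "norm (z - w) \<le> 2 * a"
proof (cases "Re z \<le> 0")
  case True
  have z0: "z \<noteq> 0" using z a by auto
  have "norm (z - of_real a) \<le> norm z + a" using norm_triangle_ineq4[of z "of_real a"] a by simp
  then have l: "1 - norm z \<le> a" using z by linarith
  define w where "w = z / of_real (norm z)"
  have "w \<in> left_semicircle" using z0 True by (simp add: left_semicircle_eq w_def norm_divide divide_nonpos_nonneg)
  moreover have "norm (z - w) = 1 - norm z"
  proof -
    have "z - w = of_real (norm z - 1) * w" using z0 by (simp add: w_def field_simps)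
    then show ?thesis using z z0 by (simp only: norm_mult norm_of_real) (simp add: w_def norm_divide)
  qed
  ultimately show ?thesis using that[of w] l a by auto
next
  case False
  have "1 < (norm (z - of_real a))\<^sup>2" using z by (simp add: one_less_power)
  also have "\<dots> = (norm z)\<^sup>2 - 2 * a * Re z + a\<^sup>2"
    unfolding cmod_power2 by (simp add: power2_eq_square algebra_simps)
  also have "(norm z)\<^sup>2 \<le> 1" using z by (simp add: abs_square_le_1)
  finally have "a * (2 * Re z) < a * a" by (simp add: power2_eq_square)
  then have re: "2 * Re z < a" using a by (simp add: mult_less_cancel_left)
  have "norm (z - of_real a) \<le> norm z + a" using norm_triangle_ineq4[of z "of_real a"] a by simp
  moreover have "norm z \<le> \<bar>Re z\<bar> + \<bar>Im z\<bar>" by (rule cmod_le)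
  ultimately have im: "1 - a - a / 2 \<le> \<bar>Im z\<bar>" using z re False by linarith
  have im1: "\<bar>Im z\<bar> \<le> 1" using abs_Im_le_cmod[of z] z by linarith
  define w where "w = (if Im z \<ge> 0 then \<i> else - \<i>)"
  have "norm (z - w) \<le> \<bar>Re (z - w)\<bar> + \<bar>Im (z - w)\<bar>" by (rule cmod_le)
  also have "\<dots> \<le> 2 * a" using im im1 re False by (auto simp: w_def)
  finally have "norm (z - w) \<le> 2 * a" .
  moreover have "w \<in> left_semicircle" by (auto simp: w_def left_semicircle_eq)
  ultimately show ?thesis using that by blast
qed

text \<open>Markov's inequality for the real part of the barrier, which is bounded below on \<open>K\<close>. Its mean over
  the zeroes is compared with its mean over the critical points, and these lie within \<open>2 a\<close> of a set
  on which it vanishes.\<close>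

lemma root_mean_indicator_compact_le:
  assumes K: "compact K" "K \<subseteq> cball 0 1 - left_semicircle"
  obtains A where "0 \<le> A"
    "\<And>f a. sendov_exception f a \<Longrightarrow> root_mean f (indicator K) \<le> A * (a + 1 / sqrt (degree f))"
proof (cases "K = {}")
  case True
  have "root_mean f (indicator K :: _ \<Rightarrow> real) = 0" for f by (simp add: True root_mean_def)
  then show ?thesis using that[of 0] by simp
next
  case False
  define L where "L = (\<Sum>k. real k * norm (barrier_coeff k))"
  have L: "0 \<le> L" unfolding L_def using summable_barrier_coeff by (intro suminf_nonneg) auto
  have "continuous_on K (\<lambda>z. Re (barrier z))"
    using K by (intro continuous_intros continuous_on_subset[OF continuous_on_barrier]) auto
  then obtain z0 where z0: "z0 \<in> K" "\<And>z. z \<in> K \<Longrightarrow> Re (barrier z0) \<le> Re (barrier z)"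
    using continuous_attains_inf[OF K(1) False] by metis
  define b where "b = Re (barrier z0)"
  have b: "b > 0" unfolding b_def using z0 K by (intro Re_barrier_pos) auto
  have nonneg: "0 \<le> Re (barrier z)" if "norm z \<le> 1" for z
    using Re_barrier_pos[of z] that by (cases "z \<in> left_semicircle") (auto simp: left_semicircle_eq Re_barrier_unit_circle less_imp_le)
  show ?thesis
  proof (rule that)
    show "0 \<le> 9 * L / b" using L b by simp
    fix f a assume f: "sendov_exception f a"
    then have a: "0 \<le> a" "a \<le> 1" by (auto simp: sendov_exception_def)
    have "b * root_mean f (indicator K) = root_mean f (\<lambda>x. b * indicator K x)"
      by (simp add: root_mean_cmult)
    also have "\<dots> \<le> root_mean f (\<lambda>x. Re (barrier x))"
    proof (rule root_mean_mono)
      fix x assume "x \<in># proots f"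
      then show "b * indicator K x \<le> Re (barrier x)"
        using z0 nonneg[of x] sendov_exception_roots(1)[OF f] by (auto simp: indicator_def b_def)
    qed
    also have "\<dots> = Re (root_mean f barrier)" by (simp add: Re_root_mean)
    also have "\<dots> \<le> Re (root_mean (pderiv f) barrier) + 9 * L / sqrt (degree f)"
    proof -
      have "Re (root_mean f barrier) - Re (root_mean (pderiv f) barrier)
          \<le> norm (root_mean f barrier - root_mean (pderiv f) barrier)"
        by (metis complex_Re_le_cmod minus_complex.simps(1))
      also have "\<dots> \<le> 9 * L / sqrt (degree f)"
        using root_mean_power_series_diff_le[OF f summable_barrier_coeff]
        by (simp add: barrier_def[abs_def] L_def)
      finally show ?thesis by simp
    qed
    also have "Re (root_mean (pderiv f) barrier) = root_mean (pderiv f) (\<lambda>x. Re (barrier x))"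
      by (simp add: Re_root_mean)
    also have "\<dots> \<le> root_mean (pderiv f) (\<lambda>_. 2 * a * L)"
    proof (rule root_mean_mono)
      fix x assume x: "x \<in># proots (pderiv f)"
      obtain w where w: "w \<in> left_semicircle" "norm (x - w) \<le> 2 * a"
        using lune_near_left_semicircle[OF a sendov_exception_roots(2,3)[OF f x]] .
      have "Re (barrier x) = Re (barrier x - barrier w)"
        using w by (simp add: left_semicircle_eq Re_barrier_unit_circle)
      also have "\<dots> \<le> norm (barrier x - barrier w)" by (rule complex_Re_le_cmod)
      also have "\<dots> \<le> L * norm (x - w)"
        unfolding L_def using w sendov_exception_roots(2)[OF f x]
        by (intro barrier_lipschitz) (auto simp: left_semicircle_eq)
      also have "\<dots> \<le> L * (2 * a)" using w L by (intro mult_left_mono)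
      finally show "Re (barrier x) \<le> 2 * a * L" by (simp add: mult_ac)
    qed
    also have "\<dots> = 2 * a * L"
      using f by (intro root_mean_const) (simp add: sendov_exception_def degree_pderiv)
    finally have "b * root_mean f (indicator K) \<le> 2 * a * L + 9 * L / sqrt (degree f)" by simp
    also have "\<dots> \<le> 9 * L * (a + 1 / sqrt (degree f))"
      using a L by (simp add: algebra_simps)
    finally show "root_mean f (indicator K) \<le> 9 * L / b * (a + 1 / sqrt (degree f))"
      using b by (simp add: field_simps)
  qed
qed

section \<open>Laplace's method along a segment\<close>

lemma norm_one_plus_le_exp: "norm (1 + u) \<le> exp (Re u + (norm u)\<^sup>2 / 2)" for u :: complex
proof -
  have "(norm (1 + u))\<^sup>2 = 1 + (2 * Re u + (norm u)\<^sup>2)"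
    unfolding cmod_power2 by (simp add: power2_eq_square algebra_simps)
  also have "\<dots> \<le> exp (2 * Re u + (norm u)\<^sup>2)" by (rule exp_ge_add_one_self)
  also have "\<dots> = (exp (Re u + (norm u)\<^sup>2 / 2))\<^sup>2"
    by (simp add: power2_eq_square exp_add[symmetric])
  finally show ?thesis by (rule power2_le_imp_le) simp
qed

text \<open>The function \<open>y - y\<^sup>2/2 + y\<^sup>3/3 - ln (1 + y)\<close> has derivative \<open>y\<^sup>3 / (1 + y)\<close>, hence its minimum at \<open>0\<close>.\<close>

lemma one_plus_le_exp_cubic:
  fixes y :: real
  assumes "-1 < y"
  shows "1 + y \<le> exp (y - y\<^sup>2 / 2 + y ^ 3 / 3)"
proof -
  define g where "g = (\<lambda>y::real. y - y\<^sup>2 / 2 + y ^ 3 / 3 - ln (1 + y))"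
  have D: "(g has_real_derivative y ^ 3 / (1 + y)) (at y)" if "-1 < y" for y
    unfolding g_def using that
    by (auto intro!: derivative_eq_intros simp: field_simps power2_eq_square power3_eq_cube)
  have "g 0 \<le> g y"
  proof (cases "0 \<le> y")
    case True
    then show ?thesis
      by (rule DERIV_nonneg_imp_nondecreasing[of 0 y g]) (use D in force)
  next
    case False
    then have "y \<le> 0" by simp
    then show ?thesis
    proof (rule DERIV_nonpos_imp_nonincreasing[of y 0 g])
      fix x assume "y \<le> x" "x \<le> 0"
      then have "x ^ 3 / (1 + x) \<le> 0" "-1 < x"
        using assms by (auto simp: divide_nonpos_pos power_le_zero_eq)
      then show "\<exists>d. (g has_real_derivative d) (at x) \<and> d \<le> 0" using D by blast
    qed
  qed
  then have "ln (1 + y) \<le> y - y\<^sup>2 / 2 + y ^ 3 / 3" by (simp add: g_def)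
  then have "exp (ln (1 + y)) \<le> exp (y - y\<^sup>2 / 2 + y ^ 3 / 3)" by simp
  then show ?thesis using assms by simp
qed

text \<open>The second-order expansion of \<open>log |1 + u|\<close>, obtained from the real case with
  \<open>1 + y = |1 + u|\<^sup>2\<close>, \<open>y = 2 Re u + |u|\<^sup>2\<close>.\<close>

lemma norm_one_plus_le_exp_cubic:
  fixes u :: complex
  assumes "norm u \<le> 1 / 2"
  shows "norm (1 + u) \<le> exp (Re u - Re (u\<^sup>2) / 2 + 4 * norm u ^ 3)"
proof -
  define r where "r = norm u"
  define y where "y = 2 * Re u + r\<^sup>2"
  have r: "0 \<le> r" "r \<le> 1 / 2" using assms by (auto simp: r_def)
  have re: "\<bar>Re u\<bar> \<le> r" unfolding r_def by (rule abs_Re_le_cmod)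
  have sq: "(norm (1 + u))\<^sup>2 = 1 + y"
    unfolding y_def r_def cmod_power2 by (simp add: power2_eq_square algebra_simps)
  have "1 / 2 \<le> norm (1 + u)"
    using norm_triangle_ineq2[of 1 "- u"] assms by simp
  then have "0 < (norm (1 + u))\<^sup>2" by (intro zero_less_power) linarith
  then have y: "-1 < y" using sq by linarith
  have "y - y\<^sup>2 / 2 + y ^ 3 / 3 \<le> 2 * (Re u - Re (u\<^sup>2) / 2 + 4 * r ^ 3)"
  proof -
    have ruu: "Re (u\<^sup>2) = 2 * (Re u)\<^sup>2 - r\<^sup>2"
      unfolding r_def cmod_power2 by (simp add: power2_eq_square)
    have "y - y\<^sup>2 / 2 = 2 * Re u - Re (u\<^sup>2) - 2 * (Re u * r\<^sup>2) - r\<^sup>2 * r\<^sup>2 / 2"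
      unfolding y_def ruu by (simp add: power2_eq_square field_simps)
    moreover have "- 2 * (Re u * r\<^sup>2) \<le> 2 * r ^ 3"
    proof -
      have "- Re u * r\<^sup>2 \<le> r * r\<^sup>2" using re by (intro mult_right_mono) auto
      then show ?thesis by (simp add: power3_eq_cube power2_eq_square mult_ac)
    qed
    moreover have "y ^ 3 / 3 \<le> 6 * r ^ 3"
    proof -
      have "r\<^sup>2 \<le> r / 2" using r mult_left_mono[of r "1/2" r] by (simp add: power2_eq_square)
      then have "\<bar>y\<bar> \<le> 5 / 2 * r" unfolding y_def using re r zero_le_power2[of r] by linarith
      then have "\<bar>y\<bar> ^ 3 \<le> (5 / 2 * r) ^ 3" by (intro power_mono) auto
      then have "y ^ 3 \<le> (5 / 2 * r) ^ 3" by (metis abs_le_D1 power_abs)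
      also have "\<dots> = 125 / 8 * r ^ 3" by (simp add: power_mult_distrib power3_eq_cube)
      also have "\<dots> \<le> 18 * r ^ 3" using r by (intro mult_right_mono) auto
      finally show ?thesis by simp
    qed
    moreover have "0 \<le> r\<^sup>2 * r\<^sup>2 / 2" by simp
    moreover have "s + t \<le> 2 * (A - B / 2 + 4 * R)"
      if "s = 2 * A - B - 2 * C - E" "- 2 * C \<le> 2 * R" "t \<le> 6 * R" "0 \<le> E" for s t A B C E R :: real
      using that by simp
    ultimately show ?thesis by blast
  qed
  then have "(norm (1 + u))\<^sup>2 \<le> exp (2 * (Re u - Re (u\<^sup>2) / 2 + 4 * r ^ 3))"
    using one_plus_le_exp_cubic[OF y] unfolding sq by (meson exp_le_cancel_iff order_trans)
  also have "\<dots> = (exp (Re u - Re (u\<^sup>2) / 2 + 4 * r ^ 3))\<^sup>2"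
    by (rule exp_double)
  finally show ?thesis unfolding r_def by (rule power2_le_imp_le) simp
qed

lemma norm_poly_le_exp:
  fixes p :: "complex poly"
  assumes pa: "poly p a \<noteq> 0"
    and h: "\<And>x. x \<in># proots p \<Longrightarrow> norm (1 + w / (a - x)) \<le> exp (h x)"
  shows "norm (poly p (a + w)) \<le> exp (degree p * root_mean p h) * norm (poly p a)"
proof (cases "degree p = 0")
  case True
  then show ?thesis by (auto elim!: degree_eq_zeroE)
next
  case False
  have ne: "a \<noteq> x" if "x \<in># proots p" for x
    using that pa by (cases "p = 0") auto
  have "norm (\<Prod>x\<in>#A. a + w - x) \<le> exp (\<Sum>x\<in>#A. h x) * norm (\<Prod>x\<in>#A. a - x)"
    if "\<forall>x. x \<in># A \<longrightarrow> x \<in># proots p" for A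
    using that
  proof (induction A)
    case (add x A)
    have "a + w - x = (1 + w / (a - x)) * (a - x)"
      using ne[of x] add.prems by (simp add: distrib_right)
    then have "norm (a + w - x) = norm (1 + w / (a - x)) * norm (a - x)"
      by (simp only: norm_mult)
    also have "\<dots> \<le> exp (h x) * norm (a - x)"
      using h[of x] add.prems by (intro mult_right_mono) auto
    finally have "norm (a + w - x) * norm (\<Prod>x\<in>#A. a + w - x)
        \<le> exp (h x) * norm (a - x) * (exp (\<Sum>x\<in>#A. h x) * norm (\<Prod>x\<in>#A. a - x))"
      using add by (intro mult_mono) auto
    then show ?case by (simp add: norm_mult exp_add mult_ac)
  qed simp
  then have "norm (\<Prod>x\<in>#proots p. a + w - x) \<le> exp (\<Sum>x\<in>#proots p. h x) * norm (\<Prod>x\<in>#proots p. a - x)"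
    by blast
  moreover have "(\<Sum>x\<in>#proots p. h x) = degree p * root_mean p h"
    using False by (simp add: root_mean_def size_proots_complex)
  ultimately show ?thesis
    by (simp add: poly_eq_prod_proots[of p] norm_mult mult_left_mono mult.left_commute)
qed

text \<open>Let \<open>p = f'\<close> and \<open>V = p'(a) / p(a)\<close>. If \<open>p\<close> were exactly \<open>exp (V z)\<close>, then \<open>p - V f\<close> would be constant.
  In general its derivative along the segment is \<open>w p\<close> times the difference of \<open>p' / p\<close> at the current
  point and at \<open>a\<close>, which is \<open>O(m s)\<close>; against the decay \<open>exp (- \<kappa> m s)\<close> this integrates to \<open>O(1 / m)\<close>.
  So \<open>|V f|\<close> at the midpoint is nearly \<open>|p(a)|\<close>, where \<open>|V| \<le> m\<close>, and the second half of the segment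
  adds only an exponentially small amount. Stopping at the midpoint keeps the points at a distance
  at least \<open>1/2\<close> from all zeroes of \<open>p\<close>.\<close>

lemma laplace_lower_bound_aux:
  fixes f :: "complex poly" and a w :: complex and \<kappa> :: real
  assumes \<kappa>: "\<kappa> > 0" and fa: "poly f a = 0" and deg: "degree f = Suc m" "m \<ge> 1"
    and far: "\<And>x. poly (pderiv f) x = 0 \<Longrightarrow> 1 \<le> norm (a - x)" and w: "norm w \<le> 1"
    and decay: "\<And>s. 0 \<le> s \<Longrightarrow> s \<le> 1 \<Longrightarrow>
       norm (poly (pderiv f) (a + of_real s * w)) \<le> exp (- \<kappa> * m * s) * norm (poly (pderiv f) a)"
  shows "(1 - exp (- \<kappa> * m / 2) - 2 / (\<kappa>\<^sup>2 * m) - m * exp (- \<kappa> * m / 2) / 2) * norm (poly (pderiv f) a)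
      \<le> m * norm (poly f (a + w))"
proof -
  define p where "p = pderiv f"
  define P where "P = norm (poly p a)"
  define G where "G = (\<lambda>s::real. a + of_real s * w)"
  have dp: "degree p = m" using deg by (simp add: p_def degree_pderiv)
  have p0: "p \<noteq> 0" using dp deg by auto
  have pa: "poly p a \<noteq> 0" using far[of a] by (auto simp: p_def)
  define V where "V = (\<Sum>x\<in>#proots p. 1 / (a - x))"
  have far': "1 \<le> norm (a - x)" if "x \<in># proots p" for x
    using that p0 far by (auto simp: p_def)
  have V: "norm V \<le> m"
  proof -
    have "norm (1 / (a - x)) \<le> 1" if "x \<in># proots p" for x
      using far'[OF that] by (simp add: norm_divide divide_le_eq_1)
    then have "norm V \<le> real (size (proots p)) * 1" unfolding V_def by (intro norm_sum_mset_le)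
    then show ?thesis by (simp add: size_proots_complex dp)
  qed
  have dG: "(G has_vector_derivative w) (at s)" for s
    unfolding G_def by (auto intro!: derivative_eq_intros)
  have dq: "((\<lambda>s. poly q (G s)) has_vector_derivative w * poly (pderiv q) (G s)) (at s)" for q s
    using field_vector_diff_chain_at[OF dG poly_DERIV[of q "G s"]] by (simp add: o_def)
  define \<Phi> where "\<Phi> = (\<lambda>s. poly p (G s) - V * poly f (G s))"
  define \<Phi>' where "\<Phi>' = (\<lambda>s. w * (poly (pderiv p) (G s) - V * poly p (G s)))"
  define k where "k = \<kappa> * m"
  have k: "k > 0" using \<kappa> deg by (simp add: k_def)
  have decay': "norm (poly p (G s)) \<le> exp (- k * s) * P" if "0 \<le> s" "s \<le> 1" for s
    using decay[OF that] by (simp add: p_def G_def P_def k_def)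
  have dPhi: "(\<Phi> has_vector_derivative \<Phi>' s) (at s)" for s
    unfolding \<Phi>_def \<Phi>'_def right_diff_distrib p_def
    by (auto intro!: derivative_eq_intros dq simp: mult_ac)
  have Phi'_le: "norm (\<Phi>' s) \<le> 2 * m * P * (s * exp (- k * s))" if s: "0 \<le> s" "s \<le> 1 / 2" for s
  proof -
    have lo: "1 / 2 * norm (a - x) \<le> norm (G s - x)" if "x \<in># proots p" for x
    proof -
      have "norm (of_real s * w) \<le> 1 / 2 * 1" unfolding norm_mult using s w by (intro mult_mono) auto
      then have "norm (of_real s * w) \<le> 1 / 2 * norm (a - x)" using far'[OF that] by linarith
      moreover have "norm (a - x) - norm (of_real s * w) \<le> norm (G s - x)"
        using norm_triangle_ineq2[of "a - x" "- (of_real s * w)"] by (simp add: G_def algebra_simps)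
      ultimately show ?thesis by linarith
    qed
    have nz: "poly p (G s) \<noteq> 0"
    proof
      assume "poly p (G s) = 0"
      then have "G s \<in># proots p" using p0 by simp
      from lo[OF this] far'[OF this] show False by simp
    qed
    have each: "norm (1 / (G s - x) - 1 / (a - x)) \<le> 2 * s" if x: "x \<in># proots p" for x
    proof -
      have ne: "G s - x \<noteq> 0" "a - x \<noteq> 0" using lo[OF x] far'[OF x] by auto
      have "1 / (G s - x) - 1 / (a - x) = - (of_real s * w) / ((G s - x) * (a - x))"
        using ne by (simp add: field_simps G_def)
      then have "norm (1 / (G s - x) - 1 / (a - x)) = s * norm w / (norm (G s - x) * norm (a - x))"
        using s by (simp add: norm_divide norm_mult)
      also have "\<dots> \<le> s * 1 / (1 / 2 * 1)"
      proof (rule frac_le)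
        have "1 / 2 \<le> norm (G s - x)" using lo[OF x] far'[OF x] by linarith
        then show "1 / 2 * 1 \<le> norm (G s - x) * norm (a - x)"
          using far'[OF x] by (intro mult_mono) auto
        show "s * norm w \<le> s * 1" using s w by (intro mult_left_mono) auto
      qed (use s in auto)
      finally show ?thesis by simp
    qed
    have "poly (pderiv p) (G s) - V * poly p (G s)
        = poly p (G s) * ((\<Sum>x\<in>#proots p. 1 / (G s - x)) - V)"
      by (simp add: poly_pderiv_eq_sum_proots[OF nz] algebra_simps)
    also have "(\<Sum>x\<in>#proots p. 1 / (G s - x)) - V = (\<Sum>x\<in>#proots p. 1 / (G s - x) - 1 / (a - x))"
    proof -
      have "(\<Sum>x\<in>#A. 1 / (G s - x)) - (\<Sum>x\<in>#A. 1 / (a - x)) = (\<Sum>x\<in>#A. 1 / (G s - x) - 1 / (a - x))" for A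
        by (induction A) (auto simp: algebra_simps)
      then show ?thesis by (simp add: V_def)
    qed
    finally have "norm (\<Phi>' s) = norm w * (norm (poly p (G s)) * norm (\<Sum>x\<in>#proots p. 1 / (G s - x) - 1 / (a - x)))"
      by (simp add: \<Phi>'_def norm_mult)
    also have "\<dots> \<le> 1 * ((exp (- k * s) * P) * (real (size (proots p)) * (2 * s)))"
    proof (intro mult_mono norm_sum_mset_le each w)
      show "norm (poly p (G s)) \<le> exp (- k * s) * P" using s by (intro decay') auto
    qed (use s in \<open>auto simp: P_def\<close>)
    finally show ?thesis by (simp add: size_proots_complex dp mult_ac)
  qed
  \<comment> \<open>An antiderivative of the bound on the derivative of \<open>\<Phi>\<close>; its total increase is at most \<open>2 m P / k\<^sup>2\<close>.\<close>
  define \<phi> where "\<phi> = (\<lambda>s. - (2 * m * P) * ((s / k + 1 / k\<^sup>2) * exp (- k * s)))"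
  have dphi: "(\<phi> has_vector_derivative 2 * m * P * (s * exp (- k * s))) (at s)" for s
    unfolding \<phi>_def has_real_derivative_iff_has_vector_derivative[symmetric]
    using k by (auto intro!: derivative_eq_intros simp: field_simps power2_eq_square)
  have "norm (\<Phi> (1/2) - \<Phi> 0) \<le> \<phi> (1/2) - \<phi> 0"
  proof (rule differentiable_bound_general)
    show "continuous_on {0..1/2} \<Phi>" "continuous_on {0..1/2} \<phi>"
      using dPhi dphi by (meson continuous_at_imp_continuous_on has_vector_derivative_continuous)+
  qed (use dPhi dphi Phi'_le in auto)
  also have "\<dots> \<le> 2 * m * P / k\<^sup>2"
    using k by (simp add: \<phi>_def P_def)
  finally have 1: "norm (\<Phi> (1/2) - \<Phi> 0) \<le> 2 * m * P / k\<^sup>2" .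
  have "norm (poly f (G 1) - poly f (G (1/2))) \<le> exp (- k / 2) * P * 1 - exp (- k / 2) * P * (1/2)"
  proof (rule differentiable_bound_general)
    show "continuous_on {1/2..1} (\<lambda>s. poly f (G s))"
      using dq by (meson continuous_at_imp_continuous_on has_vector_derivative_continuous)
    show "norm (w * poly p (G s)) \<le> exp (- k / 2) * P" if "1 / 2 < s" "s < 1" for s
    proof -
      have "norm (w * poly p (G s)) \<le> 1 * (exp (- k * s) * P)"
        unfolding norm_mult using w that decay'[of s] by (intro mult_mono) auto
      also have "exp (- k * s) \<le> exp (- k / 2)" using that k by simp
      finally show ?thesis by (simp add: P_def mult_right_mono)
    qed
    show "((*) (exp (- k / 2) * P) has_vector_derivative exp (- k / 2) * P) (at s)" for s
      unfolding has_real_derivative_iff_has_vector_derivative[symmetric]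
      by (auto intro!: derivative_eq_intros)
  qed (auto intro!: continuous_intros dq simp: p_def)
  then have 2: "norm (poly f (G 1) - poly f (G (1/2))) \<le> exp (- k / 2) * P / 2" by (simp add: mult_ac)
  have "\<Phi> (1/2) - \<Phi> 0 = poly p (G (1/2)) - V * poly f (G (1/2)) - poly p a"
    using fa by (simp add: \<Phi>_def G_def)
  then have "poly p a = poly p (G (1/2)) - V * poly f (G (1/2)) - (\<Phi> (1/2) - \<Phi> 0)" by simp
  then have "P \<le> norm (poly p (G (1/2))) + norm (V * poly f (G (1/2))) + norm (\<Phi> (1/2) - \<Phi> 0)"
    unfolding P_def by (metis add_right_mono norm_triangle_ineq4 order_trans)
  also have "\<dots> \<le> exp (- k / 2) * P + m * (norm (poly f (a + w)) + exp (- k / 2) * P / 2) + 2 * m * P / k\<^sup>2"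
  proof (intro add_mono 1)
    show "norm (poly p (G (1/2))) \<le> exp (- k / 2) * P" using decay'[of "1/2"] by simp
    have "norm (poly f (G (1/2))) \<le> norm (poly f (a + w)) + norm (poly f (G 1) - poly f (G (1/2)))"
      using norm_triangle_ineq4[of "poly f (G 1)" "poly f (G 1) - poly f (G (1/2))"] by (simp add: G_def)
    also have "\<dots> \<le> norm (poly f (a + w)) + exp (- k / 2) * P / 2" using 2 by simp
    finally show "norm (V * poly f (G (1/2))) \<le> m * (norm (poly f (a + w)) + exp (- k / 2) * P / 2)"
      unfolding norm_mult using V by (intro mult_mono) auto
  qed
  also have "2 * m * P / k\<^sup>2 = 2 / (\<kappa>\<^sup>2 * m) * P"
    using deg by (simp add: k_def power2_eq_square)
  finally have "P \<le> exp (- k / 2) * P + m * (norm (poly f (a + w)) + exp (- k / 2) * P / 2) + 2 / (\<kappa>\<^sup>2 * m) * P" .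
  then show ?thesis
    unfolding P_def[symmetric] p_def[symmetric] by (simp add: k_def algebra_simps)
qed

lemma laplace_lower_bound:
  fixes \<kappa> :: real
  assumes "\<kappa> > 0"
  shows "\<forall>\<^sub>F m in sequentially. \<forall>(f :: complex poly) a w.
    poly f a = 0 \<and> degree f = Suc m \<and> (\<forall>x. poly (pderiv f) x = 0 \<longrightarrow> 1 \<le> norm (a - x)) \<and> norm w \<le> 1 \<and>
    (\<forall>s\<in>{0..1}. norm (poly (pderiv f) (a + of_real s * w)) \<le> exp (- \<kappa> * m * s) * norm (poly (pderiv f) a))
    \<longrightarrow> norm (poly (pderiv f) a) \<le> 2 * m * norm (poly f (a + w))"
proof -
  have "((\<lambda>m. 1 - exp (- \<kappa> * real m / 2) - 2 / (\<kappa>\<^sup>2 * real m) - real m * exp (- \<kappa> * real m / 2) / 2) \<longlonglongrightarrow> 1)"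
    using assms by real_asymp
  then have "\<forall>\<^sub>F m in sequentially.
      1 / 2 < 1 - exp (- \<kappa> * real m / 2) - 2 / (\<kappa>\<^sup>2 * real m) - real m * exp (- \<kappa> * real m / 2) / 2"
    by (rule order_tendstoD) simp
  then show ?thesis
    using eventually_ge_at_top[of 1]
  proof eventually_elim
    case (elim m)
    show ?case
    proof (intro allI impI, elim conjE)
      fix f :: "complex poly" and a w
      assume *: "poly f a = 0" "degree f = Suc m" "\<forall>x. poly (pderiv f) x = 0 \<longrightarrow> 1 \<le> norm (a - x)" "norm w \<le> 1"
        "\<forall>s\<in>{0..1}. norm (poly (pderiv f) (a + of_real s * w)) \<le> exp (- \<kappa> * m * s) * norm (poly (pderiv f) a)"
      have "1 / 2 * norm (poly (pderiv f) a) \<le>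
          (1 - exp (- \<kappa> * m / 2) - 2 / (\<kappa>\<^sup>2 * m) - m * exp (- \<kappa> * m / 2) / 2) * norm (poly (pderiv f) a)"
        using elim by (intro mult_right_mono) auto
      also have "\<dots> \<le> m * norm (poly f (a + w))"
        using * elim by (intro laplace_lower_bound_aux[OF assms]) auto
      finally show "norm (poly (pderiv f) a) \<le> 2 * m * norm (poly f (a + w))" by simp
    qed
  qed
qed

section \<open>Critical points when the distinguished zero approaches the circle\<close>

lemma filterlim_at_top_of_Suc:
  assumes "filterlim (\<lambda>k. Suc (m k)) at_top F" shows "filterlim m at_top F"
  unfolding filterlim_at_top
proof
  fix Z
  have "\<forall>\<^sub>F k in F. Suc Z \<le> Suc (m k)" using assms unfolding filterlim_at_top by blast
  then show "\<forall>\<^sub>F k in F. Z \<le> m k" by simp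
qed

lemma sendov_exception_pderiv:
  assumes "sendov_exception f a"
  shows "degree (pderiv f) \<noteq> 0" "poly (pderiv f) (of_real a) \<noteq> 0" "degree f = Suc (degree (pderiv f))"
    and "poly (pderiv f) x = 0 \<Longrightarrow> 1 \<le> norm (of_real a - x)"
  using assms by (auto simp: sendov_exception_def degree_pderiv norm_minus_commute less_imp_le)

lemma norm_inverse_critical_le:
  assumes "sendov_exception f a" "x \<in># proots (pderiv f)"
  shows "norm (1 / (of_real a - x)) \<le> 1"
  using sendov_exception_roots(3)[OF assms] by (simp add: norm_divide norm_minus_commute divide_le_eq_1)

text \<open>The sign condition selects one of the two conjugate points of the circle at distance \<open>\<tau>\<close> from \<open>1\<close>. It
  serves to discard a first-order term, which would otherwise dominate the second-order ones.\<close>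

lemma circle_point_exists:
  fixes \<tau> b :: real
  assumes "0 < \<tau>" "\<tau> \<le> 1"
  obtains w :: complex where "norm (1 + w) = 1" "norm w = \<tau>" "Re w = - \<tau>\<^sup>2 / 2" "0 \<le> Im w * b"
proof -
  define \<eta> where "\<eta> = sqrt (\<tau>\<^sup>2 - (\<tau>\<^sup>2 / 2)\<^sup>2)"
  have "\<tau>\<^sup>2 \<le> 1" using assms by (simp add: abs_square_le_1)
  then have "\<tau>\<^sup>2 * \<tau>\<^sup>2 \<le> \<tau>\<^sup>2 * 1" by (intro mult_left_mono) auto
  moreover have "(\<tau>\<^sup>2 / 2)\<^sup>2 = \<tau>\<^sup>2 * \<tau>\<^sup>2 / 4" by (simp add: power2_eq_square)
  ultimately have nn: "0 \<le> \<tau>\<^sup>2 - (\<tau>\<^sup>2 / 2)\<^sup>2" using zero_le_power2[of \<tau>] by linarith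
  then have \<eta>: "\<eta>\<^sup>2 = \<tau>\<^sup>2 - (\<tau>\<^sup>2 / 2)\<^sup>2" "0 \<le> \<eta>" by (auto simp: \<eta>_def)
  define w where "w = Complex (- \<tau>\<^sup>2 / 2) (if 0 \<le> b then \<eta> else - \<eta>)"
  have im: "(Im w)\<^sup>2 = \<tau>\<^sup>2 - (\<tau>\<^sup>2 / 2)\<^sup>2" using \<eta> by (simp add: w_def)
  have "(norm w)\<^sup>2 = \<tau>\<^sup>2" unfolding cmod_power2 im by (simp add: w_def)
  then have "norm w = \<tau>" using assms by (simp add: power2_eq_iff_nonneg)
  moreover have "(norm (1 + w))\<^sup>2 = 1"
    unfolding cmod_power2 using im by (simp add: w_def power2_eq_square algebra_simps)
  then have "norm (1 + w) = 1" by (simp add: power2_eq_1_iff) (metis norm_ge_zero not_one_le_zero neg_0_le_iff_le)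
  ultimately show ?thesis
    using that[of w] \<eta>(2) by (cases "0 \<le> b") (auto simp: w_def mult_nonneg_nonpos)
qed

text \<open>The mean of \<open>log |1 + s w v|\<close> is at most \<open>s (A - s B / 2 + 4 s\<^sup>2 |w|\<^sup>3)\<close> with \<open>A = Re (w \<alpha>)\<close> and
  \<open>B = Re (w\<^sup>2 \<beta>)\<close>. Up to the cubic term the bracket is affine in \<open>s\<close>, so it suffices to control it at
  the two ends \<open>s = 0\<close> and \<open>s = 1\<close>.\<close>

lemma pderiv_decay_on_segment:
  fixes f a w
  assumes f: "sendov_exception f a" and w: "norm w \<le> 1 / 2" and s: "0 \<le> s" "s \<le> 1"
  defines "\<alpha> \<equiv> root_mean (pderiv f) (\<lambda>x. 1 / (of_real a - x))"
    and "\<beta> \<equiv> root_mean (pderiv f) (\<lambda>x. (1 / (of_real a - x))\<^sup>2)"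
  assumes A: "Re (w * \<alpha>) + 4 * norm w ^ 3 \<le> - \<kappa>"
    and B: "Re (w * \<alpha>) - Re (w\<^sup>2 * \<beta>) / 2 + 4 * norm w ^ 3 \<le> - \<kappa>"
  shows "norm (poly (pderiv f) (of_real a + of_real s * w))
    \<le> exp (- \<kappa> * degree (pderiv f) * s) * norm (poly (pderiv f) (of_real a))"
proof -
  define p where "p = pderiv f"
  define v where "v = (\<lambda>x. 1 / (complex_of_real a - x))"
  define h where "h = (\<lambda>x. s * Re (w * v x) - s\<^sup>2 / 2 * Re (w\<^sup>2 * (v x)\<^sup>2) + s * (4 * norm w ^ 3))"
  note P = sendov_exception_pderiv[OF f, folded p_def]
  have "norm (poly p (of_real a + of_real s * w)) \<le> exp (degree p * root_mean p h) * norm (poly p (of_real a))"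
  proof (rule norm_poly_le_exp[OF P(2)])
    fix x assume x: "x \<in># proots p"
    define u where "u = of_real s * w / (of_real a - x)"
    have v1: "norm (v x) \<le> 1" using norm_inverse_critical_le[OF f] x by (simp add: p_def v_def)
    have u: "u = of_real s * (w * v x)" by (simp add: u_def v_def)
    have "norm (w * v x) \<le> norm w" unfolding norm_mult using v1 by (simp add: mult_left_le)
    then have nu: "norm u \<le> s * norm w" unfolding u norm_mult[of "of_real s"] using s by (simp add: mult_left_mono)
    also have "\<dots> \<le> 1 * (1 / 2)" using s w by (intro mult_mono) auto
    finally have "norm (1 + u) \<le> exp (Re u - Re (u\<^sup>2) / 2 + 4 * norm u ^ 3)"
      by (intro norm_one_plus_le_exp_cubic) simp
    also have "Re u = s * Re (w * v x)" by (simp add: u)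
    also have "Re (u\<^sup>2) = s\<^sup>2 * Re (w\<^sup>2 * (v x)\<^sup>2)"
    proof -
      have "u\<^sup>2 = of_real (s\<^sup>2) * (w\<^sup>2 * (v x)\<^sup>2)" by (simp add: u power_mult_distrib)
      then show ?thesis by (simp only: Re_complex_of_real Im_complex_of_real times_complex.simps(1))
    qed
    also have "exp (s * Re (w * v x) - s\<^sup>2 * Re (w\<^sup>2 * (v x)\<^sup>2) / 2 + 4 * norm u ^ 3) \<le> exp (h x)"
    proof -
      have "norm u ^ 3 \<le> (s * norm w) ^ 3" using nu by (intro power_mono) auto
      also have "\<dots> = s ^ 3 * norm w ^ 3" by (simp add: power_mult_distrib)
      also have "\<dots> \<le> s * norm w ^ 3"
        using s power_decreasing[of 1 3 s] by (intro mult_right_mono) auto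
      finally show ?thesis by (simp add: h_def)
    qed
    finally show "norm (1 + of_real s * w / (of_real a - x)) \<le> exp (h x)" by (simp add: u_def)
  qed
  also have "root_mean p h = s * Re (w * \<alpha>) - s\<^sup>2 / 2 * Re (w\<^sup>2 * \<beta>) + s * (4 * norm w ^ 3)"
    unfolding h_def \<alpha>_def \<beta>_def p_def[symmetric] v_def root_mean_add root_mean_diff root_mean_cmult root_mean_const[OF P(1)]
    by (simp only: Re_root_mean[symmetric] root_mean_cmult)
  also have "\<dots> = s * ((1 - s) * (Re (w * \<alpha>) + 4 * norm w ^ 3)
      + s * (Re (w * \<alpha>) - Re (w\<^sup>2 * \<beta>) / 2 + 4 * norm w ^ 3))"
    by (simp add: power2_eq_square field_simps)
  also have "\<dots> \<le> s * ((1 - s) * (- \<kappa>) + s * (- \<kappa>))"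
    using s A B by (intro mult_left_mono add_mono) auto
  also have "\<dots> = - \<kappa> * s" by (simp add: algebra_simps)
  finally have "norm (poly p (of_real a + of_real s * w)) \<le> exp (degree p * (- \<kappa> * s)) * norm (poly p (of_real a))"
    by (simp add: mult_left_mono mult_right_mono)
  then show ?thesis by (simp add: p_def mult_ac)
qed

text \<open>Let \<open>1 + w\<close> be a point of the unit circle at small distance \<open>\<tau>\<close> from \<open>1\<close>, on the side where \<open>Im \<alpha>\<close>
  only helps. Since \<open>w\<^sup>2 = - \<tau>\<^sup>2 (1 + w)\<close>, the quantity \<open>Re (w \<alpha>) - Re (w\<^sup>2 \<beta>) / 2\<close> is
  \<open>- (\<tau>\<^sup>2 / 2) (Re \<alpha> - Re \<beta>) + O(\<tau>\<^sup>3)\<close>. If \<open>Re \<alpha> > Re \<beta>\<close> this is negative, so \<open>f'\<close> decays exponentially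
  from \<open>a\<close> to \<open>1 + w\<close>. Then \<open>|f|\<close> is at least \<open>|f'(a)| / (2 m)\<close> at \<open>1 + w\<close>, but it is also at most
  \<open>(2 / n) |f'(1 + w)|\<close>, which is exponentially small compared with \<open>|f'(a)|\<close>.\<close>

lemma critical_moments_limit:
  fixes f :: "nat \<Rightarrow> complex poly" and a :: "nat \<Rightarrow> real"
  assumes f: "\<And>k. sendov_exception (f k) (a k)"
    and deg: "filterlim (\<lambda>k. degree (f k)) at_top sequentially" and a: "a \<longlonglongrightarrow> 1"
    and \<alpha>: "(\<lambda>k. root_mean (pderiv (f k)) (\<lambda>x. 1 / (of_real (a k) - x))) \<longlonglongrightarrow> \<alpha>"
    and \<beta>: "(\<lambda>k. root_mean (pderiv (f k)) (\<lambda>x. (1 / (of_real (a k) - x))\<^sup>2)) \<longlonglongrightarrow> \<beta>"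
    and half: "1 / 2 \<le> Re \<alpha>"
  shows "Re \<alpha> \<le> Re \<beta>"
proof (rule ccontr)
  assume gap: "\<not> Re \<alpha> \<le> Re \<beta>"
  \<comment> \<open>With \<open>\<tau> = \<kappa>1 / 40\<close> the cubic error \<open>4 \<tau>\<^sup>3\<close> is \<open>\<tau>\<^sup>2 \<kappa>1 / 10\<close>, a fraction of the main term \<open>\<tau>\<^sup>2 \<kappa>1 / 2\<close>.\<close>
  define \<kappa>1 where "\<kappa>1 = min (Re \<alpha> - Re \<beta>) 1"
  define \<tau> where "\<tau> = \<kappa>1 / 40"
  have \<kappa>1: "0 < \<kappa>1" "\<kappa>1 \<le> 1" "\<kappa>1 \<le> Re \<alpha> - Re \<beta>" using gap by (auto simp: \<kappa>1_def)
  have \<tau>: "0 < \<tau>" "\<tau> \<le> 1" using \<kappa>1 by (auto simp: \<tau>_def)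
  obtain w where w: "norm (1 + w) = 1" "norm w = \<tau>" "Re w = - \<tau>\<^sup>2 / 2" "0 \<le> Im w * Im \<alpha>"
    using circle_point_exists[OF \<tau>] .
  define \<kappa> where "\<kappa> = \<tau>\<^sup>2 * \<kappa>1 / 20"
  have \<kappa>: "\<kappa> > 0" using \<tau> \<kappa>1 by (simp add: \<kappa>_def)
  define m where "m = (\<lambda>k. degree (pderiv (f k)))"
  have degf: "degree (f k) = Suc (m k)" for k using sendov_exception_pderiv[OF f] by (simp add: m_def)
  have m: "filterlim m at_top sequentially"
    using deg unfolding degf by (rule filterlim_at_top_of_Suc)
  have "norm \<beta> \<le> 1"
  proof (rule tendsto_upperbound[OF tendsto_norm[OF \<beta>]])
    have "norm ((1 / (of_real (a k) - x))\<^sup>2) \<le> 1" if "x \<in># proots (pderiv (f k))" for k x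
      unfolding norm_power using norm_inverse_critical_le[OF f that] by (simp add: power_le_one)
    then show "\<forall>\<^sub>F k in sequentially. norm (root_mean (pderiv (f k)) (\<lambda>x. (1 / (of_real (a k) - x))\<^sup>2)) \<le> 1"
      by (intro always_eventually allI norm_root_mean_le) auto
  qed simp
  have Re_w\<alpha>: "Re (w * \<alpha>) \<le> - \<tau>\<^sup>2 / 2 * Re \<alpha>" using w by simp
  have w2: "w\<^sup>2 = - (\<tau>\<^sup>2 * (1 + w))"
  proof -
    have "w * cnj w = \<tau>\<^sup>2" using w(2) by (simp flip: complex_norm_square)
    moreover have "cnj w = - \<tau>\<^sup>2 - w" using w(3) by (simp add: complex_eq_iff)
    ultimately show ?thesis by (simp add: power2_eq_square algebra_simps)
  qed
  have Re_w2\<beta>: "- Re (w\<^sup>2 * \<beta>) \<le> \<tau>\<^sup>2 * Re \<beta> + \<tau>\<^sup>2 * \<tau>"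
  proof -
    have "\<bar>Re (w * \<beta>)\<bar> \<le> norm w * norm \<beta>" by (metis abs_Re_le_cmod norm_mult)
    also have "\<dots> \<le> \<tau> * 1" using \<open>norm \<beta> \<le> 1\<close> w \<tau> by (intro mult_mono) auto
    finally have "\<tau>\<^sup>2 * Re (w * \<beta>) \<le> \<tau>\<^sup>2 * \<tau>" by (intro mult_left_mono) auto
    moreover have "Re (w\<^sup>2 * \<beta>) = - (\<tau>\<^sup>2 * Re \<beta> + \<tau>\<^sup>2 * Re (w * \<beta>))"
    proof -
      have "w\<^sup>2 * \<beta> = - (of_real (\<tau>\<^sup>2) * (\<beta> + w * \<beta>))" unfolding w2 by (simp add: algebra_simps)
      then show ?thesis
        by (simp only: uminus_complex.simps Re_complex_of_real Im_complex_of_real times_complex.simps(1)[of "of_real _"] plus_complex.simps)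
          (simp add: algebra_simps)
    qed
    ultimately show ?thesis by simp
  qed
  have cub: "\<tau> ^ 3 = \<tau>\<^sup>2 * \<kappa>1 / 40" by (simp add: \<tau>_def power3_eq_cube power2_eq_square)
  have \<tau>3: "\<tau>\<^sup>2 * \<tau> = \<tau>\<^sup>2 * \<kappa>1 / 40" by (simp add: \<tau>_def)
  have t\<kappa>: "\<tau>\<^sup>2 * \<kappa>1 \<le> \<tau>\<^sup>2" "0 < \<tau>\<^sup>2 * \<kappa>1" using \<kappa>1 \<tau> by (auto simp: mult_left_le)
  have A: "Re (w * \<alpha>) + 4 * norm w ^ 3 < - \<kappa>"
  proof -
    have "\<tau>\<^sup>2 / 2 * (1 / 2) \<le> \<tau>\<^sup>2 / 2 * Re \<alpha>" using half by (intro mult_left_mono) auto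
    then show ?thesis using Re_w\<alpha> t\<kappa> unfolding w(2) cub \<kappa>_def by linarith
  qed
  have B: "Re (w * \<alpha>) - Re (w\<^sup>2 * \<beta>) / 2 + 4 * norm w ^ 3 < - \<kappa>"
  proof -
    have "\<tau>\<^sup>2 * \<kappa>1 \<le> \<tau>\<^sup>2 * (Re \<alpha> - Re \<beta>)" using \<kappa>1 by (intro mult_left_mono) auto
    then have "\<tau>\<^sup>2 * \<kappa>1 \<le> \<tau>\<^sup>2 * Re \<alpha> - \<tau>\<^sup>2 * Re \<beta>" by (simp add: right_diff_distrib)
    moreover have "Re (w * \<alpha>) \<le> - (\<tau>\<^sup>2 * Re \<alpha>) / 2" using Re_w\<alpha> by simp
    ultimately show ?thesis using Re_w2\<beta> t\<kappa> unfolding w(2) cub \<kappa>_def \<tau>3 by linarith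
  qed
  define W where "W = (\<lambda>k. 1 + w - of_real (a k))"
  have "W \<longlonglongrightarrow> 1 + w - of_real 1" unfolding W_def by (intro tendsto_intros a)
  then have W: "W \<longlonglongrightarrow> w" by simp
  define \<alpha>' where "\<alpha>' = (\<lambda>k. root_mean (pderiv (f k)) (\<lambda>x. 1 / (of_real (a k) - x)))"
  define \<beta>' where "\<beta>' = (\<lambda>k. root_mean (pderiv (f k)) (\<lambda>x. (1 / (of_real (a k) - x))\<^sup>2))"
  have "(\<lambda>k. Re (W k * \<alpha>' k) + 4 * norm (W k) ^ 3) \<longlonglongrightarrow> Re (w * \<alpha>) + 4 * norm w ^ 3"
    unfolding \<alpha>'_def by (intro tendsto_intros W \<alpha>)
  then have evA: "\<forall>\<^sub>F k in sequentially. Re (W k * \<alpha>' k) + 4 * norm (W k) ^ 3 < - \<kappa>"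
    using A by (rule order_tendstoD)
  have "(\<lambda>k. Re (W k * \<alpha>' k) - Re ((W k)\<^sup>2 * \<beta>' k) / 2 + 4 * norm (W k) ^ 3)
      \<longlonglongrightarrow> Re (w * \<alpha>) - Re (w\<^sup>2 * \<beta>) / 2 + 4 * norm w ^ 3"
    unfolding \<alpha>'_def \<beta>'_def by (intro tendsto_intros W \<alpha> \<beta>) auto
  then have evB: "\<forall>\<^sub>F k in sequentially. Re (W k * \<alpha>' k) - Re ((W k)\<^sup>2 * \<beta>' k) / 2 + 4 * norm (W k) ^ 3 < - \<kappa>"
    using B by (rule order_tendstoD)
  have "norm w < 1 / 2" using w(2) \<kappa>1 by (simp add: \<tau>_def)
  with tendsto_norm[OF W] have evW: "\<forall>\<^sub>F k in sequentially. norm (W k) < 1 / 2"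
    by (rule order_tendstoD)
  have "(\<lambda>m::nat. exp (- \<kappa> * real m)) \<longlonglongrightarrow> 0" using \<kappa> by real_asymp
  then have "\<forall>\<^sub>F m in sequentially. exp (- \<kappa> * real m) < 1 / 4" by (rule order_tendstoD) simp
  from eventually_compose_filterlim[OF this m]
  have evE: "\<forall>\<^sub>F k in sequentially. exp (- \<kappa> * real (m k)) < 1 / 4" .
  have "\<forall>\<^sub>F k in sequentially. False"
    using evA evB evW evE eventually_compose_filterlim[OF laplace_lower_bound[OF \<kappa>] m]
  proof eventually_elim
    case (elim k)
    have decay: "norm (poly (pderiv (f k)) (of_real (a k) + of_real s * W k))
        \<le> exp (- \<kappa> * m k * s) * norm (poly (pderiv (f k)) (of_real (a k)))" if "s \<in> {0..1}" for s
      unfolding m_def using elim that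
      by (intro pderiv_decay_on_segment[OF f]) (auto simp: \<alpha>'_def \<beta>'_def)
    have z: "of_real (a k) + W k = 1 + w" by (simp add: W_def)
    have fk: "poly (f k) (of_real (a k)) = 0" "\<And>x. poly (f k) x = 0 \<Longrightarrow> x \<in> cball 0 1"
      using f[of k] by (auto simp: sendov_exception_def)
    define Q where "Q = norm (poly (pderiv (f k)) (of_real (a k)))"
    have Q: "Q > 0" using sendov_exception_pderiv[OF f] by (simp add: Q_def)
    have "Q \<le> 2 * m k * norm (poly (f k) (1 + w))"
      using elim(5)[rule_format, of "f k" "of_real (a k)" "W k"] decay fk elim(3) sendov_exception_pderiv(4)[OF f] degf
      by (auto simp: z Q_def)
    also have "\<dots> \<le> 4 * (degree (f k) / 2 * norm (poly (f k) (1 + w)))"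
      by (simp add: degf algebra_simps)
    also have "\<dots> \<le> 4 * norm ((1 + w) * poly (pderiv (f k)) (1 + w))"
      using norm_pderiv_ge_outside_disc[of "f k" "1 + w", OF fk(2)] w(1) by (intro mult_left_mono) auto
    also have "\<dots> \<le> 4 * (exp (- \<kappa> * m k) * Q)"
      using decay[of 1] w(1) by (simp add: norm_mult z Q_def)
    also have "\<dots> < 4 * (1 / 4 * Q)"
      using elim(4) Q by (intro mult_strict_left_mono mult_strict_right_mono) auto
    finally show False by simp
  qed
  then show False by simp
qed

lemma sum_mset_ln:
  assumes "\<forall>x. x \<in># A \<longrightarrow> g x > (0::real)"
  shows "(\<Sum>x\<in>#A. ln (g x)) = ln (\<Prod>x\<in>#A. g x)" and "(\<Prod>x\<in>#A. g x) > 0"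
proof -
  have "(\<Sum>x\<in>#A. ln (g x)) = ln (\<Prod>x\<in>#A. g x) \<and> (\<Prod>x\<in>#A. g x) > 0"
    using assms by (induction A) (auto simp: ln_mult)
  then show "(\<Sum>x\<in>#A. ln (g x)) = ln (\<Prod>x\<in>#A. g x)" and "(\<Prod>x\<in>#A. g x) > 0" by auto
qed

text \<open>Written with the roots, the hypothesis bounds the product of all \<open>|a - \<zeta>|\<close> by twice the product of
  all \<open>|\<lambda>|\<close>. So \<open>S + T \<le> ln 2\<close> for the nonnegative sums \<open>S\<close> of \<open>ln (1 / |\<lambda>|)\<close> and \<open>T\<close> of \<open>ln |a - \<zeta>|\<close>.\<close>

lemma root_means_log_le:
  assumes f: "sendov_exception f a"
    and le: "norm (poly (pderiv f) (of_real a)) \<le> 2 * degree (pderiv f) * norm (poly f 0)"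
  shows "poly f 0 \<noteq> 0"
    and "root_mean f (\<lambda>x. ln (1 / norm x)) \<le> 2 * ln 2 / degree f"
    and "root_mean (pderiv f) (\<lambda>x. ln (norm (x - of_real a))) \<le> 2 * ln 2 / degree f"
proof -
  note P = sendov_exception_pderiv[OF f]
  show f0: "poly f 0 \<noteq> 0" using le P(2) by auto
  define m where "m = degree (pderiv f)"
  have m: "degree f = Suc m" "m \<ge> 1" using P by (auto simp: m_def)
  define S where "S = (\<Sum>x\<in>#proots f. ln (1 / norm x))"
  define T where "T = (\<Sum>x\<in>#proots (pderiv f). ln (norm (x - of_real a)))"
  have nz: "norm x > 0" if "x \<in># proots f" for x using that f0 by (cases "f = 0") auto
  have far: "norm (x - of_real a) > 1" if "x \<in># proots (pderiv f)" for x
    using sendov_exception_roots(3)[OF f that] .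
  have S0: "0 \<le> S"
  proof -
    have "0 \<le> ln (1 / norm x)" if "x \<in># proots f" for x
      using sendov_exception_roots(1)[OF f that] nz[OF that] by (simp add: ln_div)
    from sum_mset_ge[OF this] show ?thesis by (simp add: S_def)
  qed
  have T0: "0 \<le> T"
  proof -
    have "0 \<le> ln (norm (x - of_real a))" if "x \<in># proots (pderiv f)" for x
      using far[OF that] by simp
    from sum_mset_ge[OF this] show ?thesis by (simp add: T_def)
  qed
  have "S = - (\<Sum>x\<in>#proots f. ln (norm x))"
  proof -
    have "(\<forall>x. x \<in># A \<longrightarrow> norm x > 0) \<Longrightarrow> (\<Sum>x\<in>#A. ln (1 / norm x)) = - (\<Sum>x\<in>#A. ln (norm x))" for A :: "complex multiset"
      by (induction A) (auto simp: ln_div)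
    then show ?thesis using nz by (auto simp: S_def)
  qed
  also have "(\<Sum>x\<in>#proots f. ln (norm x)) = ln (norm (poly f 0))"
  proof -
    have "norm (poly f 0) = (\<Prod>x\<in>#proots f. norm x)"
      using f by (simp add: poly_eq_prod_proots[of f] sendov_exception_def norm_mult norm_prod_mset)
    then show ?thesis using sum_mset_ln(1)[of "proots f" norm] nz by simp
  qed
  finally have S: "S = - ln (norm (poly f 0))" .
  define R where "R = (\<Prod>x\<in>#proots (pderiv f). norm (x - of_real a))"
  have T: "T = ln R" "R > 0"
    unfolding T_def R_def by (rule sum_mset_ln; use far in force)+
  have "norm (poly (pderiv f) (of_real a)) = Suc m * R"
  proof -
    have "lead_coeff (pderiv f) = of_nat (Suc m)"
      using f m by (simp add: m_def[symmetric] coeff_pderiv sendov_exception_def)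
    then show ?thesis
      by (simp add: poly_eq_prod_proots[of "pderiv f"] norm_mult norm_prod_mset R_def norm_minus_commute
         del: of_nat_Suc)
  qed
  with le have "Suc m * R \<le> 2 * m * norm (poly f 0)" by (simp add: m_def)
  also have "\<dots> \<le> Suc m * (2 * norm (poly f 0))" by (simp add: algebra_simps)
  finally have "R \<le> 2 * norm (poly f 0)" by (simp del: of_nat_Suc)
  then have "ln R \<le> ln (2 * norm (poly f 0))" using T f0 by simp
  then have TS: "T + S \<le> ln 2" using f0 by (simp add: T S ln_mult)
  show "root_mean f (\<lambda>x. ln (1 / norm x)) \<le> 2 * ln 2 / degree f"
    unfolding root_mean_def size_proots_complex S_def[symmetric]
  proof -
    have "0 < ln (2::real)" by simp
    with TS T0 have "S \<le> 2 * ln 2" by linarith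
    then show "S /\<^sub>R degree f \<le> 2 * ln 2 / degree f"
      by (simp add: inverse_eq_divide divide_right_mono)
  qed
  have "T * Suc m \<le> ln 2 * (2 * m)"
    using TS S0 T0 m by (intro mult_mono) auto
  then show "root_mean (pderiv f) (\<lambda>x. ln (norm (x - of_real a))) \<le> 2 * ln 2 / degree f"
    unfolding root_mean_def size_proots_complex T_def[symmetric]
    using m by (simp add: m_def[symmetric] field_simps)
qed

text \<open>Laplace's method on the segment from \<open>a\<close> to \<open>0\<close>. At \<open>a - t\<close> the mean of \<open>log |1 - t v|\<close> is at
  most \<open>- t Re (E v) + t\<^sup>2 / 2\<close>, which for \<open>t \<le> 1\<close> is negative once \<open>Re (E v) > 1/2\<close>.\<close>

lemma eventually_pderiv_le_value_at_0:
  fixes f :: "nat \<Rightarrow> complex poly" and a :: "nat \<Rightarrow> real"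
  assumes f: "\<And>k. sendov_exception (f k) (a k)"
    and deg: "filterlim (\<lambda>k. degree (f k)) at_top sequentially" and a: "a \<longlonglongrightarrow> 1"
    and \<alpha>: "(\<lambda>k. root_mean (pderiv (f k)) (\<lambda>x. 1 / (of_real (a k) - x))) \<longlonglongrightarrow> 1"
  shows "\<forall>\<^sub>F k in sequentially. norm (poly (pderiv (f k)) (of_real (a k)))
      \<le> 2 * degree (pderiv (f k)) * norm (poly (f k) 0)"
proof -
  define m where "m = (\<lambda>k. degree (pderiv (f k)))"
  have degf: "degree (f k) = Suc (m k)" for k using sendov_exception_pderiv[OF f] by (simp add: m_def)
  have m: "filterlim m at_top sequentially"
    using deg unfolding degf by (rule filterlim_at_top_of_Suc)
  have eighth: "0 < (1 / 8 :: real)" by simp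
  have "\<forall>\<^sub>F k in sequentially. 3 / 4 < Re (root_mean (pderiv (f k)) (\<lambda>x. 1 / (of_real (a k) - x)))"
    using tendsto_Re[OF \<alpha>] by (rule order_tendstoD) simp
  moreover have "\<forall>\<^sub>F k in sequentially. 1 / 2 < a k"
    using a by (rule order_tendstoD) simp
  moreover note eventually_compose_filterlim[OF laplace_lower_bound[OF eighth] m]
  ultimately show ?thesis
  proof eventually_elim
    case (elim k)
    define p where "p = pderiv (f k)"
    define v where "v = (\<lambda>x. 1 / (complex_of_real (a k) - x))"
    note P = sendov_exception_pderiv[OF f[of k], folded p_def]
    have ak: "0 \<le> a k" "a k \<le> 1" "poly (f k) (of_real (a k)) = 0" using f[of k] by (auto simp: sendov_exception_def)
    have "norm (poly p (of_real (a k) + of_real s * (- of_real (a k)))) \<le> exp (- (1/8) * m k * s) * norm (poly p (of_real (a k)))"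
      if s: "s \<in> {0..1}" for s
    proof -
      define t where "t = s * a k"
      have t: "0 \<le> t" "t \<le> 1" "t \<le> s" using s ak by (auto simp: t_def mult_le_one mult_left_le)
      define h where "h = (\<lambda>x. - t * Re (v x) + t\<^sup>2 / 2)"
      have "norm (poly p (of_real (a k) + - of_real t)) \<le> exp (degree p * root_mean p h) * norm (poly p (of_real (a k)))"
      proof (rule norm_poly_le_exp[OF P(2)])
        fix x assume x: "x \<in># proots p"
        define u where "u = - of_real t * v x"
        have "norm (v x) \<le> 1" using norm_inverse_critical_le[OF f, of x k] x by (simp only: v_def p_def)
        moreover have "norm u = t * norm (v x)" using t by (simp add: u_def norm_mult)
        ultimately have "norm u \<le> t" using t by (simp add: mult_left_le)
        then have "(norm u)\<^sup>2 \<le> t\<^sup>2" by (intro power_mono) auto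
        then have "Re u + (norm u)\<^sup>2 / 2 \<le> h x" by (simp add: u_def h_def)
        then have "exp (Re u + (norm u)\<^sup>2 / 2) \<le> exp (h x)" by simp
        moreover have "norm (1 + u) \<le> exp (Re u + (norm u)\<^sup>2 / 2)" by (rule norm_one_plus_le_exp)
        ultimately have "norm (1 + u) \<le> exp (h x)" by (rule order_trans[rotated])
        then show "norm (1 + - of_real t / (of_real (a k) - x)) \<le> exp (h x)"
          by (simp add: u_def v_def)
      qed
      also have "root_mean p h = - t * Re (root_mean p v) + t\<^sup>2 / 2"
        unfolding h_def root_mean_add root_mean_cmult root_mean_const[OF P(1)] by (simp only: Re_root_mean)
      also have "exp (degree p * (- t * Re (root_mean p v) + t\<^sup>2 / 2)) \<le> exp (- (1/8) * m k * s)"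
      proof -
        have "t * (3 / 4) \<le> t * Re (root_mean p v)" using elim(1) t by (intro mult_left_mono) (auto simp: p_def v_def)
        moreover have "t\<^sup>2 \<le> t" using t by (simp add: power2_eq_square mult_left_le)
        moreover have "s * (1 / 2) \<le> t" unfolding t_def using s elim(2) by (intro mult_left_mono) auto
        ultimately have "- t * Re (root_mean p v) + t\<^sup>2 / 2 \<le> - (1 / 8) * s" by simp
        then have "m k * (- t * Re (root_mean p v) + t\<^sup>2 / 2) \<le> m k * (- (1 / 8) * s)"
          by (intro mult_left_mono) auto
        then show ?thesis by (simp add: p_def m_def mult_ac)
      qed
      finally show ?thesis by (simp add: t_def mult_right_mono)
    qed
    then have "norm (poly p (of_real (a k))) \<le> 2 * m k * norm (poly (f k) (of_real (a k) + - of_real (a k)))"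
      using elim(3)[rule_format, of "f k" "of_real (a k)" "- of_real (a k)"] ak P degf[of k]
      by (auto simp: p_def)
    then show ?case by (simp add: p_def m_def)
  qed
qed

section \<open>Averages and limit laws\<close>

text \<open>Markov's inequality.\<close>

lemma convergence_prob_from_mean:
  assumes M: "\<And>k. prob_space (M k)" and X: "\<And>k. uniform_random_zero (M k) (X k) (p k)"
    and \<psi>: "continuous_on UNIV (\<psi> :: complex \<Rightarrow> real)" "\<And>z. 0 \<le> \<psi> z"
    and lim: "(\<lambda>k. root_mean (p k) \<psi>) \<longlonglongrightarrow> 0" and \<epsilon>: "0 < \<epsilon>"
  shows "(\<lambda>k. measure (M k) {\<omega> \<in> space (M k). \<psi> (X k \<omega>) \<le> \<epsilon>}) \<longlonglongrightarrow> 1"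
proof (rule tendsto_sandwich[OF _ _ _ tendsto_const])
  show "\<forall>\<^sub>F k in sequentially. 1 - root_mean (p k) \<psi> / \<epsilon> \<le> measure (M k) {\<omega> \<in> space (M k). \<psi> (X k \<omega>) \<le> \<epsilon>}"
  proof (intro always_eventually allI)
    fix k
    interpret prob_space "M k" by (rule M)
    have [measurable]: "X k \<in> borel_measurable (M k)" using X[of k] by (simp add: uniform_random_zero_def)
    have [measurable]: "\<psi> \<in> borel_measurable borel" by (rule borel_measurable_continuous_onI[OF \<psi>(1)])
    note * = integral_uniform_random_zero[OF M X, of k \<psi>]
    have "measure (M k) {\<omega> \<in> space (M k). \<epsilon> \<le> \<psi> (X k \<omega>)} \<le> (\<integral>\<omega>. \<psi> (X k \<omega>) \<partial>M k) / \<epsilon>"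
      by (rule integral_Markov_inequality_measure[where A="space (M k)"]) (use * \<psi> \<epsilon> in \<open>auto simp: has_bochner_integral_iff\<close>)
    also have "\<dots> = root_mean (p k) \<psi> / \<epsilon>" using * by (simp add: has_bochner_integral_iff)
    finally have 1: "measure (M k) {\<omega> \<in> space (M k). \<epsilon> \<le> \<psi> (X k \<omega>)} \<le> root_mean (p k) \<psi> / \<epsilon>" .
    have "measure (M k) {\<omega> \<in> space (M k). \<not> \<psi> (X k \<omega>) \<le> \<epsilon>} \<le> measure (M k) {\<omega> \<in> space (M k). \<epsilon> \<le> \<psi> (X k \<omega>)}"
      by (intro finite_measure_mono) auto
    moreover have "measure (M k) {\<omega> \<in> space (M k). \<not> \<psi> (X k \<omega>) \<le> \<epsilon>} = 1 - measure (M k) {\<omega> \<in> space (M k). \<psi> (X k \<omega>) \<le> \<epsilon>}"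
      by (rule prob_neg) measurable
    ultimately show "1 - root_mean (p k) \<psi> / \<epsilon> \<le> measure (M k) {\<omega> \<in> space (M k). \<psi> (X k \<omega>) \<le> \<epsilon>}"
      using 1 by linarith
  qed
  have "(\<lambda>k. 1 - root_mean (p k) \<psi> / \<epsilon>) \<longlonglongrightarrow> 1 - 0 / \<epsilon>"
    by (intro tendsto_intros lim) (use \<epsilon> in auto)
  then show "(\<lambda>k. 1 - root_mean (p k) \<psi> / \<epsilon>) \<longlonglongrightarrow> 1" by simp
qed (use M in \<open>auto intro!: always_eventually prob_space.prob_le_1\<close>)

lemma integrable_continuous_disc_rv:
  fixes \<phi> :: "complex \<Rightarrow> 'c::{banach,second_countable_topology}"
  assumes "prob_space P" "Y \<in> borel_measurable P" "\<And>\<omega>. \<omega> \<in> space P \<Longrightarrow> Y \<omega> \<in> cball 0 1"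
    and "continuous_on UNIV \<phi>"
  shows "integrable P (\<lambda>\<omega>. \<phi> (Y \<omega>))"
proof -
  interpret prob_space P by fact
  have "compact (\<phi> ` cball 0 1)"
    by (intro compact_continuous_image continuous_on_subset[OF assms(4)]) auto
  then obtain B where "\<And>z. z \<in> cball 0 1 \<Longrightarrow> norm (\<phi> z) \<le> B"
    by (metis bounded_iff compact_imp_bounded imageI)
  then show ?thesis
    using assms(3) measurable_compose[OF assms(2) borel_measurable_continuous_onI[OF assms(4)]]
    by (intro integrable_const_bound[where B=B]) auto
qed

text \<open>Since all values lie in the closed disc, \<open>\<phi>\<close> may be composed with the radial retraction onto the
  disc, which makes it bounded.\<close>

lemma root_mean_tendsto_integral:
  fixes \<phi> :: "complex \<Rightarrow> complex"
  assumes M: "\<And>k. prob_space (M k)" and X: "\<And>k. uniform_random_zero (M k) (X k) (p k)"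
    and roots: "\<And>k x. x \<in># proots (p k) \<Longrightarrow> norm x \<le> 1"
    and Y: "\<And>\<omega>. \<omega> \<in> space P \<Longrightarrow> Y \<omega> \<in> cball 0 1"
    and lim: "converges_in_distribution M X P Y"
    and \<phi>: "continuous_on UNIV \<phi>"
  shows "(\<lambda>k. root_mean (p k) \<phi>) \<longlonglongrightarrow> (\<integral>\<omega>. \<phi> (Y \<omega>) \<partial>P)"
proof -
  define \<pi> where "\<pi> = (\<lambda>z::complex. z / of_real (max 1 (norm z)))"
  define \<psi> where "\<psi> = (\<lambda>z. \<phi> (\<pi> z))"
  have \<pi>_id: "\<pi> z = z" if "norm z \<le> 1" for z using that by (simp add: \<pi>_def max_def)
  have \<pi>_disc: "\<pi> z \<in> cball 0 1" for z
    by (auto simp: \<pi>_def norm_divide divide_le_eq_1 max_def)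
  have "max 1 (norm z) \<noteq> 0" for z :: complex by (auto simp: max_def)
  then have \<pi>: "continuous_on UNIV \<pi>"
    unfolding \<pi>_def by (intro continuous_intros) auto
  have c: "continuous_on UNIV \<psi>" unfolding \<psi>_def
    by (rule continuous_on_compose2[OF \<phi> \<pi>]) auto
  have "bounded (\<phi> ` cball 0 1)"
    by (intro compact_imp_bounded compact_continuous_image continuous_on_subset[OF \<phi>]) auto
  then have b: "bounded (range \<psi>)"
    by (rule bounded_subset) (use \<pi>_disc in \<open>auto simp: \<psi>_def\<close>)
  have "(\<lambda>k. \<integral>\<omega>. \<psi> (X k \<omega>) \<partial>M k) \<longlonglongrightarrow> (\<integral>\<omega>. \<psi> (Y \<omega>) \<partial>P)"
    using lim c b by (simp add: converges_in_distribution_def)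
  also have "(\<lambda>k. \<integral>\<omega>. \<psi> (X k \<omega>) \<partial>M k) = (\<lambda>k. root_mean (p k) \<phi>)"
  proof
    fix k
    have "(\<integral>\<omega>. \<psi> (X k \<omega>) \<partial>M k) = root_mean (p k) \<psi>"
      using integral_uniform_random_zero[OF M X, of k \<psi>] by (rule has_bochner_integral_integral_eq)
    also have "\<dots> = root_mean (p k) \<phi>"
      using roots by (intro root_mean_cong) (simp add: \<psi>_def \<pi>_id)
    finally show "(\<integral>\<omega>. \<psi> (X k \<omega>) \<partial>M k) = root_mean (p k) \<phi>" .
  qed
  also have "(\<integral>\<omega>. \<psi> (Y \<omega>) \<partial>P) = (\<integral>\<omega>. \<phi> (Y \<omega>) \<partial>P)"
    using Y by (intro Bochner_Integration.integral_cong) (auto simp: \<psi>_def \<pi>_id)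
  finally show ?thesis .
qed

lemma root_mean_tendsto_integral_real:
  fixes \<phi> :: "complex \<Rightarrow> real"
  assumes "\<And>k. prob_space (M k)" "\<And>k. uniform_random_zero (M k) (X k) (p k)"
    and "\<And>k x. x \<in># proots (p k) \<Longrightarrow> norm x \<le> 1"
    and "\<And>\<omega>. \<omega> \<in> space P \<Longrightarrow> Y \<omega> \<in> cball 0 1"
    and "converges_in_distribution M X P Y"
    and \<phi>: "continuous_on UNIV \<phi>"
  shows "(\<lambda>k. root_mean (p k) \<phi>) \<longlonglongrightarrow> (\<integral>\<omega>. \<phi> (Y \<omega>) \<partial>P)"
proof -
  have "(\<lambda>k. root_mean (p k) (\<lambda>x. complex_of_real (\<phi> x))) \<longlonglongrightarrow> (\<integral>\<omega>. complex_of_real (\<phi> (Y \<omega>)) \<partial>P)"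
    by (rule root_mean_tendsto_integral[OF assms(1-5)]) (auto intro!: continuous_intros \<phi>)
  from tendsto_Re[OF this] show ?thesis by (simp add: Re_root_mean)
qed

lemma limit_AE_zero:
  fixes \<psi> :: "complex \<Rightarrow> real"
  assumes "\<And>k. prob_space (M k)" "\<And>k. uniform_random_zero (M k) (X k) (p k)"
    and "\<And>k x. x \<in># proots (p k) \<Longrightarrow> norm x \<le> 1"
    and Y: "\<And>\<omega>. \<omega> \<in> space P \<Longrightarrow> Y \<omega> \<in> cball 0 1"
    and "converges_in_distribution M X P Y"
    and P: "prob_space P" and Ym: "Y \<in> borel_measurable P"
    and \<psi>: "continuous_on UNIV \<psi>" "\<And>z. 0 \<le> \<psi> z"
    and lim: "(\<lambda>k. root_mean (p k) \<psi>) \<longlonglongrightarrow> 0"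
  shows "AE \<omega> in P. \<psi> (Y \<omega>) = 0"
proof -
  have "(\<integral>\<omega>. \<psi> (Y \<omega>) \<partial>P) = 0"
    by (rule LIMSEQ_unique[OF root_mean_tendsto_integral_real[OF assms(1-5) \<psi>(1)] lim])
  moreover have "integrable P (\<lambda>\<omega>. \<psi> (Y \<omega>))"
    by (rule integrable_continuous_disc_rv[OF P Ym Y \<psi>(1)])
  ultimately show ?thesis
    using \<psi>(2) by (subst (asm) integral_nonneg_eq_0_iff_AE) auto
qed

lemma root_mean_squeeze_0:
  fixes \<psi> :: "nat \<Rightarrow> complex \<Rightarrow> real"
  assumes "\<And>k x. x \<in># proots (p k) \<Longrightarrow> 0 \<le> \<psi> k x" "\<And>k x. x \<in># proots (p k) \<Longrightarrow> \<psi> k x \<le> b k"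
    and "b \<longlonglongrightarrow> 0" "\<And>k. degree (p k) \<noteq> 0"
  shows "(\<lambda>k. root_mean (p k) (\<psi> k)) \<longlonglongrightarrow> 0"
proof (rule tendsto_sandwich[OF _ _ tendsto_const assms(3)])
  show "\<forall>\<^sub>F k in sequentially. 0 \<le> root_mean (p k) (\<psi> k)"
    using root_mean_mono[of "p _" "\<lambda>_. 0" "\<psi> _"] assms by (intro always_eventually allI) simp
  show "\<forall>\<^sub>F k in sequentially. root_mean (p k) (\<psi> k) \<le> b k"
    using root_mean_mono[of "p _" "\<psi> _" "\<lambda>_. b _"] assms by (intro always_eventually allI) simp
qed

lemma moment_uniform_unit_circle: "(\<integral>z. z ^ Suc k \<partial>uniform_unit_circle) = 0"
proof -
  define I where "I = {0..2 * pi}"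
  have eI: "emeasure lborel I \<noteq> 0" "emeasure lborel I \<noteq> \<infinity>" by (auto simp: I_def)
  define c where "c = \<i> * of_nat (Suc k)"
  have c0: "c \<noteq> 0" by (auto simp: c_def simp del: of_nat_Suc)
  have "((\<lambda>\<theta>. exp (c * of_real \<theta>)) has_integral (exp (c * of_real (2 * pi)) / c - exp (c * of_real 0) / c)) I"
    unfolding I_def
  proof (rule fundamental_theorem_of_calculus)
    show "((\<lambda>\<theta>. exp (c * of_real \<theta>) / c) has_vector_derivative exp (c * of_real \<theta>)) (at \<theta> within {0..2 * pi})" for \<theta>
      using c0 by (auto intro!: derivative_eq_intros has_vector_derivative_real_field simp: field_simps)
  qed simp
  moreover have "exp (c * of_real (2 * pi)) = 1"
    unfolding exp_eq_1 by (auto simp: c_def intro!: exI[of _ "int (Suc k)"])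
  ultimately have hi: "((\<lambda>\<theta>. exp (c * of_real \<theta>)) has_integral 0) I" by simp
  have abs: "set_integrable lborel I (\<lambda>\<theta>. exp (c * of_real \<theta>))"
    unfolding I_def by (intro borel_integrable_atLeastAtMost' continuous_intros)
  have z: "(LINT \<theta>:I|lborel. exp (c * of_real \<theta>)) = 0"
    using set_borel_integral_eq_integral(2)[OF abs] hi by (simp add: integral_unique)
  have "(\<integral>z. z ^ Suc k \<partial>uniform_unit_circle) = (\<integral>\<theta>. exp (\<i> * of_real \<theta>) ^ Suc k \<partial>uniform_measure lborel I)"
    unfolding uniform_unit_circle_def I_def by (subst integral_distr) (auto simp del: power_Suc)
  also have "\<dots> = (\<integral>\<theta>. exp (c * of_real \<theta>) \<partial>uniform_measure lborel I)"
    by (simp add: c_def exp_of_nat_mult[symmetric] mult_ac del: power_Suc of_nat_Suc)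
  also have "\<dots> = (\<integral>\<theta>. exp (c * of_real \<theta>) \<partial>density lborel (\<lambda>x. ennreal (indicator I x / measure lborel I)))"
    unfolding uniform_measure_def using eI by (intro arg_cong2[where f=lebesgue_integral] arg_cong2[where f=density] refl ext)
      (auto simp: emeasure_eq_ennreal_measure indicator_def I_def divide_ennreal[symmetric])
  also have "\<dots> = (\<integral>\<theta>. (indicator I \<theta> / measure lborel I) *\<^sub>R exp (c * of_real \<theta>) \<partial>lborel)"
    by (rule integral_density) (auto simp: I_def)
  also have "\<dots> = (\<integral>\<theta>. (1 / measure lborel I) *\<^sub>R (indicator I \<theta> *\<^sub>R exp (c * of_real \<theta>)) \<partial>lborel)"
    by (simp add: mult.commute)
  also have "\<dots> = (1 / measure lborel I) *\<^sub>R (LINT \<theta>:I|lborel. exp (c * of_real \<theta>))"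
    unfolding set_lebesgue_integral_def by (rule integral_scaleR_right)
  also have "\<dots> = 0" by (simp only: z scaleR_zero_right)
  finally show ?thesis .
qed

lemma prob_space_uniform_unit_circle: "prob_space uniform_unit_circle"
  unfolding uniform_unit_circle_def
  by (intro prob_space.prob_space_distr prob_space_uniform_measure) auto

lemma AE_uniform_unit_circle: "AE z in uniform_unit_circle. norm z = 1"
  unfolding uniform_unit_circle_def by (subst AE_distr_iff) auto

section \<open>The two limiting cases\<close>

text \<open>The function \<open>1 / (1 - z)\<close>, made continuous and bounded by a modification within distance \<open>1/2\<close>
  of its pole.\<close>

lemma continuous_on_inverse_one_minus_cutoff:
  "continuous_on UNIV (\<lambda>z::complex. cnj (1 - z) / of_real ((max (norm (1 - z)) (1 / 2))\<^sup>2))"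
proof -
  have "max (norm (1 - z)) (1 / 2) \<noteq> 0" for z :: complex by (auto simp: max_def)
  then show ?thesis by (intro continuous_intros) auto
qed

text \<open>The data of the theorem reindexed by the position in the sequence.\<close>

locale sendov_sequence =
  fixes f :: "nat \<Rightarrow> complex poly" and a :: "nat \<Rightarrow> real" and a_inf :: real
    and M :: "nat \<Rightarrow> 'a measure" and lam zeta :: "nat \<Rightarrow> 'a \<Rightarrow> complex"
    and P :: "'b measure" and lam_inf zeta_inf :: "'b \<Rightarrow> complex"
  assumes f: "\<And>k. sendov_exception (f k) (a k)"
    and deg: "filterlim (\<lambda>k. degree (f k)) at_top sequentially"
    and a_lim: "a \<longlonglongrightarrow> a_inf"
    and M: "\<And>k. prob_space (M k)"
    and lam: "\<And>k. uniform_random_zero (M k) (lam k) (f k)"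
    and zeta: "\<And>k. uniform_random_zero (M k) (zeta k) (pderiv (f k))"
    and P: "prob_space P"
    and lam_inf_rv: "lam_inf \<in> borel_measurable P"
    and zeta_inf_rv: "zeta_inf \<in> borel_measurable P"
    and lam_inf_range: "\<And>\<omega>. \<omega> \<in> space P \<Longrightarrow> lam_inf \<omega> \<in> cball 0 1"
    and zeta_inf_range: "\<And>\<omega>. \<omega> \<in> space P \<Longrightarrow> zeta_inf \<omega> \<in> cball 0 1"
    and lam_lim: "converges_in_distribution M lam P lam_inf"
    and zeta_lim: "converges_in_distribution M zeta P zeta_inf"
begin

lemmas lam_roots = sendov_exception_roots(1)[OF f]
  and zeta_roots = sendov_exception_roots(2)[OF f]
  and zeta_far = sendov_exception_roots(3)[OF f]

lemma degrees: "degree (f k) \<noteq> 0" "degree (pderiv (f k)) \<noteq> 0"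
  using f[of k] by (auto simp: sendov_exception_def degree_pderiv)

lemma a_bounds: "0 \<le> a k" "a k \<le> 1"
  using f[of k] by (auto simp: sendov_exception_def)

lemma lam_mean_lim:
  fixes \<phi> :: "complex \<Rightarrow> complex"
  assumes "continuous_on UNIV \<phi>"
  shows "(\<lambda>k. root_mean (f k) \<phi>) \<longlonglongrightarrow> (\<integral>\<omega>. \<phi> (lam_inf \<omega>) \<partial>P)"
  by (rule root_mean_tendsto_integral[OF M lam _ _ lam_lim assms]) (use lam_roots lam_inf_range in auto)

lemma zeta_mean_lim:
  fixes \<phi> :: "complex \<Rightarrow> complex"
  assumes "continuous_on UNIV \<phi>"
  shows "(\<lambda>k. root_mean (pderiv (f k)) \<phi>) \<longlonglongrightarrow> (\<integral>\<omega>. \<phi> (zeta_inf \<omega>) \<partial>P)"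
  by (rule root_mean_tendsto_integral[OF M zeta _ _ zeta_lim assms]) (use zeta_roots zeta_inf_range in auto)

lemma lam_AE_zero:
  fixes \<psi> :: "complex \<Rightarrow> real"
  assumes "continuous_on UNIV \<psi>" "\<And>z. 0 \<le> \<psi> z" "(\<lambda>k. root_mean (f k) \<psi>) \<longlonglongrightarrow> 0"
  shows "AE \<omega> in P. \<psi> (lam_inf \<omega>) = 0"
  by (rule limit_AE_zero[OF M lam _ _ lam_lim P lam_inf_rv assms]) (use lam_roots lam_inf_range in auto)

lemma zeta_AE_zero:
  fixes \<psi> :: "complex \<Rightarrow> real"
  assumes "continuous_on UNIV \<psi>" "\<And>z. 0 \<le> \<psi> z" "(\<lambda>k. root_mean (pderiv (f k)) \<psi>) \<longlonglongrightarrow> 0"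
  shows "AE \<omega> in P. \<psi> (zeta_inf \<omega>) = 0"
  by (rule limit_AE_zero[OF M zeta _ _ zeta_lim P zeta_inf_rv assms]) (use zeta_roots zeta_inf_range in auto)

lemma moments_eq: "(\<integral>\<omega>. lam_inf \<omega> ^ j \<partial>P) = (\<integral>\<omega>. zeta_inf \<omega> ^ j \<partial>P)"
proof -
  have "(\<lambda>k. root_mean (f k) (\<lambda>x. x ^ j) - root_mean (pderiv (f k)) (\<lambda>x. x ^ j))
      \<longlonglongrightarrow> (\<integral>\<omega>. lam_inf \<omega> ^ j \<partial>P) - (\<integral>\<omega>. zeta_inf \<omega> ^ j \<partial>P)"
    by (intro tendsto_diff lam_mean_lim zeta_mean_lim continuous_intros)
  moreover have "(\<lambda>k. root_mean (f k) (\<lambda>x. x ^ j) - root_mean (pderiv (f k)) (\<lambda>x. x ^ j)) \<longlonglongrightarrow> 0"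
  proof (rule Lim_null_comparison)
    show "\<forall>\<^sub>F k in sequentially. norm (root_mean (f k) (\<lambda>x. x ^ j) - root_mean (pderiv (f k)) (\<lambda>x. x ^ j))
        \<le> 9 * real j / sqrt (degree (f k))"
      by (intro always_eventually allI root_mean_power_diff_le[OF f])
    have "(\<lambda>n. 9 * real j / sqrt (real n)) \<longlonglongrightarrow> 0" by real_asymp
    from filterlim_compose[OF this deg] show "(\<lambda>k. 9 * real j / sqrt (degree (f k))) \<longlonglongrightarrow> 0" .
  qed
  ultimately show ?thesis using LIMSEQ_unique by fastforce
qed

text \<open>Limits on the circle are identified through the moments of \<open>zeta_inf\<close>, which agree with those of
  \<open>lam_inf\<close>.\<close>

lemma distr_eqI_circle:
  assumes "AE \<omega> in P. norm (lam_inf \<omega>) = 1" "prob_space Q" "sets Q = sets borel" "AE z in Q. norm z = 1"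
    and "\<And>j. (\<integral>\<omega>. zeta_inf \<omega> ^ Suc j \<partial>P) = (\<integral>z. z ^ Suc j \<partial>Q)"
  shows "distr P borel lam_inf = Q"
proof (rule unit_circle_law_eqI)
  interpret prob_space P by (rule P)
  have [measurable]: "lam_inf \<in> borel_measurable P" by (rule lam_inf_rv)
  show "prob_space (distr P borel lam_inf)" by (rule prob_space_distr) measurable
  show "AE z in distr P borel lam_inf. norm z = 1"
    using assms(1) by (subst AE_distr_iff) auto
  show "(\<integral>z. z ^ Suc j \<partial>distr P borel lam_inf) = (\<integral>z. z ^ Suc j \<partial>Q)" for j
    using moments_eq[of "Suc j"] assms(5)[of j] by (subst integral_distr) auto
qed (use assms in auto)

lemma minus_one_left_semicircle: "-1 \<in> left_semicircle"
  by (simp add: left_semicircle_eq)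

lemma left_semicircle_AE: "AE \<omega> in P. infdist (Y \<omega>) left_semicircle = 0 \<Longrightarrow> AE \<omega> in P. Y \<omega> \<in> left_semicircle"
  using minus_one_left_semicircle
  by (subst in_closed_iff_infdist_zero[OF closed_left_semicircle]) auto

lemma infdist_left_semicircle_le: "norm x \<le> 1 \<Longrightarrow> infdist x left_semicircle \<le> 2"
  using infdist_le[OF minus_one_left_semicircle, of x] norm_triangle_ineq[of x 1]
  by (simp add: dist_norm)

text \<open>The distance to the semicircle is at most \<open>\<epsilon>/2\<close> off a compact set to which the quantitative bound
  applies, and at most \<open>2\<close> everywhere.\<close>

lemma lam_infdist_mean:
  assumes "a_inf = 0"
  shows "(\<lambda>k. root_mean (f k) (\<lambda>x. infdist x left_semicircle)) \<longlonglongrightarrow> 0"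
proof (rule tendstoI)
  fix e :: real assume e: "e > 0"
  define K where "K = {z \<in> cball 0 1. e / 2 \<le> infdist z left_semicircle}"
  have "K = cball 0 1 \<inter> (\<lambda>z. infdist z left_semicircle) -` {e / 2..}" by (auto simp: K_def)
  also have "compact \<dots>"
    by (intro compact_Int_closed compact_cball closed_vimage continuous_on_infdist continuous_on_id closed_atLeast)
  finally have "compact K" .
  moreover have "K \<subseteq> cball 0 1 - left_semicircle" using e by (auto simp: K_def)
  ultimately obtain A where A: "0 \<le> A"
    "\<And>f a. sendov_exception f a \<Longrightarrow> root_mean f (indicator K) \<le> A * (a + 1 / sqrt (degree f))"
    using root_mean_indicator_compact_le by blast
  have "(\<lambda>n. 1 / sqrt (real n)) \<longlonglongrightarrow> 0" by real_asymp
  from filterlim_compose[OF this deg] have "(\<lambda>k. 1 / sqrt (degree (f k))) \<longlonglongrightarrow> 0" .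
  then have "(\<lambda>k. 2 * (A * (a k + 1 / sqrt (degree (f k))))) \<longlonglongrightarrow> 2 * (A * (0 + 0))"
    using a_lim assms by (intro tendsto_intros) auto
  then have "\<forall>\<^sub>F k in sequentially. 2 * (A * (a k + 1 / sqrt (degree (f k)))) < e / 2"
    by (rule order_tendstoD) (use e in auto)
  then show "\<forall>\<^sub>F k in sequentially. dist (root_mean (f k) (\<lambda>x. infdist x left_semicircle)) 0 < e"
  proof eventually_elim
    case (elim k)
    have "root_mean (f k) (\<lambda>x. infdist x left_semicircle) \<le> root_mean (f k) (\<lambda>x. e / 2 + 2 * indicator K x)"
    proof (rule root_mean_mono)
      fix x assume "x \<in># proots (f k)"
      then have "norm x \<le> 1" by (rule lam_roots)
      then show "infdist x left_semicircle \<le> e / 2 + 2 * indicator K x"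
        using infdist_left_semicircle_le[of x] e by (auto simp: K_def indicator_def)
    qed
    also have "\<dots> = e / 2 + 2 * root_mean (f k) (indicator K)"
      by (simp add: root_mean_add root_mean_cmult degrees)
    also have "\<dots> < e" using A(2)[OF f, of k] elim by simp
    finally show ?case
      using root_mean_mono[of "f k" "\<lambda>_. 0" "\<lambda>x. infdist x left_semicircle"]
      by (simp add: infdist_nonneg degrees)
  qed
qed

text \<open>The mean distances of \<open>\<lambda>\<close> and \<open>\<zeta>\<close> to the semicircle tend to \<open>0\<close>, so both limits lie on it; there the
  moments, which agree, determine the laws.\<close>

lemma a_near_zero:
  assumes "a_inf = 0"
  shows "AE \<omega> in P. lam_inf \<omega> \<in> left_semicircle" "AE \<omega> in P. zeta_inf \<omega> \<in> left_semicircle"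
    "distr P borel lam_inf = distr P borel zeta_inf"
    "converges_in_probability M (\<lambda>k \<omega>. infdist (lam k \<omega>) left_semicircle) 0"
proof -
  have c: "continuous_on UNIV (\<lambda>x. infdist x left_semicircle)" by (intro continuous_intros)
  show 1: "AE \<omega> in P. lam_inf \<omega> \<in> left_semicircle"
    by (rule left_semicircle_AE, rule lam_AE_zero[OF c]) (auto simp: infdist_nonneg lam_infdist_mean[OF assms])
  have "(\<lambda>k. root_mean (pderiv (f k)) (\<lambda>x. infdist x left_semicircle)) \<longlonglongrightarrow> 0"
  proof (rule root_mean_squeeze_0)
    show "infdist x left_semicircle \<le> 2 * a k" if x: "x \<in># proots (pderiv (f k))" for x k
    proof -
      obtain w where "w \<in> left_semicircle" "norm (x - w) \<le> 2 * a k"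
        using lune_near_left_semicircle[OF a_bounds zeta_roots[OF x] zeta_far[OF x]] .
      then show ?thesis using infdist_le[of w left_semicircle x] by (simp add: dist_norm)
    qed
    have "(\<lambda>k. 2 * a k) \<longlonglongrightarrow> 2 * 0" using a_lim assms by (intro tendsto_intros) auto
    then show "(\<lambda>k. 2 * a k) \<longlonglongrightarrow> 0" by simp
  qed (auto simp: infdist_nonneg degrees)
  then show 2: "AE \<omega> in P. zeta_inf \<omega> \<in> left_semicircle"
    by (intro left_semicircle_AE zeta_AE_zero[OF c]) (auto simp: infdist_nonneg)
  interpret P: prob_space P by (rule P)
  have [measurable]: "zeta_inf \<in> borel_measurable P" by (rule zeta_inf_rv)
  show "distr P borel lam_inf = distr P borel zeta_inf"
  proof (rule distr_eqI_circle)
    show "AE \<omega> in P. norm (lam_inf \<omega>) = 1" using 1 by (auto simp: left_semicircle_eq)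
    show "prob_space (distr P borel zeta_inf)" by (rule P.prob_space_distr) measurable
    show "AE z in distr P borel zeta_inf. norm z = 1"
      using 2 by (subst AE_distr_iff) (auto simp: left_semicircle_eq)
    show "(\<integral>\<omega>. zeta_inf \<omega> ^ Suc j \<partial>P) = (\<integral>z. z ^ Suc j \<partial>distr P borel zeta_inf)" for j
      by (subst integral_distr) auto
  qed simp
  show "converges_in_probability M (\<lambda>k \<omega>. infdist (lam k \<omega>) left_semicircle) 0"
    unfolding converges_in_probability_def
    using convergence_prob_from_mean[OF M lam c infdist_nonneg lam_infdist_mean[OF assms]]
    by (simp add: infdist_nonneg)
qed

lemma zeta_inf_far:
  assumes "a_inf = 1"
  shows "AE \<omega> in P. 1 \<le> norm (1 - zeta_inf \<omega>)"
proof -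
  have "AE \<omega> in P. max 0 (1 - norm (1 - zeta_inf \<omega>)) = 0"
  proof (rule zeta_AE_zero)
    show "(\<lambda>k. root_mean (pderiv (f k)) (\<lambda>x. max 0 (1 - norm (1 - x)))) \<longlonglongrightarrow> 0"
    proof (rule root_mean_squeeze_0)
      show "max 0 (1 - norm (1 - x)) \<le> 1 - a k" if x: "x \<in># proots (pderiv (f k))" for x k
      proof -
        have "norm (of_real (a k) - 1 :: complex) = 1 - a k"
          using a_bounds[of k] by (metis abs_minus_commute abs_of_nonneg diff_ge_0_iff_ge norm_of_real of_real_1 of_real_diff)
        moreover have "norm (of_real (a k) - x) \<le> norm (of_real (a k) - 1 :: complex) + norm (1 - x)"
          using norm_triangle_ineq[of "of_real (a k) - 1" "1 - x"] by simp
        ultimately show ?thesis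
          using zeta_far[OF x] a_bounds[of k] by (simp add: norm_minus_commute)
      qed
      have "(\<lambda>k. 1 - a k) \<longlonglongrightarrow> 1 - 1" using a_lim assms by (intro tendsto_intros) auto
      then show "(\<lambda>k. 1 - a k) \<longlonglongrightarrow> 0" by simp
    qed (auto simp: degrees)
  qed (auto intro!: continuous_intros)
  then show ?thesis by eventually_elim simp
qed

text \<open>The bounded continuous function \<open>\<phi>\<close> agrees with \<open>1 / (1 - z)\<close> at all critical points, so that the means
  of \<open>v = 1 / (a - \<zeta>)\<close> and of \<open>v\<^sup>2\<close> converge to the expectations of \<open>u\<close> and \<open>u\<^sup>2\<close>, where
  \<open>u = 1 / (1 - zeta_inf)\<close>. The limit inequality gives \<open>Re (E u) \<le> Re (E u\<^sup>2)\<close>, while pointwise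
  \<open>Re u - Re u\<^sup>2 = Re u (1 - Re u) + (Im u)\<^sup>2\<close> is nonnegative. So it vanishes almost surely, and
  \<open>Re u \<ge> 1/2\<close> leaves only \<open>u = 1\<close>.\<close>

lemma zeta_inf_zero:
  assumes one: "a_inf = 1"
  shows "AE \<omega> in P. zeta_inf \<omega> = 0"
    and "(\<lambda>k. root_mean (pderiv (f k)) (\<lambda>x. 1 / (of_real (a k) - x))) \<longlonglongrightarrow> 1"
proof -
  interpret P: prob_space P by (rule P)
  define \<phi> where "\<phi> = (\<lambda>z::complex. cnj (1 - z) / of_real ((max (norm (1 - z)) (1 / 2))\<^sup>2))"
  have c: "continuous_on UNIV \<phi>" unfolding \<phi>_def by (rule continuous_on_inverse_one_minus_cutoff)
  have c2: "continuous_on UNIV (\<lambda>z. (\<phi> z)\<^sup>2)" by (intro continuous_intros c)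
  have \<phi>_eq: "\<phi> z = 1 / (1 - z)" if "1 / 2 \<le> norm (1 - z)" for z
  proof -
    have "1 - z \<noteq> 0" using that by auto
    then have "cnj (1 - z) / ((1 - z) * cnj (1 - z)) = 1 / (1 - z)" by simp
    then show ?thesis using that unfolding \<phi>_def
      by (simp only: max_absorb1 complex_norm_square)
  qed
  define \<alpha> where "\<alpha> = (\<integral>\<omega>. \<phi> (zeta_inf \<omega>) \<partial>P)"
  define \<beta> where "\<beta> = (\<integral>\<omega>. (\<phi> (zeta_inf \<omega>))\<^sup>2 \<partial>P)"
  have \<delta>: "(\<lambda>k. 1 - a k) \<longlonglongrightarrow> 1 - 1" using a_lim one by (intro tendsto_intros) auto
  then have ev: "\<forall>\<^sub>F k in sequentially. 1 - a k < 1 / 2" by (rule order_tendstoD) simp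
  have near: "norm (1 / (of_real (a k) - x) - \<phi> x) \<le> 2 * (1 - a k) \<and> norm (\<phi> x) \<le> 2 \<and> norm (1 / (of_real (a k) - x)) \<le> 1"
    if k: "1 - a k < 1 / 2" and x: "x \<in># proots (pderiv (f k))" for k x
  proof -
    have na: "norm (of_real (a k) - 1 :: complex) = 1 - a k"
      using a_bounds[of k] by (metis abs_minus_commute abs_of_nonneg diff_ge_0_iff_ge norm_of_real of_real_1 of_real_diff)
    have "norm (of_real (a k) - x) \<le> norm (of_real (a k) - 1 :: complex) + norm (1 - x)"
      using norm_triangle_ineq[of "of_real (a k) - 1" "1 - x"] by simp
    moreover have far: "1 < norm (of_real (a k) - x)" using zeta_far[OF x] by (simp add: norm_minus_commute)
    ultimately have half: "1 / 2 \<le> norm (1 - x)" using na k by linarith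
    have ne: "1 - x \<noteq> 0" "of_real (a k) - x \<noteq> 0" using half far by auto
    have "1 / (of_real (a k) - x) - 1 / (1 - x) = (1 - of_real (a k)) / ((of_real (a k) - x) * (1 - x))"
      using ne by (simp add: field_simps)
    then have "norm (1 / (of_real (a k) - x) - \<phi> x) = (1 - a k) / (norm (of_real (a k) - x) * norm (1 - x))"
      using na by (simp add: \<phi>_eq[OF half] norm_divide norm_mult norm_minus_commute)
    also have "\<dots> \<le> (1 - a k) / (1 * (1 / 2))"
      using half far a_bounds[of k] by (intro divide_left_mono mult_mono mult_pos_pos) auto
    finally have "norm (1 / (of_real (a k) - x) - \<phi> x) \<le> 2 * (1 - a k)" by simp
    moreover have "norm (\<phi> x) \<le> 2" using half ne by (simp add: \<phi>_eq[OF half] norm_divide divide_le_eq)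
    moreover have "norm (1 / (of_real (a k) - x)) \<le> 1" using norm_inverse_critical_le[OF f x] .
    ultimately show ?thesis by blast
  qed
  have lim\<alpha>: "(\<lambda>k. root_mean (pderiv (f k)) (\<lambda>x. 1 / (of_real (a k) - x))) \<longlonglongrightarrow> \<alpha>"
  proof -
    have "(\<lambda>k. root_mean (pderiv (f k)) (\<lambda>x. 1 / (of_real (a k) - x)) - root_mean (pderiv (f k)) \<phi>) \<longlonglongrightarrow> 0"
    proof (rule Lim_null_comparison)
      show "\<forall>\<^sub>F k in sequentially. norm (root_mean (pderiv (f k)) (\<lambda>x. 1 / (of_real (a k) - x)) - root_mean (pderiv (f k)) \<phi>)
          \<le> 2 * (1 - a k)"
        using ev by eventually_elim (use near a_bounds in \<open>auto simp flip: root_mean_diff intro!: norm_root_mean_le\<close>)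
      show "(\<lambda>k. 2 * (1 - a k)) \<longlonglongrightarrow> 0" using tendsto_mult_left[OF \<delta>, of 2] by simp
    qed
    from tendsto_add[OF this zeta_mean_lim[OF c]] show ?thesis by (simp add: \<alpha>_def)
  qed
  have lim\<beta>: "(\<lambda>k. root_mean (pderiv (f k)) (\<lambda>x. (1 / (of_real (a k) - x))\<^sup>2)) \<longlonglongrightarrow> \<beta>"
  proof -
    have "(\<lambda>k. root_mean (pderiv (f k)) (\<lambda>x. (1 / (of_real (a k) - x))\<^sup>2) - root_mean (pderiv (f k)) (\<lambda>x. (\<phi> x)\<^sup>2)) \<longlonglongrightarrow> 0"
    proof (rule Lim_null_comparison)
      show "\<forall>\<^sub>F k in sequentially. norm (root_mean (pderiv (f k)) (\<lambda>x. (1 / (of_real (a k) - x))\<^sup>2) - root_mean (pderiv (f k)) (\<lambda>x. (\<phi> x)\<^sup>2))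
          \<le> 6 * (1 - a k)"
        using ev
      proof eventually_elim
        case (elim k)
        show ?case unfolding root_mean_diff[symmetric]
        proof (rule norm_root_mean_le)
          fix x assume x: "x \<in># proots (pderiv (f k))"
          define v where "v = 1 / (of_real (a k) - x)"
          have n: "norm (v - \<phi> x) \<le> 2 * (1 - a k)" "norm (\<phi> x) \<le> 2" "norm v \<le> 1"
            using near[OF elim x] by (auto simp only: v_def)
          have "norm (v\<^sup>2 - (\<phi> x)\<^sup>2) = norm (v - \<phi> x) * norm (v + \<phi> x)"
            by (simp add: norm_mult[symmetric] power2_eq_square algebra_simps)
          also have "norm (v + \<phi> x) \<le> 3" using norm_triangle_ineq[of v "\<phi> x"] n by linarith
          then have "norm (v - \<phi> x) * norm (v + \<phi> x) \<le> 2 * (1 - a k) * 3"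
            using n a_bounds[of k] by (intro mult_mono) auto
          finally show "norm ((1 / (of_real (a k) - x))\<^sup>2 - (\<phi> x)\<^sup>2) \<le> 6 * (1 - a k)"
            by (simp add: v_def)
        qed (use a_bounds in auto)
      qed
      show "(\<lambda>k. 6 * (1 - a k)) \<longlonglongrightarrow> 0" using tendsto_mult_left[OF \<delta>, of 6] by simp
    qed
    from tendsto_add[OF this zeta_mean_lim[OF c2]] show ?thesis by (simp add: \<beta>_def)
  qed
  have v: "AE \<omega> in P. \<phi> (zeta_inf \<omega>) = 1 / (1 - zeta_inf \<omega>) \<and> norm (\<phi> (zeta_inf \<omega>)) \<le> 1 \<and> 1 / 2 \<le> Re (\<phi> (zeta_inf \<omega>))"
    using zeta_inf_far[OF one] AE_space
  proof eventually_elim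
    case (elim \<omega>)
    have "zeta_inf \<omega> \<noteq> 1" using elim by auto
    then have "1 / 2 \<le> Re (1 / (1 - zeta_inf \<omega>))"
      using zeta_inf_range[of \<omega>] elim by (intro Re_inverse_one_minus_ge_half) auto
    then show ?case using elim by (simp add: \<phi>_eq norm_divide divide_le_eq_1)
  qed
  have int: "integrable P (\<lambda>\<omega>. \<phi> (zeta_inf \<omega>))" "integrable P (\<lambda>\<omega>. (\<phi> (zeta_inf \<omega>))\<^sup>2)"
    by (intro integrable_continuous_disc_rv[OF P zeta_inf_rv zeta_inf_range] c c2; assumption)+
  have Re\<alpha>: "Re \<alpha> = (\<integral>\<omega>. Re (\<phi> (zeta_inf \<omega>)) \<partial>P)" "Re \<beta> = (\<integral>\<omega>. Re ((\<phi> (zeta_inf \<omega>))\<^sup>2) \<partial>P)"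
    unfolding \<alpha>_def \<beta>_def using int by (auto simp del: Re_power2)
  have "(\<integral>\<omega>. 1 / 2 \<partial>P) \<le> Re \<alpha>"
    unfolding Re\<alpha> by (rule integral_mono_AE) (use v int in auto)
  then have "1 / 2 \<le> Re \<alpha>" by (simp add: P.prob_space)
  then have "Re \<alpha> \<le> Re \<beta>"
    using a_lim one by (intro critical_moments_limit[OF f deg _ lim\<alpha> lim\<beta>]) auto
  moreover have gap: "0 \<le> Re u - Re (u\<^sup>2)" if "norm u \<le> 1" "1 / 2 \<le> Re u" for u :: complex
  proof -
    have "Re u \<le> 1" using complex_Re_le_cmod[of u] that by linarith
    then have "Re u * Re u \<le> Re u" using that by (simp add: mult_left_le)
    then show ?thesis by (simp add: power2_eq_square) (smt (verit) zero_le_square)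
  qed
  define G where "G = (\<lambda>\<omega>. Re (\<phi> (zeta_inf \<omega>)) - Re ((\<phi> (zeta_inf \<omega>))\<^sup>2))"
  have G: "integrable P G" "AE \<omega> in P. 0 \<le> G \<omega>"
    unfolding G_def using int v gap by (auto simp del: Re_power2)
  have "(\<integral>\<omega>. G \<omega> \<partial>P) = Re \<alpha> - Re \<beta>" unfolding Re\<alpha> G_def using int by (auto simp del: Re_power2)
  ultimately have "(\<integral>\<omega>. G \<omega> \<partial>P) = 0" using integral_nonneg_AE[OF G(2)] by simp
  then have "AE \<omega> in P. G \<omega> = 0" using G by (simp add: integral_nonneg_eq_0_iff_AE)
  then show zero: "AE \<omega> in P. zeta_inf \<omega> = 0"
    using v zeta_inf_far[OF one]
  proof eventually_elim
    case (elim \<omega>)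
    define u where "u = \<phi> (zeta_inf \<omega>)"
    have u: "norm u \<le> 1" "1 / 2 \<le> Re u" "Re u = Re u * Re u - Im u * Im u"
      using elim by (auto simp: u_def G_def power2_eq_square)
    have re: "Re u \<le> 1" using complex_Re_le_cmod[of u] u by linarith
    then have "Re u * Re u \<le> Re u" using u by (simp add: mult_left_le)
    moreover have "0 \<le> Im u * Im u" by simp
    ultimately have "Im u * Im u = 0" "Re u * Re u = Re u" using u(3) by linarith+
    then have "u = 1" using u by (auto simp: complex_eq_iff)
    moreover have "zeta_inf \<omega> \<noteq> 1" using elim by auto
    ultimately show ?case using elim by (simp add: u_def)
  qed
  have "\<alpha> = (\<integral>\<omega>. 1 \<partial>P)"
    unfolding \<alpha>_def
  proof (rule integral_cong_AE)
    show "AE \<omega> in P. \<phi> (zeta_inf \<omega>) = 1" using zero by eventually_elim (simp add: \<phi>_eq)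
  qed (use int in auto)
  then show "(\<lambda>k. root_mean (pderiv (f k)) (\<lambda>x. 1 / (of_real (a k) - x))) \<longlonglongrightarrow> 1"
    using lim\<alpha> by (simp add: P.prob_space)
qed

lemma eventually_log_means:
  assumes one: "a_inf = 1"
  shows "\<forall>\<^sub>F k in sequentially. poly (f k) 0 \<noteq> 0 \<and>
      root_mean (f k) (\<lambda>x. ln (1 / norm x)) \<le> 2 * ln 2 / degree (f k) \<and>
      root_mean (pderiv (f k)) (\<lambda>x. ln (norm (x - of_real (a k)))) \<le> 2 * ln 2 / degree (f k)"
proof -
  have "\<forall>\<^sub>F k in sequentially. norm (poly (pderiv (f k)) (of_real (a k)))
      \<le> 2 * degree (pderiv (f k)) * norm (poly (f k) 0)"
    using a_lim one by (intro eventually_pderiv_le_value_at_0[OF f deg] zeta_inf_zero(2)) auto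
  then show ?thesis
    by eventually_elim (use root_means_log_le[OF f] in auto)
qed

text \<open>Since \<open>1 - |\<lambda>| \<le> ln (1 / |\<lambda>|)\<close>, the logarithmic bound puts \<open>lam_inf\<close> on the circle, where it is
  identified by its moments: they are those of \<open>zeta_inf = 0\<close>.\<close>

lemma a_near_one:
  assumes one: "a_inf = 1"
  shows "distr P borel lam_inf = uniform_unit_circle" "AE \<omega> in P. zeta_inf \<omega> = 0"
    "converges_in_probability M (\<lambda>k \<omega>. norm (lam k \<omega>)) 1"
    "converges_in_probability M zeta 0"
    "\<exists>A\<ge>0. \<forall>\<^sub>F k in sequentially.
       (\<integral>\<^sup>+\<omega>. log_recip (norm (lam k \<omega>)) \<partial>M k) \<le> ennreal (A / degree (f k)) \<and>
       (\<integral>\<^sup>+\<omega>. ennreal (ln (norm (zeta k \<omega> - of_real (a k)))) \<partial>M k) \<le> ennreal (A / degree (f k))"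
proof -
  interpret P: prob_space P by (rule P)
  show zero: "AE \<omega> in P. zeta_inf \<omega> = 0" by (rule zeta_inf_zero[OF one])
  have cn: "continuous_on UNIV (\<lambda>z::complex. \<bar>norm z - 1\<bar>)" by (intro continuous_intros)
  have lam_mean: "(\<lambda>k. root_mean (f k) (\<lambda>x. \<bar>norm x - 1\<bar>)) \<longlonglongrightarrow> 0"
  proof (rule tendsto_sandwich[OF _ _ tendsto_const])
    have "(\<lambda>n. 2 * ln 2 / real n) \<longlonglongrightarrow> 0" by real_asymp
    from filterlim_compose[OF this deg] show "(\<lambda>k. 2 * ln 2 / real (degree (f k))) \<longlonglongrightarrow> 0" .
    show "\<forall>\<^sub>F k in sequentially. 0 \<le> root_mean (f k) (\<lambda>x. \<bar>norm x - 1\<bar>)"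
      using root_mean_mono[of "f _" "\<lambda>_. 0" "\<lambda>x. \<bar>norm x - 1\<bar>"] by (simp add: degrees)
    show "\<forall>\<^sub>F k in sequentially. root_mean (f k) (\<lambda>x. \<bar>norm x - 1\<bar>) \<le> 2 * ln 2 / real (degree (f k))"
      using eventually_log_means[OF one]
    proof eventually_elim
      case (elim k)
      have "root_mean (f k) (\<lambda>x. \<bar>norm x - 1\<bar>) \<le> root_mean (f k) (\<lambda>x. ln (1 / norm x))"
      proof (rule root_mean_mono)
        fix x assume x: "x \<in># proots (f k)"
        then have "norm x > 0" using elim by (cases "f k = 0") auto
        then have "ln (norm x) \<le> norm x - 1" "ln (1 / norm x) = - ln (norm x)"
          by (auto simp: ln_le_minus_one ln_div)
        then show "\<bar>norm x - 1\<bar> \<le> ln (1 / norm x)" using lam_roots[OF x] by simp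
      qed
      with elim show ?case by simp
    qed
  qed
  have circ: "AE \<omega> in P. norm (lam_inf \<omega>) = 1"
    using lam_AE_zero[OF cn _ lam_mean] by simp
  show "distr P borel lam_inf = uniform_unit_circle"
  proof (rule distr_eqI_circle[OF circ prob_space_uniform_unit_circle _ AE_uniform_unit_circle])
    show "sets uniform_unit_circle = sets borel" by (simp add: uniform_unit_circle_def)
    show "(\<integral>\<omega>. zeta_inf \<omega> ^ Suc j \<partial>P) = (\<integral>z. z ^ Suc j \<partial>uniform_unit_circle)" for j
    proof -
      have "(\<integral>\<omega>. zeta_inf \<omega> ^ Suc j \<partial>P) = (\<integral>\<omega>. 0 \<partial>P)"
        using zero zeta_inf_rv by (intro integral_cong_AE) auto
      then show ?thesis by (simp add: moment_uniform_unit_circle del: power_Suc)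
    qed
  qed
  show "converges_in_probability M (\<lambda>k \<omega>. norm (lam k \<omega>)) 1"
    unfolding converges_in_probability_def
    using convergence_prob_from_mean[OF M lam cn _ lam_mean] by simp
  have "(\<lambda>k. root_mean (pderiv (f k)) norm) \<longlonglongrightarrow> (\<integral>\<omega>. norm (zeta_inf \<omega>) \<partial>P)"
    by (rule root_mean_tendsto_integral_real[OF M zeta zeta_roots zeta_inf_range zeta_lim])
      (auto intro!: continuous_intros)
  also have "(\<integral>\<omega>. norm (zeta_inf \<omega>) \<partial>P) = (\<integral>\<omega>. 0 \<partial>P)"
    using zero zeta_inf_rv by (intro integral_cong_AE) auto
  finally have "(\<lambda>k. root_mean (pderiv (f k)) norm) \<longlonglongrightarrow> 0" by simp
  then show "converges_in_probability M zeta 0"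
    unfolding converges_in_probability_def
    using convergence_prob_from_mean[OF M zeta, of norm] by (simp add: continuous_on_norm_id)
  have "\<forall>\<^sub>F k in sequentially.
       (\<integral>\<^sup>+\<omega>. log_recip (norm (lam k \<omega>)) \<partial>M k) \<le> ennreal (2 * ln 2 / degree (f k)) \<and>
       (\<integral>\<^sup>+\<omega>. ennreal (ln (norm (zeta k \<omega> - of_real (a k)))) \<partial>M k) \<le> ennreal (2 * ln 2 / degree (f k))"
    using eventually_log_means[OF one]
  proof eventually_elim
    case (elim k)
    have nz: "norm x > 0" if "x \<in># proots (f k)" for x using that elim by (cases "f k = 0") auto
    have "(\<integral>\<^sup>+\<omega>. log_recip (norm (lam k \<omega>)) \<partial>M k) = (\<integral>\<^sup>+\<omega>. ennreal (ln (1 / norm (lam k \<omega>))) \<partial>M k)"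
    proof (rule nn_integral_cong)
      fix \<omega> assume "\<omega> \<in> space (M k)"
      then have "norm (lam k \<omega>) > 0" using lam[of k] nz by (auto simp: uniform_random_zero_def)
      then show "log_recip (norm (lam k \<omega>)) = ennreal (ln (1 / norm (lam k \<omega>)))" by (simp add: log_recip_def)
    qed
    also have "\<dots> = ennreal (root_mean (f k) (\<lambda>x. ln (1 / norm x)))"
    proof (rule nn_integral_uniform_random_zero[OF M lam])
      fix x assume x: "x \<in># proots (f k)"
      show "0 \<le> ln (1 / norm x)" using nz[OF x] lam_roots[OF x] by simp
    qed
    also have "\<dots> \<le> ennreal (2 * ln 2 / degree (f k))" using elim by (intro ennreal_leI) auto
    finally have 1: "(\<integral>\<^sup>+\<omega>. log_recip (norm (lam k \<omega>)) \<partial>M k) \<le> ennreal (2 * ln 2 / degree (f k))" .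
    have "(\<integral>\<^sup>+\<omega>. ennreal (ln (norm (zeta k \<omega> - of_real (a k)))) \<partial>M k)
        = ennreal (root_mean (pderiv (f k)) (\<lambda>x. ln (norm (x - of_real (a k)))))"
      by (rule nn_integral_uniform_random_zero[OF M zeta]) (use zeta_far in \<open>force intro: less_imp_le\<close>)
    also have "\<dots> \<le> ennreal (2 * ln 2 / degree (f k))" using elim by (intro ennreal_leI) auto
    finally show ?case using 1 by simp
  qed
  moreover have "0 \<le> 2 * ln (2::real)" by simp
  ultimately show "\<exists>A\<ge>0. \<forall>\<^sub>F k in sequentially.
       (\<integral>\<^sup>+\<omega>. log_recip (norm (lam k \<omega>)) \<partial>M k) \<le> ennreal (A / degree (f k)) \<and>
       (\<integral>\<^sup>+\<omega>. ennreal (ln (norm (zeta k \<omega> - of_real (a k)))) \<partial>M k) \<le> ennreal (A / degree (f k))"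
    by blast
qed

end

text \<open>Compares the error term obtained from the moments with the one in the statement.\<close>

lemma inverse_sqrt_le_log:
  assumes "2 \<le> n" shows "1 / sqrt (real n) \<le> 2 * (ln (real n) / real n powr (1 / 3))"
proof -
  have "ln 2 \<le> ln (real n)" using assms by simp
  moreover have "1 / 2 \<le> ln (2::real)" using ln_le_minus_one[of "1 / 2 :: real"] by (simp add: ln_div)
  ultimately have "1 \<le> 2 * ln (real n)" by linarith
  have "real n powr (1 / 3) \<le> real n powr (1 / 2)" using assms by (intro powr_mono) auto
  then have "real n powr (1 / 3) \<le> sqrt (real n)" by (simp add: powr_half_sqrt)
  then have "1 / sqrt (real n) \<le> 1 / real n powr (1 / 3)"
    using assms by (intro divide_left_mono mult_pos_pos) auto
  also have "\<dots> \<le> 2 * ln (real n) / real n powr (1 / 3)"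
    using \<open>1 \<le> 2 * ln (real n)\<close> by (intro divide_right_mono) auto
  finally show ?thesis by simp
qed

theorem theorem1p10:
  fixes N :: "nat \<Rightarrow> nat"
    and f :: "nat \<Rightarrow> complex poly"
    and a :: "nat \<Rightarrow> real" and a_inf :: real
    and M :: "nat \<Rightarrow> 'a measure"
    and lam zeta :: "nat \<Rightarrow> 'a \<Rightarrow> complex"
    and P :: "'b measure"
    and lam_inf zeta_inf :: "'b \<Rightarrow> complex"
  assumes N_ge: "\<And>k. N k \<ge> 2"
    and N_lim: "filterlim N at_top sequentially"
    and f_monic: "\<And>n. n \<in> range N \<Longrightarrow> lead_coeff (f n) = 1"
    and f_degree: "\<And>n. n \<in> range N \<Longrightarrow> degree (f n) = n"
    and f_zeroes: "\<And>n z. n \<in> range N \<Longrightarrow> poly (f n) z = 0 \<Longrightarrow> z \<in> cball 0 1"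
    and a_range: "\<And>n. n \<in> range N \<Longrightarrow> a n \<in> {0..1}"
    and a_zero: "\<And>n. n \<in> range N \<Longrightarrow> poly (f n) (of_real (a n)) = 0"
    and f'_zeroes: "\<And>n z. n \<in> range N \<Longrightarrow> z \<in> cball (of_real (a n)) 1 \<Longrightarrow> poly (pderiv (f n)) z \<noteq> 0"
    and a_inf_range: "a_inf \<in> {0..1}"
    and a_lim: "(\<lambda>k. a (N k)) \<longlonglongrightarrow> a_inf"
    and M_prob: "\<And>n. n \<in> range N \<Longrightarrow> prob_space (M n)"
    and lam_unif: "\<And>n. n \<in> range N \<Longrightarrow> uniform_random_zero (M n) (lam n) (f n)"
    and zeta_unif: "\<And>n. n \<in> range N \<Longrightarrow> uniform_random_zero (M n) (zeta n) (pderiv (f n))"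
    and indep: "\<And>n. n \<in> range N \<Longrightarrow> prob_space.indep_var (M n) borel (lam n) borel (zeta n)"
    and P_prob: "prob_space P"
    and lam_inf_rv: "lam_inf \<in> borel_measurable P"
    and zeta_inf_rv: "zeta_inf \<in> borel_measurable P"
    and lam_inf_range: "\<And>\<omega>. \<omega> \<in> space P \<Longrightarrow> lam_inf \<omega> \<in> cball 0 1"
    and zeta_inf_range: "\<And>\<omega>. \<omega> \<in> space P \<Longrightarrow> zeta_inf \<omega> \<in> cball 0 1"
    and lam_lim: "converges_in_distribution (\<lambda>k. M (N k)) (\<lambda>k. lam (N k)) P lam_inf"
    and zeta_lim: "converges_in_distribution (\<lambda>k. M (N k)) (\<lambda>k. zeta (N k)) P zeta_inf"
  shows
    "(a_inf = 0 \<longrightarrow>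
        (AE \<omega> in P. lam_inf \<omega> \<in> left_semicircle) \<and>
        (AE \<omega> in P. zeta_inf \<omega> \<in> left_semicircle) \<and>
        distr P borel lam_inf = distr P borel zeta_inf \<and>
        converges_in_probability (\<lambda>k. M (N k))
          (\<lambda>k \<omega>. infdist (lam (N k) \<omega>) left_semicircle) 0 \<and>
        (\<forall>K. compact K \<and> K \<subseteq> cball 0 1 - left_semicircle \<longrightarrow>
          (\<exists>A::real. \<forall>n \<in> range N.
             measure (M n) {\<omega> \<in> space (M n). lam n \<omega> \<in> K}
               \<le> A * (a n + ln (real n) / real n powr (1 / 3)))))
     \<and>
     (a_inf = 1 \<longrightarrow>
        distr P borel lam_inf = uniform_unit_circle \<and>
        (AE \<omega> in P. zeta_inf \<omega> = 0) \<and>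
        converges_in_probability (\<lambda>k. M (N k)) (\<lambda>k \<omega>. norm (lam (N k) \<omega>)) 1 \<and>
        converges_in_probability (\<lambda>k. M (N k)) (\<lambda>k. zeta (N k)) 0 \<and>
        (\<exists>A::real. A \<ge> 0 \<and> (\<forall>\<^sub>F k in sequentially.
           (\<integral>\<^sup>+\<omega>. log_recip (norm (lam (N k) \<omega>)) \<partial>M (N k)) \<le> ennreal (A / real (N k)) \<and>
           (\<integral>\<^sup>+\<omega>. ennreal (ln (norm (zeta (N k) \<omega> - of_real (a (N k))))) \<partial>M (N k))
             \<le> ennreal (A / real (N k)))))"
proof -
  have exc: "sendov_exception (f n) (a n)" if n: "n \<in> range N" for n
  proof -
    have "2 \<le> n" using n N_ge by auto
    moreover have "1 < norm (z - of_real (a n))" if "poly (pderiv (f n)) z = 0" for z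
    proof -
      have "z \<notin> cball (of_real (a n)) 1" using f'_zeroes[OF n] that by blast
      then show ?thesis by (simp add: dist_norm norm_minus_commute)
    qed
    ultimately show ?thesis
      using f_monic[OF n] f_degree[OF n] f_zeroes[OF n] a_range[OF n] a_zero[OF n]
      by (auto simp: sendov_exception_def)
  qed
  have degN: "degree (f (N k)) = N k" for k by (rule f_degree) simp
  interpret S: sendov_sequence "\<lambda>k. f (N k)" "\<lambda>k. a (N k)" a_inf "\<lambda>k. M (N k)"
    "\<lambda>k. lam (N k)" "\<lambda>k. zeta (N k)" P lam_inf zeta_inf
    by (rule sendov_sequence.intro)
      (use exc N_lim a_lim M_prob lam_unif zeta_unif P_prob lam_inf_rv zeta_inf_rv lam_inf_range
        zeta_inf_range lam_lim zeta_lim in \<open>simp_all add: degN\<close>)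
  have bound: "\<exists>A::real. \<forall>n \<in> range N. measure (M n) {\<omega> \<in> space (M n). lam n \<omega> \<in> K}
      \<le> A * (a n + ln (real n) / real n powr (1 / 3))"
    if K: "compact K" "K \<subseteq> cball 0 1 - left_semicircle" for K
  proof -
    obtain A where A: "0 \<le> A"
      "\<And>f a. sendov_exception f a \<Longrightarrow> root_mean f (indicator K) \<le> A * (a + 1 / sqrt (degree f))"
      using root_mean_indicator_compact_le[OF K] by blast
    have "measure (M n) {\<omega> \<in> space (M n). lam n \<omega> \<in> K} \<le> 2 * A * (a n + ln (real n) / real n powr (1 / 3))"
      if n: "n \<in> range N" for n
    proof -
      have "2 \<le> n" using n N_ge by auto
      have "measure (M n) {\<omega> \<in> space (M n). lam n \<omega> \<in> K} = root_mean (f n) (indicator K)"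
        using M_prob[OF n] lam_unif[OF n] K by (intro prob_uniform_random_zero) (auto intro: borel_compact)
      also have "\<dots> \<le> A * (a n + 1 / sqrt (real n))"
        using A(2)[OF exc[OF n]] f_degree[OF n] by simp
      also have "\<dots> \<le> A * (2 * (a n + ln (real n) / real n powr (1 / 3)))"
        using A(1) inverse_sqrt_le_log[OF \<open>2 \<le> n\<close>] a_range[OF n] by (intro mult_left_mono) auto
      finally show ?thesis by (simp only: mult_ac)
    qed
    then show ?thesis by blast
  qed
  show ?thesis
    using S.a_near_zero bound S.a_near_one by (simp add: degN)
qed

end
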